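(* Let $a<b$ be real numbers, let $p\in[1,\infty]$, and let $h\in\mathcal{C}^1[a,b]$ be a real-valued function with $h'(t)>0$ for all $t\in[a,b]$. Let $L^p[a,b]$ denote the Banach space of (classes of) real-valued $p$-integrable functions on $[a,b]$ (essentially bounded functions if $p=\infty$). Then there is exactly one family $(J_{h,a^+}^{\alpha})_{\alpha>0}$ of operators in $\mathcal{B}(L^p[a,b])$, indexed by the positive real numbers $\alpha$, satisfying the following three conditions: 1. (Interpolation property) $J_{h,a^+}^{1}=I_{h,a^+}^{1}$, i.e. $(J_{h,a^+}^{1}f)(t)=\int_a^t f(s)\,h'(s)\,ds$ for every $f\in L^p[a,b]$ and almost every $t\in[a,b]$. 2. (Index Law) $J_{h,a^+}^{\alpha}\circ J_{h,a^+}^{\beta}=J_{h,a^+}^{\alpha+\beta}$ for all real $\alpha,\beta>0$. 3. (Continuity) The map $\mathbb{R}^+\to\mathcal{B}(L^p[a,b])$, $\alpha\mapsto J_{h,a^+}^{\alpha}$, is continuous, where $\mathcal{B}(L^p[a,b])$ carries the operator norm topology. This unique family is given by the Riemann-Liouville fractional integrals with respect to $h$, that is, $J_{h,a^+}^{\alpha}=I_{h,a^+}^{\alpha}$ for all $\alpha>0$.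
   Context: $\mathbb{R}^+$ is the set of strictly positive real numbers. $\mathcal{B}(L^p[a,b])$ is the space of continuous linear operators from $L^p[a,b]$ to itself. Identities between elements of $L^p[a,b]$ are understood to hold almost everywhere with respect to Lebesgue measure. For $\alpha>0$, the Riemann-Liouville fractional integral of order $\alpha$ and base point $a$ with respect to $h$ of a function $f\in L^p[a,b]$ is $$\left(I_{h,a^+}^{\alpha}f\right)(t):=\int_a^t\frac{(h(t)-h(s))^{\alpha-1}}{\Gamma(\alpha)}\,f(s)\,h'(s)\,ds,$$ where $\Gamma$ is Euler's Gamma function. For each $\alpha>0$ this defines an element of $\mathcal{B}(L^p[a,b])$; for $\alpha=1$ it is the Stieltjes integral operator with integrator $h$. *)

theory Defs
  imports "HOL-Analysis.Analysis" "HOL-Probability.Essential_Supremum"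
begin

text \<open>
  The library has no \<open>L\<^sup>p\<close> spaces. Elements are represented here by functions, two functions
  standing for the same element iff they agree almost everywhere; operators act on
  representatives, and equality of operators is almost everywhere equality of all their values.
\<close>

definition Lp_space :: "ennreal \<Rightarrow> 'a measure \<Rightarrow> ('a \<Rightarrow> real) set" where
  "Lp_space p M = {f \<in> borel_measurable M.
     if p = \<infinity> then esssup M (\<lambda>x. ereal \<bar>f x\<bar>) < \<infinity>
     else integrable M (\<lambda>x. \<bar>f x\<bar> powr enn2real p)}"

definition Lp_norm :: "ennreal \<Rightarrow> 'a measure \<Rightarrow> ('a \<Rightarrow> real) \<Rightarrow> real" where
  "Lp_norm p M f =
     (if p = \<infinity> then real_of_ereal (esssup M (\<lambda>x. ereal \<bar>f x\<bar>))
      else (LINT x|M. \<bar>f x\<bar> powr enn2real p) powr (1 / enn2real p))"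

definition Lp_op_eq ::
    "ennreal \<Rightarrow> 'a measure \<Rightarrow> (('a \<Rightarrow> real) \<Rightarrow> 'a \<Rightarrow> real) \<Rightarrow> (('a \<Rightarrow> real) \<Rightarrow> 'a \<Rightarrow> real) \<Rightarrow> bool" where
  "Lp_op_eq p M S T \<longleftrightarrow> (\<forall>f\<in>Lp_space p M. AE x in M. S f x = T f x)"

text \<open>The second conjunct says that \<open>T\<close> descends to classes of functions.\<close>

definition Lp_bounded_operator ::
    "ennreal \<Rightarrow> 'a measure \<Rightarrow> (('a \<Rightarrow> real) \<Rightarrow> 'a \<Rightarrow> real) \<Rightarrow> bool" where
  "Lp_bounded_operator p M T \<longleftrightarrow>
     (\<forall>f\<in>Lp_space p M. T f \<in> Lp_space p M) \<and>
     (\<forall>f\<in>Lp_space p M. \<forall>g\<in>Lp_space p M.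
        (AE x in M. f x = g x) \<longrightarrow> (AE x in M. T f x = T g x)) \<and>
     (\<forall>f\<in>Lp_space p M. \<forall>g\<in>Lp_space p M.
        AE x in M. T (\<lambda>y. f y + g y) x = T f x + T g x) \<and>
     (\<forall>c. \<forall>f\<in>Lp_space p M. AE x in M. T (\<lambda>y. c * f y) x = c * T f x) \<and>
     (\<exists>C. \<forall>f\<in>Lp_space p M. Lp_norm p M (T f) \<le> C * Lp_norm p M f)"

text \<open>Meaningful for bounded operators only, since the supremum is taken in the reals.\<close>

definition Lp_onorm :: "ennreal \<Rightarrow> 'a measure \<Rightarrow> (('a \<Rightarrow> real) \<Rightarrow> 'a \<Rightarrow> real) \<Rightarrow> real" where
  "Lp_onorm p M T = (SUP f\<in>{f \<in> Lp_space p M. Lp_norm p M f \<le> 1}. Lp_norm p M (T f))"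

text \<open>
  The argument \<open>h'\<close> stands for the derivative of \<open>h\<close>. The value is only relevant for almost every
  \<open>t\<close>: for \<open>\<alpha> < 1\<close> the integrand can fail to be integrable on a null set of \<open>t\<close>. The convention
  \<open>0 powr x = 0\<close> only affects the single point \<open>s = t\<close>.
\<close>

definition RL_integral ::
    "(real \<Rightarrow> real) \<Rightarrow> (real \<Rightarrow> real) \<Rightarrow> real \<Rightarrow> real \<Rightarrow> (real \<Rightarrow> real) \<Rightarrow> real \<Rightarrow> real" where
  "RL_integral h h' a \<alpha> f t =
     (LINT s:{a..t}|lebesgue. (h t - h s) powr (\<alpha> - 1) / Gamma \<alpha> * f s * h' s)"

text \<open>
  Families indexed by the positive reals are functions on all reals whose values at
  nonpositive arguments are ignored.
\<close>

definition fractional_integral_family ::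
    "ennreal \<Rightarrow> real \<Rightarrow> real \<Rightarrow> (real \<Rightarrow> real) \<Rightarrow> (real \<Rightarrow> (real \<Rightarrow> real) \<Rightarrow> real \<Rightarrow> real) \<Rightarrow> bool" where
  "fractional_integral_family p a b h' J \<longleftrightarrow>
     (\<forall>\<alpha>>0. Lp_bounded_operator p (lebesgue_on {a..b}) (J \<alpha>)) \<and>
     Lp_op_eq p (lebesgue_on {a..b}) (J 1) (\<lambda>f t. LINT s:{a..t}|lebesgue. f s * h' s) \<and>
     (\<forall>\<alpha>>0. \<forall>\<beta>>0. Lp_op_eq p (lebesgue_on {a..b}) (J \<alpha> \<circ> J \<beta>) (J (\<alpha> + \<beta>))) \<and>
     (\<forall>\<alpha>>0. ((\<lambda>\<beta>. Lp_onorm p (lebesgue_on {a..b}) (\<lambda>f t. J \<beta> f t - J \<alpha> f t)) \<longlongrightarrow> 0)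
        (at \<alpha> within {0<..}))"

end

theory Submission imports Defs begin

text \<open>
  In the variable \<open>u = h(t) - h(s)\<close> the Riemann-Liouville operators are convolutions on an
  interval with the kernels \<open>u\<^bsup>\<alpha>-1\<^esup>/\<Gamma>(\<alpha>)\<close>.

  Existence. Young's inequality (\<open>conv_op_Lp\<close>) bounds the operator norm of a convolution by a
  constant times the \<open>L\<^sup>1\<close> norm of its kernel, which gives boundedness and, as the kernels depend
  continuously on \<open>\<alpha>\<close> in \<open>L\<^sup>1\<close>, continuity in the operator norm. The index law is Euler's Beta
  integral (\<open>frac_kernel_conv\<close>) combined with Fubini's theorem (\<open>conv_op_conv_op\<close>).

  Uniqueness. Let \<open>V\<close> be the operator of order 1 and \<open>L = h(b) - h(a)\<close>. By the index law all
  \<open>J\<^sup>\<alpha>\<close> commute with \<open>V\<close>. By continuity it suffices to know them for dyadic \<open>\<alpha>\<close>, and by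
  the index law for \<open>\<alpha> = 2\<^bsup>-n\<^esup>\<close>. Thus the problem is to take square roots: if \<open>J\<^sup>\<alpha>\<close> is the
  fractional integral of order \<open>\<alpha>\<close>, then \<open>J\<^bsup>\<alpha>/2\<^esup>\<close> is the one of order \<open>\<alpha>/2\<close>.

  Commuting operators are convolutions in disguise, and one would like to factor \<open>A\<^sup>2 - B\<^sup>2\<close> and
  invoke Titchmarsh's theorem on zero divisors, which on a bounded interval allows nilpotent
  elements. Instead, an operator \<open>R\<close> that commutes with \<open>V\<close> is given a Laplace transform
  \<open>\<phi>\<^sub>R(x) = \<integral> exp (- x (h - h(a))) (R 1) dh\<close>. Since \<open>V R\<close> maps the exponential \<open>exp (x (h - h(a)))\<close>
  to \<open>\<phi>\<^sub>R(x)\<close> times itself up to an error bounded in \<open>x\<close>, one has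
  \<open>\<phi>\<^sub>S(x) \<phi>\<^sub>T(x) = \<phi>\<^bsub>ST\<^esub>(x) / x + O(exp (- x L))\<close> (\<open>laplace_multiplicative\<close>). For \<open>A = J\<^bsup>\<alpha>/2\<^esup>\<close> and the fractional integral \<open>B\<close>
  of the same order this makes \<open>\<phi>\<^sub>A\<^sup>2 - \<phi>\<^sub>B\<^sup>2\<close> of that size. As \<open>A\<close> is the square of \<open>J\<^bsup>\<alpha>/4\<^esup>\<close>, its
  transform is nonnegative up to an exponentially small error, while \<open>\<phi>\<^sub>B\<close> is positive and decays more slowly
  than any exponential. So \<open>\<phi>\<^sub>A + \<phi>\<^sub>B\<close> can be divided out, and \<open>\<phi>\<^sub>A - \<phi>\<^sub>B\<close> is
  \<open>O(exp (- x (L - \<delta>)))\<close> for every \<open>\<delta> > 0\<close>. Mikusinski's moment argument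
  (\<open>integral_superlevel_zero_if_moments_small\<close>) then yields \<open>A 1 = B 1\<close>
  (\<open>square_root_apply_one\<close>), and a bounded operator that commutes with \<open>V\<close> is determined by its
  value at 1 (\<open>commutes_with_V_eqI\<close>).
\<close>

section \<open>Lebesgue spaces over a finite measure\<close>

lemma Lp_space_measurable: "f \<in> Lp_space p M \<Longrightarrow> f \<in> borel_measurable M"
  by (simp add: Lp_space_def)

lemma enn2real_ge_1: "1 \<le> p \<Longrightarrow> p \<noteq> \<infinity> \<Longrightarrow> 1 \<le> enn2real p"
  using enn2real_mono[of 1 p] by (simp add: less_top)

lemma powr_le_cancel:
  fixes x y :: real
  assumes "x powr q \<le> y powr q" "0 < q" "0 \<le> x" "0 \<le> y"
  shows "x \<le> y"
  using powr_less_mono2[of q y x] assms by (meson not_le)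

lemma Lp_norm_nonneg: "0 \<le> Lp_norm p M f"
proof (cases "p = \<infinity>")
  case True
  have "0 \<le> real_of_ereal (esssup M (\<lambda>x. ereal \<bar>f x\<bar>))"
  proof (cases "(\<lambda>x. ereal \<bar>f x\<bar>) \<in> borel_measurable M")
    case meas: True
    show ?thesis
    proof (cases "emeasure M (space M) = 0")
      case True
      then show ?thesis using esssup_zero_space[OF True meas] by simp
    next
      case False
      have "esssup M (\<lambda>x. 0::ereal) \<le> esssup M (\<lambda>x. ereal \<bar>f x\<bar>)"
        by (rule esssup_mono) auto
      then show ?thesis using esssup_const[OF False, of "0::ereal"]
        by (simp add: real_of_ereal_pos)
    qed
  next
    case False
    then show ?thesis using esssup_non_measurable[OF False] by (simp add: top_ereal_def)
  qed
  then show ?thesis using True by (simp add: Lp_norm_def)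
qed (simp add: Lp_norm_def)

lemma AE_le_Lp_norm_infinity:
  assumes "f \<in> Lp_space \<infinity> M"
  shows "AE x in M. \<bar>f x\<bar> \<le> Lp_norm \<infinity> M f"
proof -
  have fin: "esssup M (\<lambda>x. ereal \<bar>f x\<bar>) < \<infinity>"
    using assms by (simp add: Lp_space_def)
  have "AE x in M. ereal \<bar>f x\<bar> \<le> esssup M (\<lambda>x. ereal \<bar>f x\<bar>)"
    by (rule esssup_AE)
  then show ?thesis
  proof eventually_elim
    case (elim x)
    then show ?case using fin
      by (cases "esssup M (\<lambda>x. ereal \<bar>f x\<bar>)") (auto simp: Lp_norm_def)
  qed
qed

lemma Lp_norm_powr:
  assumes "1 \<le> p" "p \<noteq> \<infinity>"
  shows "Lp_norm p M f powr enn2real p = (LINT x|M. \<bar>f x\<bar> powr enn2real p)"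
  using assms enn2real_ge_1[OF assms] by (simp add: Lp_norm_def powr_powr)

text \<open>
  Scalar multiples, modifications on null sets and bounded functions are all special cases of
  domination, so this lemma serves for each of them.
\<close>

lemma Lp_dominated:
  assumes p: "1 \<le> p" and f: "f \<in> Lp_space p M" and g: "g \<in> borel_measurable M"
    and c: "0 \<le> c" and le: "AE x in M. \<bar>g x\<bar> \<le> c * \<bar>f x\<bar>"
  shows "g \<in> Lp_space p M" and "Lp_norm p M g \<le> c * Lp_norm p M f"
proof -
  note [measurable] = g Lp_space_measurable[OF f]
  have "g \<in> Lp_space p M \<and> Lp_norm p M g \<le> c * Lp_norm p M f"
  proof (cases "p = \<infinity>")
    case True
    have "AE x in M. ereal \<bar>g x\<bar> \<le> ereal (c * Lp_norm p M f)"
      using le AE_le_Lp_norm_infinity[OF f[unfolded True]]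
    proof eventually_elim
      case (elim x)
      then show ?case using mult_left_mono[OF elim(2) c] True by simp
    qed
    then have le': "esssup M (\<lambda>x. ereal \<bar>g x\<bar>) \<le> ereal (c * Lp_norm p M f)"
      by (intro esssup_I) auto
    moreover have "real_of_ereal (esssup M (\<lambda>x. ereal \<bar>g x\<bar>)) \<le> c * Lp_norm p M f"
      using le' c Lp_norm_nonneg[of p M f]
      by (cases "esssup M (\<lambda>x. ereal \<bar>g x\<bar>)") auto
    ultimately show ?thesis using True g
      by (auto simp: Lp_space_def Lp_norm_def)
  next
    case False
    define q where "q = enn2real p"
    have q: "1 \<le> q" using enn2real_ge_1[OF p False] by (simp add: q_def)
    have intf: "integrable M (\<lambda>x. \<bar>f x\<bar> powr q)"
      using f False by (simp add: Lp_space_def q_def)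
    have le': "AE x in M. \<bar>g x\<bar> powr q \<le> c powr q * \<bar>f x\<bar> powr q"
      using le
    proof eventually_elim
      case (elim x)
      have "\<bar>g x\<bar> powr q \<le> (c * \<bar>f x\<bar>) powr q"
        using elim q by (intro powr_mono2) auto
      then show ?case using c by (simp add: powr_mult)
    qed
    have intg: "integrable M (\<lambda>x. \<bar>g x\<bar> powr q)"
      by (rule Bochner_Integration.integrable_bound[OF integrable_mult_right[OF intf, of "c powr q"]])
        (use le' in auto)
    have "(LINT x|M. \<bar>g x\<bar> powr q) \<le> (LINT x|M. c powr q * \<bar>f x\<bar> powr q)"
      using intf intg le' by (intro integral_mono_AE) auto
    then have "Lp_norm p M g powr q \<le> (c * Lp_norm p M f) powr q"
      using Lp_norm_powr[OF p False, of M g] Lp_norm_powr[OF p False, of M f] c Lp_norm_nonneg[of p M f]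
      by (simp add: q_def powr_mult)
    then have "Lp_norm p M g \<le> c * Lp_norm p M f"
      by (rule powr_le_cancel) (use q c in \<open>auto intro!: mult_nonneg_nonneg Lp_norm_nonneg\<close>)
    then show ?thesis using intg False by (auto simp: Lp_space_def q_def)
  qed
  then show "g \<in> Lp_space p M" "Lp_norm p M g \<le> c * Lp_norm p M f" by auto
qed

text \<open>
  The constant 4 is not the optimal 1 of Minkowski's inequality: only continuity of addition
  matters below.
\<close>

lemma Lp_add:
  assumes p: "1 \<le> p" and f: "f \<in> Lp_space p M" and g: "g \<in> Lp_space p M"
  shows "(\<lambda>x. f x + g x) \<in> Lp_space p M"
    and "Lp_norm p M (\<lambda>x. f x + g x) \<le> 4 * (Lp_norm p M f + Lp_norm p M g)"
proof -
  note [measurable] = Lp_space_measurable[OF f] Lp_space_measurable[OF g]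
  let ?F = "Lp_norm p M f" and ?G = "Lp_norm p M g"
  have nn: "0 \<le> ?F" "0 \<le> ?G" by (rule Lp_norm_nonneg)+
  have "(\<lambda>x. f x + g x) \<in> Lp_space p M \<and> Lp_norm p M (\<lambda>x. f x + g x) \<le> 4 * (?F + ?G)"
  proof (cases "p = \<infinity>")
    case True
    have "AE x in M. ereal \<bar>f x + g x\<bar> \<le> ereal (?F + ?G)"
      using AE_le_Lp_norm_infinity[OF f[unfolded True]] AE_le_Lp_norm_infinity[OF g[unfolded True]]
      by eventually_elim (use True in auto)
    then have le': "esssup M (\<lambda>x. ereal \<bar>f x + g x\<bar>) \<le> ereal (?F + ?G)"
      by (intro esssup_I) auto
    moreover have "real_of_ereal (esssup M (\<lambda>x. ereal \<bar>f x + g x\<bar>)) \<le> 4 * (?F + ?G)"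
      using le' nn by (cases "esssup M (\<lambda>x. ereal \<bar>f x + g x\<bar>)") auto
    ultimately show ?thesis using True
      by (auto simp: Lp_space_def Lp_norm_def)
  next
    case False
    define q where "q = enn2real p"
    have q: "1 \<le> q" using enn2real_ge_1[OF p False] by (simp add: q_def)
    have intf: "integrable M (\<lambda>x. \<bar>f x\<bar> powr q)" and intg: "integrable M (\<lambda>x. \<bar>g x\<bar> powr q)"
      using f g False by (simp_all add: Lp_space_def q_def)
    have le: "\<bar>f x + g x\<bar> powr q \<le> 2 powr q * (\<bar>f x\<bar> powr q + \<bar>g x\<bar> powr q)" for x
    proof -
      have "\<bar>f x + g x\<bar> powr q \<le> (2 * max \<bar>f x\<bar> \<bar>g x\<bar>) powr q"
        using q by (intro powr_mono2) auto
      also have "\<dots> = 2 powr q * max \<bar>f x\<bar> \<bar>g x\<bar> powr q"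
        by (simp add: powr_mult)
      also have "\<dots> \<le> 2 powr q * (\<bar>f x\<bar> powr q + \<bar>g x\<bar> powr q)"
        by (intro mult_left_mono) (auto simp: max_def)
      finally show ?thesis .
    qed
    have int: "integrable M (\<lambda>x. 2 powr q * (\<bar>f x\<bar> powr q + \<bar>g x\<bar> powr q))"
      using intf intg by auto
    have intfg: "integrable M (\<lambda>x. \<bar>f x + g x\<bar> powr q)"
      by (rule Bochner_Integration.integrable_bound[OF int]) (use le in auto)
    have "Lp_norm p M (\<lambda>x. f x + g x) powr q \<le> (LINT x|M. 2 powr q * (\<bar>f x\<bar> powr q + \<bar>g x\<bar> powr q))"
      unfolding Lp_norm_powr[OF p False, folded q_def] by (rule integral_mono[OF intfg int le])
    also have "\<dots> = 2 powr q * (?F powr q + ?G powr q)"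
      using intf intg Lp_norm_powr[OF p False, of M f] Lp_norm_powr[OF p False, of M g]
      by (simp add: q_def)
    also have "\<dots> \<le> 2 powr q * ((?F + ?G) powr q + (?F + ?G) powr q)"
      using q nn by (intro mult_left_mono add_mono powr_mono2) auto
    also have "\<dots> = 2 powr q * (2 powr 1 * (?F + ?G) powr q)"
      by simp
    also have "\<dots> \<le> 2 powr q * (2 powr q * (?F + ?G) powr q)"
      using q by (intro mult_left_mono mult_right_mono powr_mono) auto
    also have "\<dots> = (4 * (?F + ?G)) powr q"
    proof -
      have "2 powr q * 2 powr q = (4::real) powr q"
        using powr_mult[of 2 2 q] by simp
      then show ?thesis using nn
        by (simp add: powr_mult mult.assoc[symmetric] del: distrib_left_numeral)
    qed
    finally have "Lp_norm p M (\<lambda>x. f x + g x) \<le> 4 * (?F + ?G)"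
      by (rule powr_le_cancel) (use q nn in \<open>auto intro!: Lp_norm_nonneg\<close>)
    then show ?thesis using intfg False by (auto simp: Lp_space_def q_def)
  qed
  then show "(\<lambda>x. f x + g x) \<in> Lp_space p M"
    "Lp_norm p M (\<lambda>x. f x + g x) \<le> 4 * (?F + ?G)" by auto
qed

lemma Lp_scale:
  assumes "1 \<le> p" and f: "f \<in> Lp_space p M"
  shows "(\<lambda>x. c * f x) \<in> Lp_space p M" and "Lp_norm p M (\<lambda>x. c * f x) \<le> \<bar>c\<bar> * Lp_norm p M f"
  using Lp_space_measurable[OF f]
  by (auto intro!: Lp_dominated[OF assms, where c = "\<bar>c\<bar>"] simp: abs_mult)

lemma Lp_diff:
  assumes p: "1 \<le> p" and f: "f \<in> Lp_space p M" and g: "g \<in> Lp_space p M"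
  shows "(\<lambda>x. f x - g x) \<in> Lp_space p M"
    and "Lp_norm p M (\<lambda>x. f x - g x) \<le> 4 * (Lp_norm p M f + Lp_norm p M g)"
  using Lp_add[OF p f Lp_scale(1)[OF p g, of "-1"]] Lp_scale(2)[OF p g, of "-1"] by auto

lemma (in finite_measure) Lp_const_1:
  assumes p: "1 \<le> p"
  shows "(\<lambda>x. 1) \<in> Lp_space p M" and "Lp_norm p M (\<lambda>x. 1) \<le> 1 + measure M (space M)"
proof -
  have "(\<lambda>x. 1) \<in> Lp_space p M \<and> Lp_norm p M (\<lambda>x. 1) \<le> 1 + measure M (space M)"
  proof (cases "p = \<infinity>")
    case True
    have le: "esssup M (\<lambda>x. ereal \<bar>1\<bar>) \<le> ereal 1" by (intro esssup_I) auto
    then have "real_of_ereal (esssup M (\<lambda>x. ereal \<bar>1\<bar>)) \<le> 1"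
      by (cases "esssup M (\<lambda>x. ereal \<bar>1\<bar>)") auto
    moreover have "esssup M (\<lambda>x. ereal \<bar>1\<bar>) < \<infinity>" using le by auto
    ultimately show ?thesis using True
      by (auto simp: Lp_space_def Lp_norm_def intro: add_increasing2)
  next
    case False
    have q: "1 \<le> enn2real p" using enn2real_ge_1[OF p False] .
    have "measure M (space M) powr (1 / enn2real p) \<le> (1 + measure M (space M)) powr (1 / enn2real p)"
      using q by (intro powr_mono2) auto
    also have "\<dots> \<le> (1 + measure M (space M)) powr 1"
      using q by (intro powr_mono) auto
    finally show ?thesis using False by (simp add: Lp_space_def Lp_norm_def)
  qed
  then show "(\<lambda>x. 1) \<in> Lp_space p M" "Lp_norm p M (\<lambda>x. 1) \<le> 1 + measure M (space M)" by auto
qed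

lemma (in finite_measure) Lp_bounded_function:
  assumes p: "1 \<le> p" and f: "f \<in> borel_measurable M" and "0 \<le> B" and "AE x in M. \<bar>f x\<bar> \<le> B"
  shows "f \<in> Lp_space p M" and "Lp_norm p M f \<le> (1 + measure M (space M)) * B"
proof -
  have le: "AE x in M. \<bar>f x\<bar> \<le> B * \<bar>1\<bar>" using assms(4) by simp
  show "f \<in> Lp_space p M"
    by (rule Lp_dominated(1)[OF p Lp_const_1(1)[OF p] f \<open>0 \<le> B\<close> le])
  have "Lp_norm p M f \<le> B * Lp_norm p M (\<lambda>x. 1)"
    by (rule Lp_dominated(2)[OF p Lp_const_1(1)[OF p] f \<open>0 \<le> B\<close> le])
  also have "\<dots> \<le> B * (1 + measure M (space M))"
    using Lp_const_1(2)[OF p] \<open>0 \<le> B\<close> by (intro mult_left_mono)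
  finally show "Lp_norm p M f \<le> (1 + measure M (space M)) * B" by (simp add: mult.commute)
qed

text \<open>
  On a finite measure space the \<open>L\<^sup>1\<close> norm is the weakest of all: after scaling to norm 1
  this is \<open>\<bar>y\<bar> \<le> 1 + \<bar>y\<bar>\<^sup>q\<close>.
\<close>

lemma (in finite_measure) Lp_imp_L1:
  assumes p: "1 \<le> p" and f: "f \<in> Lp_space p M"
  shows "integrable M f" and "(LINT x|M. \<bar>f x\<bar>) \<le> (1 + measure M (space M)) * Lp_norm p M f"
proof -
  note fm[measurable] = Lp_space_measurable[OF f]
  let ?N = "Lp_norm p M f"
  have N: "0 \<le> ?N" by (rule Lp_norm_nonneg)
  have "integrable M f \<and> (LINT x|M. \<bar>f x\<bar>) \<le> (1 + measure M (space M)) * ?N"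
  proof (cases "p = \<infinity>")
    case True
    have le: "AE x in M. \<bar>f x\<bar> \<le> ?N"
      using AE_le_Lp_norm_infinity[OF f[unfolded True]] True by simp
    have int: "integrable M f"
      by (rule integrable_const_bound[where B = ?N]) (use le in auto)
    have "(LINT x|M. \<bar>f x\<bar>) \<le> (LINT x|M. ?N)"
      using int le by (intro integral_mono_AE) auto
    also have "\<dots> \<le> (1 + measure M (space M)) * ?N" using N by (simp add: algebra_simps)
    finally show ?thesis using int by simp
  next
    case False
    define q where "q = enn2real p"
    have q: "1 \<le> q" using enn2real_ge_1[OF p False] by (simp add: q_def)
    have intf: "integrable M (\<lambda>x. \<bar>f x\<bar> powr q)"
      using f False by (simp add: Lp_space_def q_def)
    have Nq: "?N powr q = (LINT x|M. \<bar>f x\<bar> powr q)"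
      using Lp_norm_powr[OF p False] by (simp add: q_def)
    show ?thesis
    proof (cases "?N = 0")
      case True
      then have "(LINT x|M. \<bar>f x\<bar> powr q) = 0" using Nq by simp
      then have "AE x in M. \<bar>f x\<bar> powr q = 0"
        using integral_nonneg_eq_0_iff_AE[OF intf] by simp
      then have ae: "AE x in M. f x = 0" by simp
      have "integrable M f \<longleftrightarrow> integrable M (\<lambda>x. 0::real)"
        by (rule integrable_cong_AE) (use ae in auto)
      moreover have "(LINT x|M. \<bar>f x\<bar>) = (LINT x|M. 0)"
        by (rule integral_cong_AE) (use ae in auto)
      ultimately show ?thesis using True by simp
    next
      case False
      then have Np: "0 < ?N" using N by simp
      have le: "\<bar>f x\<bar> \<le> ?N * (1 + \<bar>f x\<bar> powr q / ?N powr q)" for x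
      proof -
        have "\<bar>f x\<bar> / ?N \<le> 1 + (\<bar>f x\<bar> / ?N) powr q"
        proof (cases "\<bar>f x\<bar> / ?N \<le> 1")
          case False
          then have "(\<bar>f x\<bar> / ?N) powr 1 \<le> (\<bar>f x\<bar> / ?N) powr q"
            using q by (intro powr_mono) auto
          then show ?thesis using False Np by simp
        qed (simp add: add_increasing2)
        then show ?thesis using Np by (simp add: powr_divide field_simps)
      qed
      have int: "integrable M (\<lambda>x. ?N * (1 + \<bar>f x\<bar> powr q / ?N powr q))"
        using intf by auto
      have intf1: "integrable M f"
        by (rule Bochner_Integration.integrable_bound[OF int])
          (use le in \<open>auto intro: order_trans[OF _ abs_ge_self]\<close>)
      have "(LINT x|M. \<bar>f x\<bar>) \<le> (LINT x|M. ?N * (1 + \<bar>f x\<bar> powr q / ?N powr q))"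
        using int intf1 le by (intro integral_mono) auto
      also have "\<dots> = ?N * (measure M (space M) + 1)"
        using intf Np by (simp add: Nq[symmetric])
      finally show ?thesis using intf1 by (simp add: algebra_simps)
    qed
  qed
  then show "integrable M f" "(LINT x|M. \<bar>f x\<bar>) \<le> (1 + measure M (space M)) * ?N" by auto
qed

section \<open>Operator norms\<close>

lemma Lp_zero: "1 \<le> p \<Longrightarrow> (\<lambda>x. 0) \<in> Lp_space p M" "1 \<le> p \<Longrightarrow> Lp_norm p M (\<lambda>x. 0) = 0"
proof -
  assume p: "1 \<le> p"
  show z: "(\<lambda>x. 0) \<in> Lp_space p M"
  proof (cases "p = \<infinity>")
    case True
    have "esssup M (\<lambda>x. ereal \<bar>0\<bar>) \<le> ereal 0" by (intro esssup_I) auto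
    then show ?thesis using True by (auto simp: Lp_space_def)
  qed (simp add: Lp_space_def)
  show "Lp_norm p M (\<lambda>x. 0) = 0"
    using Lp_scale(2)[OF p z, of 0] Lp_norm_nonneg[of p M "\<lambda>x. 0"] by simp
qed

lemma Lp_onorm_le:
  assumes p: "1 \<le> p" and C: "0 \<le> C" "\<And>f. f \<in> Lp_space p M \<Longrightarrow> Lp_norm p M (T f) \<le> C * Lp_norm p M f"
  shows "0 \<le> Lp_onorm p M T" and "Lp_onorm p M T \<le> C"
proof -
  let ?B = "{f \<in> Lp_space p M. Lp_norm p M f \<le> 1}"
  have z: "(\<lambda>x. 0) \<in> ?B" using Lp_zero(1)[OF p, of M] Lp_zero(2)[OF p, of M] by simp
  have le: "Lp_norm p M (T f) \<le> C" if "f \<in> ?B" for f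
    using C(2)[of f] mult_left_mono[of "Lp_norm p M f" 1 C] C(1) that by auto
  have bdd: "bdd_above ((\<lambda>f. Lp_norm p M (T f)) ` ?B)"
    using le by (auto intro!: bdd_aboveI2)
  show "Lp_onorm p M T \<le> C"
    unfolding Lp_onorm_def using z le by (intro cSUP_least) blast+
  have "0 \<le> Lp_norm p M (T (\<lambda>x. 0))" by (rule Lp_norm_nonneg)
  also have "\<dots> \<le> Lp_onorm p M T"
    unfolding Lp_onorm_def by (rule cSUP_upper[OF z bdd])
  finally show "0 \<le> Lp_onorm p M T" .
qed

text \<open>
  The bound \<open>C\<close> makes the real supremum defining the operator norm a genuine one.
\<close>

lemma Lp_norm_le_onorm:
  assumes p: "1 \<le> p"
    and C: "0 \<le> C" "\<And>f. f \<in> Lp_space p M \<Longrightarrow> Lp_norm p M (T f) \<le> C * Lp_norm p M f"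
    and T: "\<And>f. f \<in> Lp_space p M \<Longrightarrow> T f \<in> Lp_space p M"
    and hom: "\<And>c f. f \<in> Lp_space p M \<Longrightarrow> AE x in M. T (\<lambda>y. c * f y) x = c * T f x"
    and f: "f \<in> Lp_space p M"
  shows "Lp_norm p M (T f) \<le> Lp_onorm p M T * Lp_norm p M f"
proof (cases "Lp_norm p M f = 0")
  case True
  then show ?thesis using C(2)[OF f] by simp
next
  case False
  let ?N = "Lp_norm p M f"
  let ?B = "{f \<in> Lp_space p M. Lp_norm p M f \<le> 1}"
  have N: "0 < ?N" using False Lp_norm_nonneg[of p M f] by simp
  define g where "g = (\<lambda>x. (1 / ?N) * f x)"
  have g: "g \<in> ?B"
    using Lp_scale[OF p f, of "1 / ?N"] N by (simp add: g_def)
  have bdd: "bdd_above ((\<lambda>f. Lp_norm p M (T f)) ` ?B)"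
  proof (rule bdd_aboveI2)
    fix f assume "f \<in> ?B"
    then show "Lp_norm p M (T f) \<le> C"
      using C(2)[of f] mult_left_mono[of "Lp_norm p M f" 1 C] C(1) by auto
  qed
  have le: "Lp_norm p M (T g) \<le> Lp_onorm p M T"
    unfolding Lp_onorm_def by (rule cSUP_upper[OF g bdd])
  have Tg: "T g \<in> Lp_space p M" using T g by simp
  have "AE x in M. T g x = (1 / ?N) * T f x"
    using hom[OF f, of "1 / ?N"] by (simp add: g_def)
  then have "AE x in M. \<bar>T f x\<bar> \<le> ?N * \<bar>T g x\<bar>"
    by eventually_elim (use N in \<open>simp add: abs_mult\<close>)
  then have "Lp_norm p M (T f) \<le> ?N * Lp_norm p M (T g)"
    using Lp_dominated(2)[OF p Tg Lp_space_measurable[OF T[OF f]]] N by simp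
  also have "\<dots> \<le> ?N * Lp_onorm p M T" using le N by simp
  finally show ?thesis by (simp add: mult.commute)
qed

section \<open>Integrals over intervals\<close>

text \<open>A weighted Hoelder inequality, obtained by integrating Young's inequality against the weight.\<close>

lemma weighted_powr_mean:
  fixes w f :: "'a \<Rightarrow> real"
  assumes q: "1 \<le> q" and w: "\<And>x. 0 \<le> w x" "integrable M w"
    and K: "(LINT x|M. w x) \<le> K" and int: "integrable M (\<lambda>x. w x * \<bar>f x\<bar> powr q)"
    and wf: "integrable M (\<lambda>x. w x * f x)"
  shows "\<bar>LINT x|M. w x * f x\<bar> powr q \<le> K powr (q - 1) * (LINT x|M. w x * \<bar>f x\<bar> powr q)"
proof -
  let ?I = "LINT x|M. w x * \<bar>f x\<bar> powr q"
  have wf': "integrable M (\<lambda>x. w x * \<bar>f x\<bar>)"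
    using integrable_abs[OF wf] w(1) by (simp add: abs_mult)
  have I0: "0 \<le> ?I" using w by (intro Bochner_Integration.integral_nonneg) auto
  have W0: "0 \<le> (LINT x|M. w x)" using w by (intro Bochner_Integration.integral_nonneg) auto
  then have K0: "0 \<le> K" using K by simp
  have abs_le: "\<bar>LINT x|M. w x * f x\<bar> \<le> (LINT x|M. w x * \<bar>f x\<bar>)"
    using integral_abs_bound[of M "\<lambda>x. w x * f x"] w(1) by (simp add: abs_mult)
  have young: "(LINT x|M. w x * \<bar>f x\<bar>) \<le> (1 - 1 / q) * c * K + c powr (1 - q) / q * ?I" if c: "0 < c" for c
  proof -
    have pt: "\<bar>f x\<bar> \<le> (1 - 1 / q) * c + c powr (1 - q) / q * \<bar>f x\<bar> powr q" for x
    proof (cases "f x = 0")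
      case False
      have "\<bar>f x\<bar> = (\<bar>f x\<bar> powr q * c powr (1 - q)) powr (1 / q) * c powr (1 - 1 / q)"
        using False c q by (simp add: powr_mult powr_powr powr_add[symmetric] divide_simps)
      also have "\<dots> \<le> 1 / q * (\<bar>f x\<bar> powr q * c powr (1 - q)) + (1 - 1 / q) * c"
        using c q False by (intro Youngs_inequality_0) (auto simp: divide_simps)
      finally show ?thesis by (simp add: algebra_simps)
    qed (use c q in auto)
    have "(LINT x|M. w x * \<bar>f x\<bar>) \<le>
        (LINT x|M. (1 - 1 / q) * c * w x + c powr (1 - q) / q * (w x * \<bar>f x\<bar> powr q))"
    proof (rule integral_mono)
      fix x
      show "w x * \<bar>f x\<bar> \<le> (1 - 1 / q) * c * w x + c powr (1 - q) / q * (w x * \<bar>f x\<bar> powr q)"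
        using mult_left_mono[OF pt[of x] w(1)[of x]] by (simp add: algebra_simps)
    qed (use wf' w int in auto)
    also have "\<dots> = (1 - 1 / q) * c * (LINT x|M. w x) + c powr (1 - q) / q * ?I"
      using w int by simp
    also have "\<dots> \<le> (1 - 1 / q) * c * K + c powr (1 - q) / q * ?I"
      using K c q by (intro add_right_mono mult_left_mono) auto
    finally show ?thesis .
  qed
  have "(LINT x|M. w x * \<bar>f x\<bar>) powr q \<le> K powr (q - 1) * ?I"
  proof (cases "K = 0 \<or> ?I = 0")
    case True
    have "AE x in M. w x * \<bar>f x\<bar> = 0"
    proof (cases "K = 0")
      case True
      then have "(LINT x|M. w x) = 0" using W0 K by simp
      then have "AE x in M. w x = 0"
        using integral_nonneg_eq_0_iff_AE[OF w(2)] w(1) by simp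
      then show ?thesis by eventually_elim simp
    next
      case False
      with True have "AE x in M. w x * \<bar>f x\<bar> powr q = 0"
        using integral_nonneg_eq_0_iff_AE[OF int] w(1) by simp
      then show ?thesis by eventually_elim auto
    qed
    then have "(LINT x|M. w x * \<bar>f x\<bar>) = (LINT x|M. 0)"
      using wf' by (intro integral_cong_AE) auto
    then show ?thesis using K0 I0 by simp
  next
    case False
    then have pos: "0 < K" "0 < ?I" using K0 I0 by auto
    \<comment> \<open>Young's inequality is sharpest at this value of the free parameter.\<close>
    define c where "c = (?I / K) powr (1 / q)"
    have c: "0 < c" using pos by (simp add: c_def)
    have cq: "c powr q = ?I / K" using pos q by (simp add: c_def powr_powr)
    then have I: "?I = c powr q * K" using pos by simp
    have "(LINT x|M. w x * \<bar>f x\<bar>) \<le> (1 - 1 / q) * c * K + c powr (1 - q) / q * (c powr q * K)"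
      using young[OF c] I by simp
    also have "\<dots> = c * K"
      using c q by (simp add: powr_add[symmetric] field_simps)
    finally have "(LINT x|M. w x * \<bar>f x\<bar>) powr q \<le> (c * K) powr q"
      using w(1) q by (intro powr_mono2) (auto intro!: Bochner_Integration.integral_nonneg)
    also have "\<dots> = c powr q * (K powr (q - 1) * K powr 1)"
      using c pos powr_add[of K "q - 1" 1] by (simp add: powr_mult)
    also have "\<dots> = K powr (q - 1) * ?I" using I pos by simp
    finally show ?thesis .
  qed
  moreover have "\<bar>LINT x|M. w x * f x\<bar> powr q \<le> (LINT x|M. w x * \<bar>f x\<bar>) powr q"
    using abs_le q by (intro powr_mono2) auto
  ultimately show ?thesis by linarith
qed

lemma primitive_eq_HK_integral:
  fixes G :: "real \<Rightarrow> real"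
  assumes G: "integrable (lebesgue_on {a..b}) G" and t: "t \<in> {a..b}"
  shows "(LINT s|lebesgue_on {a..b}. (if s < t then G s else 0)) = integral {a..t} G"
proof -
  have Gt: "integrable (lebesgue_on {a..t}) G"
    using integrable_subinterval[of a b G a t] G t by (auto simp: )
  have ae: "AE s in lebesgue. s \<noteq> t"
    using AE_lborel_singleton[of t] by (rule AE_completion)
  have meas [measurable]: "(\<lambda>s. indicator {a..b} s *\<^sub>R G s) \<in> borel_measurable lebesgue"
      "(\<lambda>s. indicator {a..t} s *\<^sub>R G s) \<in> borel_measurable lebesgue"
    using borel_measurable_integrable[OF G] borel_measurable_integrable[OF Gt]
    by (auto simp: borel_measurable_restrict_space_iff mult.commute)
  have "(LINT s|lebesgue_on {a..b}. (if s < t then G s else 0))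
     = (LINT s|lebesgue. indicator {a..b} s *\<^sub>R (if s < t then G s else 0))"
    by (subst integral_restrict_space) auto
  also have "\<dots> = (LINT s|lebesgue. indicator {a..t} s *\<^sub>R G s)"
  proof (rule integral_cong_AE)
    have "(\<lambda>s. indicator {..<t} s *\<^sub>R (indicator {a..b} s *\<^sub>R G s)) \<in> borel_measurable lebesgue"
      by (rule borel_measurable_scaleR[OF borel_measurable_indicator meas(1)]) simp
    also have "(\<lambda>s. indicator {..<t} s *\<^sub>R (indicator {a..b} s *\<^sub>R G s)) =
       (\<lambda>s. indicator {a..b} s *\<^sub>R (if s < t then G s else 0))" by (auto simp: indicator_def)
    finally show "(\<lambda>s. indicator {a..b} s *\<^sub>R (if s < t then G s else 0)) \<in> borel_measurable lebesgue" .
    show "AE s in lebesgue. indicator {a..b} s *\<^sub>R (if s < t then G s else 0) = indicator {a..t} s *\<^sub>R G s"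
      using ae by eventually_elim (use t in \<open>auto simp: indicator_def\<close>)
  qed (rule meas(2))
  also have "\<dots> = (LINT s|lebesgue_on {a..t}. G s)"
    by (subst integral_restrict_space) auto
  also have "\<dots> = integral {a..t} G"
    using Gt by (rule lebesgue_integral_eq_integral) auto
  finally show ?thesis .
qed

lemma continuous_on_primitive:
  fixes G :: "real \<Rightarrow> real"
  assumes G: "integrable (lebesgue_on {a..b}) G"
  shows "continuous_on {a..b} (\<lambda>t. LINT s|lebesgue_on {a..b}. (if s < t then G s else 0))"
proof -
  have "G integrable_on {a..b}"
    using integrable_on_lebesgue_on[OF G] by simp
  then have "continuous_on {a..b} (\<lambda>t. integral {a..t} G)"
    by (rule indefinite_integral_continuous_1)
  then show ?thesis
    using primitive_eq_HK_integral[OF G] by (subst continuous_on_cong[OF refl]) auto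
qed

text \<open>
  The primitive is continuous, hence zero everywhere. So the positive and the negative part of
  \<open>G\<close> have equal integrals over all half-lines, and are densities of the same measure.
\<close>

lemma AE_zero_if_primitive_zero:
  fixes G :: "real \<Rightarrow> real"
  assumes ab: "a < b" and G: "integrable (lebesgue_on {a..b}) G"
    and zero: "AE t in lebesgue_on {a..b}. (LINT s|lebesgue_on {a..b}. (if s < t then G s else 0)) = 0"
  shows "AE s in lebesgue_on {a..b}. G s = 0"
proof -
  let ?M = "lebesgue_on {a..b}"
  define F where "F t = (LINT s|?M. (if s < t then G s else 0))" for t
  have contF: "continuous_on {a..b} F"
    unfolding F_def by (rule continuous_on_primitive[OF G])
  have "closed {t \<in> {a..b}. F t = 0}"
    using contF by (rule continuous_closed_preimage_constant) auto
  moreover have "AE t \<in> {a<..<b} in lebesgue. t \<in> {t \<in> {a..b}. F t = 0}"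
    using zero unfolding F_def by (auto simp: AE_restrict_space_iff elim!: eventually_mono)
  ultimately have "F t = 0" if "t \<in> {a<..<b}" for t
    using mem_closed_if_AE_lebesgue_open[of "{a<..<b}" "{t \<in> {a..b}. F t = 0}" t] that by auto
  then have F0: "F t = 0" if "t \<in> {a..b}" for t
    using continuous_constant_on_closure[of "{a<..<b}" F 0 t] contF that ab by auto
  define G0 where "G0 s = indicator {a..b} s * G s" for s
  have intG0: "integrable lebesgue G0"
    using G by (simp add: integrable_restrict_space G0_def[abs_def])
  then obtain g where g: "g \<in> borel_measurable lborel" "AE s in lborel. G0 s = g s"
    using completion_ex_borel_measurable_real[of G0 lborel] by auto
  note [measurable] = g(1)
  have g': "AE s in lebesgue. G0 s = g s" using AE_completion[OF g(2)] .
  have intg': "integrable lebesgue g"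
    using integrable_cong_AE_imp[OF intG0 _ g'] g(1)
    by (simp add: measurable_completion eq_commute)
  then have intg: "integrable lborel g"
    using integrable_completion[of g lborel] g(1) by simp
  have tail: "(LINT s|lborel. indicator {x<..} s * g s) = 0" for x
  proof -
    have "(LINT s|lborel. indicator {x<..} s * g s) = (LINT s|lebesgue. indicator {x<..} s * g s)"
      by (rule integral_completion[symmetric]) auto
    also have "\<dots> = (LINT s|lebesgue. indicator {x<..} s * G0 s)"
      using g' intG0 intg' by (intro integral_cong_AE borel_measurable_times borel_measurable_indicator)
        (auto elim!: eventually_mono)
    also have "\<dots> = (LINT s|lebesgue. indicator {a..b} s *\<^sub>R (indicator {x<..} s * G s))"
      by (simp add: G0_def mult_ac)
    also have "\<dots> = (LINT s|?M. indicator {x<..} s * G s)"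
      by (subst integral_restrict_space) auto
    also have "\<dots> = 0"
    proof -
      define y where "y = max a (min b x)"
      have y: "y \<in> {a..b}" using ab by (auto simp: y_def)
      have m[measurable]: "G \<in> borel_measurable ?M" using G by auto
      have id[measurable]: "(\<lambda>s. s) \<in> borel_measurable ?M"
        by (intro continuous_imp_measurable_on_sets_lebesgue) auto
      have aey: "AE s in ?M. s \<noteq> y \<and> s \<noteq> b"
        using AE_completion[OF AE_lborel_singleton[of y]] AE_completion[OF AE_lborel_singleton[of b]]
        by (auto simp: AE_restrict_space_iff)
      have int: "integrable ?M (\<lambda>s. (if s < t then G s else 0))" for t
        by (rule Bochner_Integration.integrable_bound[OF G]) auto
      have "(LINT s|?M. indicator {x<..} s * G s) =
          (LINT s|?M. (if s < b then G s else 0) - (if s < y then G s else 0))"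
      proof (rule integral_cong_AE)
        show "AE s in ?M. indicator {x<..} s * G s = (if s < b then G s else 0) - (if s < y then G s else 0)"
          using aey AE_space by eventually_elim (auto simp: indicator_def y_def)
      qed auto
      also have "\<dots> = F b - F y" using int by (simp add: F_def)
      finally show ?thesis using F0[OF y] F0[of b] ab by simp
    qed
    finally show ?thesis .
  qed
  have fin: "(\<integral>\<^sup>+s. ennreal (c * g s) \<partial>lborel) < \<infinity>" if "\<bar>c\<bar> \<le> 1" for c
  proof -
    have "(\<integral>\<^sup>+s. ennreal (c * g s) \<partial>lborel) \<le> (\<integral>\<^sup>+s. ennreal (norm (g s)) \<partial>lborel)"
    proof (intro nn_integral_mono ennreal_leI)
      fix s
      have "c * g s \<le> \<bar>c\<bar> * \<bar>g s\<bar>" by (simp add: abs_mult[symmetric])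
      also have "\<dots> \<le> 1 * \<bar>g s\<bar>" using that by (intro mult_right_mono) auto
      finally show "c * g s \<le> norm (g s)" by simp
    qed
    then show ?thesis using intg by (auto simp: integrable_iff_bounded)
  qed
  have "density lborel (\<lambda>s. ennreal (g s)) = density lborel (\<lambda>s. ennreal (- g s))"
  proof (rule measure_eqI_lessThan)
    fix x
    have em: "emeasure (density lborel (\<lambda>s. ennreal (c * g s))) {x<..} =
       (\<integral>\<^sup>+s. ennreal (c * (indicator {x<..} s * g s)) \<partial>lborel)" for c
      by (subst emeasure_density) (auto intro!: nn_integral_cong simp: indicator_def)
    have le: "(\<integral>\<^sup>+s. ennreal (c * (indicator {x<..} s * g s)) \<partial>lborel) \<le> (\<integral>\<^sup>+s. ennreal (c * g s) \<partial>lborel)" for c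
      by (intro nn_integral_mono) (auto simp: indicator_def)
    show "emeasure (density lborel (\<lambda>s. ennreal (g s))) {x<..} < \<infinity>"
      using em[of 1] le[of 1] fin[of 1] by auto
    have "integrable lborel (\<lambda>s. indicator {x<..} s * g s)"
      using integrable_mult_indicator[OF _ intg, of "{x<..}"] by simp
    from real_lebesgue_integral_def[OF this] tail[of x]
    have "enn2real (\<integral>\<^sup>+s. ennreal (1 * (indicator {x<..} s * g s)) \<partial>lborel) =
        enn2real (\<integral>\<^sup>+s. ennreal (-1 * (indicator {x<..} s * g s)) \<partial>lborel)" by simp
    then have "(\<integral>\<^sup>+s. ennreal (1 * (indicator {x<..} s * g s)) \<partial>lborel) =
        (\<integral>\<^sup>+s. ennreal (-1 * (indicator {x<..} s * g s)) \<partial>lborel)"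
      using ennreal_enn2real[OF le_less_trans[OF le[of 1] fin[of 1], unfolded infinity_ennreal_def]]
        ennreal_enn2real[OF le_less_trans[OF le[of "-1"] fin[of "-1"], unfolded infinity_ennreal_def]]
      by (metis abs_neg_one abs_one order_refl)
    then show "emeasure (density lborel (\<lambda>s. ennreal (g s))) {x<..} =
        emeasure (density lborel (\<lambda>s. ennreal (- g s))) {x<..}"
      using em[of 1] em[of "-1"] by simp
  qed auto
  then have "AE s in lborel. ennreal (g s) = ennreal (- g s)"
    by (intro sigma_finite_measure.density_unique[OF lborel.sigma_finite_measure_axioms]) auto
  then have "AE s in lborel. g s = 0"
  proof eventually_elim
    case (elim s)
    then show ?case by (cases "0 \<le> g s") (auto simp: ennreal_neg ennreal_eq_0_iff)
  qed
  with g(2) have "AE s in lborel. G0 s = 0" by eventually_elim simp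
  then have "AE s in lebesgue. G0 s = 0" by (rule AE_completion)
  then have "AE s in lebesgue. s \<in> {a..b} \<longrightarrow> G s = 0"
    by eventually_elim (auto simp: G0_def indicator_def)
  then show ?thesis by (simp add: AE_restrict_space_iff)
qed

section \<open>Convolution operators with respect to an increasing function\<close>

text \<open>
  The operators below depend on a pair of points only through the difference of their images
  under \<open>h\<close>, so they would be ordinary convolutions on an interval after the substitution
  \<open>u = h(s)\<close>. The substitution is carried out only where it is needed, for the kernels,
  so that functions and operators stay on the given interval.
\<close>

locale increasing_C1 =
  fixes a b :: real and h h' :: "real \<Rightarrow> real"
  assumes ab: "a < b"
    and h_deriv: "\<And>t. t \<in> {a..b} \<Longrightarrow> (h has_real_derivative h' t) (at t within {a..b})"
    and h'_cont: "continuous_on {a..b} h'"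
    and h'_pos: "\<And>t. t \<in> {a..b} \<Longrightarrow> h' t > 0"
begin

abbreviation M :: "real measure" where "M \<equiv> lebesgue_on {a..b}"

sublocale finite_measure M
  by (rule finite_measure_lebesgue_on) auto

sublocale MM: pair_sigma_finite M M ..

lemma h_cont: "continuous_on {a..b} h"
  using h_deriv by (meson DERIV_continuous continuous_on_eq_continuous_within)

lemma h_less: "s \<in> {a..b} \<Longrightarrow> t \<in> {a..b} \<Longrightarrow> s < t \<Longrightarrow> h s < h t"
proof -
  assume st: "s \<in> {a..b}" "t \<in> {a..b}" "s < t"
  have "\<exists>y. (h has_real_derivative y) (at x) \<and> 0 < y" if "s < x" "x < t" for x
  proof -
    have "x \<in> {a<..<b}" using st that by auto
    then have "(h has_real_derivative h' x) (at x)"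
      using h_deriv[of x] at_within_interior[of x "{a..b}"] by auto
    then show ?thesis using h'_pos[of x] st that by auto
  qed
  then show "h s < h t"
    using st by (intro DERIV_pos_imp_increasing_open[OF st(3)] continuous_on_subset[OF h_cont]) auto
qed

lemma h_less_iff: "s \<in> {a..b} \<Longrightarrow> t \<in> {a..b} \<Longrightarrow> h s < h t \<longleftrightarrow> s < t"
  using h_less[of s t] h_less[of t s] by (cases s t rule: linorder_cases) auto

lemma h_le_iff: "s \<in> {a..b} \<Longrightarrow> t \<in> {a..b} \<Longrightarrow> h s \<le> h t \<longleftrightarrow> s \<le> t"
  using h_less_iff[of t s] by (auto simp: not_less[symmetric])

lemma h_measurable [measurable]: "h \<in> borel_measurable M"
  by (rule continuous_imp_measurable_on_sets_lebesgue[OF h_cont]) auto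

lemma h'_measurable [measurable]: "h' \<in> borel_measurable M"
  by (rule continuous_imp_measurable_on_sets_lebesgue[OF h'_cont]) auto

lemma id_measurable [measurable]: "(\<lambda>t. t) \<in> borel_measurable M"
  by (intro continuous_imp_measurable_on_sets_lebesgue) auto

definition "h'_min = (INF t\<in>{a..b}. h' t)"
definition "h'_max = (SUP t\<in>{a..b}. h' t)"

lemma h'_bounds:
  shows "0 < h'_min" and "t \<in> {a..b} \<Longrightarrow> h'_min \<le> h' t" and "t \<in> {a..b} \<Longrightarrow> h' t \<le> h'_max"
    and "h'_min \<le> h'_max"
proof -
  have comp: "compact (h' ` {a..b})"
    using h'_cont by (rule compact_continuous_image) auto
  have ne: "h' ` {a..b} \<noteq> {}" using ab by auto
  have bdd: "bdd_below (h' ` {a..b})" "bdd_above (h' ` {a..b})"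
    using compact_imp_bounded[OF comp] by (simp_all add: bounded_imp_bdd_below bounded_imp_bdd_above)
  have "Inf (h' ` {a..b}) \<in> h' ` {a..b}"
    using comp ne bdd by (intro closed_contains_Inf compact_imp_closed)
  then show "0 < h'_min" using h'_pos by (auto simp: h'_min_def)
  show "t \<in> {a..b} \<Longrightarrow> h'_min \<le> h' t" for t
    unfolding h'_min_def by (rule cINF_lower[OF bdd(1)])
  show "t \<in> {a..b} \<Longrightarrow> h' t \<le> h'_max" for t
    unfolding h'_max_def by (rule cSUP_upper[OF _ bdd(2)])
  from this(1)[of a] show "h'_min \<le> h'_max"
    using ab cINF_lower[OF bdd(1), of a] unfolding h'_min_def by auto
qed

lemma h'_nonneg: "t \<in> {a..b} \<Longrightarrow> 0 \<le> h' t"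
  using h'_pos[of t] by simp

lemma integrable_times_h':
  assumes "integrable M f"
  shows "integrable M (\<lambda>s. f s * h' s)"
proof (rule Bochner_Integration.integrable_bound)
  show "integrable M (\<lambda>s. h'_max * f s)" using assms by simp
  show "AE s in M. norm (f s * h' s) \<le> norm (h'_max * f s)"
  proof (rule AE_I2)
    fix s assume "s \<in> space M"
    then have s: "s \<in> {a..b}" by simp
    have "\<bar>f s\<bar> * h' s \<le> \<bar>f s\<bar> * h'_max"
      using h'_bounds(3)[OF s] by (intro mult_left_mono) auto
    then show "norm (f s * h' s) \<le> norm (h'_max * f s)"
      using h'_nonneg[OF s] h'_bounds(1,4) by (simp add: abs_mult mult.commute)
  qed
qed (use assms in auto)

text \<open>
  Substitution in an integral needs two-sided derivatives, also at the end points. So \<open>h\<close> is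
  first continued beyond its interval, by the primitive of the constant continuation of \<open>h'\<close>.
\<close>

lemma h_extension:
  obtains H where "\<And>t. t \<in> {a..b} \<Longrightarrow> (H has_real_derivative h' t) (at t)"
    and "\<And>t. t \<in> {a..b} \<Longrightarrow> H t = h t"
proof -
  define g where "g t = h' (max a (min b t))" for t
  have contg: "continuous_on {a-1..b+1} g"
    unfolding g_def
    by (rule continuous_on_compose2[OF h'_cont]) (use ab in \<open>auto intro!: continuous_intros\<close>)
  define H where "H x = integral {a-1..x} g + (h a - integral {a-1..a} g)" for x
  have derH: "(H has_real_derivative h' t) (at t)" if t: "t \<in> {a..b}" for t
  proof -
    have "((\<lambda>x. integral {a-1..x} g) has_real_derivative g t) (at t within {a-1..b+1})"
      using t by (intro integral_has_real_derivative[OF contg]) auto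
    then have "((\<lambda>x. integral {a-1..x} g) has_real_derivative g t) (at t)"
      using at_within_interior[of t "{a-1..b+1}"] t by auto
    then show ?thesis
      using t unfolding H_def by (auto intro!: derivative_eq_intros simp: g_def)
  qed
  have "\<exists>c. \<forall>t\<in>{a..b}. H t - h t = c"
    by (rule has_field_derivative_zero_constant)
      (auto intro!: derivative_eq_intros has_field_derivative_at_within[OF derH] h_deriv)
  then obtain c where c: "\<And>t. t \<in> {a..b} \<Longrightarrow> H t - h t = c" by auto
  have "c = 0" using c[of a] ab by (simp add: H_def)
  then show ?thesis using that[of H] derH c by auto
qed

lemma nn_integral_substitution_h:
  fixes F :: "real \<Rightarrow> real"
  assumes [measurable]: "F \<in> borel_measurable borel" and F: "\<And>v. 0 \<le> F v"
  shows "(\<integral>\<^sup>+s. ennreal (F (h s) * h' s) \<partial>M) = (\<integral>\<^sup>+v. ennreal (F v * indicator {h a..h b} v) \<partial>lborel)"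
proof -
  obtain H where H: "\<And>t. t \<in> {a..b} \<Longrightarrow> (H has_real_derivative h' t) (at t)"
    and Hh: "\<And>t. t \<in> {a..b} \<Longrightarrow> H t = h t" using h_extension by blast
  have "(\<integral>\<^sup>+v. ennreal (F v * indicator {h a..h b} v) \<partial>lborel)
      = (\<integral>\<^sup>+v. ennreal (F v * indicator {H a..H b} v) \<partial>lborel)"
    using Hh ab by simp
  also have "\<dots> = (\<integral>\<^sup>+s. ennreal (F (H s) * h' s * indicator {a..b} s) \<partial>lborel)"
    using H h'_cont h'_nonneg ab
    by (intro nn_integral_substitution) (auto simp: set_borel_measurable_def)
  also have "\<dots> = (\<integral>\<^sup>+s. ennreal (F (h s) * h' s) * indicator {a..b} s \<partial>lebesgue)"
    by (subst nn_integral_completion) (auto intro!: nn_integral_cong simp: Hh indicator_def)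
  also have "\<dots> = (\<integral>\<^sup>+s. ennreal (F (h s) * h' s) \<partial>M)"
    by (rule nn_integral_restrict_space[symmetric]) auto
  finally show ?thesis by simp
qed

subsection \<open>Kernels\<close>

text \<open>
  Kernels vanish on the nonpositive half-line, which encodes the integration up to \<open>t\<close>; the
  value at \<open>0\<close> concerns a null set of arguments.
\<close>

definition kernel :: "(real \<Rightarrow> real) \<Rightarrow> bool" where
  "kernel \<kappa> \<longleftrightarrow> \<kappa> \<in> borel_measurable borel \<and> (\<forall>u\<le>0. \<kappa> u = 0) \<and>
     integrable lborel (\<lambda>u. indicator {0..h b - h a} u * \<kappa> u)"

definition kernel_norm :: "(real \<Rightarrow> real) \<Rightarrow> real" where
  "kernel_norm \<kappa> = (LINT u|lborel. indicator {0..h b - h a} u * \<bar>\<kappa> u\<bar>)"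

lemma kernel_measurable: "kernel \<kappa> \<Longrightarrow> \<kappa> \<in> borel_measurable borel"
  by (simp add: kernel_def)

lemma kernel_abs:
  assumes "kernel \<kappa>"
  shows "kernel (\<lambda>u. \<bar>\<kappa> u\<bar>)"
proof -
  have "integrable lborel (\<lambda>u. \<bar>indicator {0..h b - h a} u * \<kappa> u\<bar>)"
    using assms unfolding kernel_def by (intro integrable_abs) simp
  then show ?thesis using assms by (auto simp: kernel_def abs_mult)
qed

lemma kernel_diff: "kernel \<kappa> \<Longrightarrow> kernel \<mu> \<Longrightarrow> kernel (\<lambda>u. \<kappa> u - \<mu> u)"
  unfolding kernel_def by (auto simp: right_diff_distrib)

lemma kernel_norm_nonneg: "0 \<le> kernel_norm \<kappa>"
  unfolding kernel_norm_def by (intro Bochner_Integration.integral_nonneg) auto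

lemma kernel_norm_abs [simp]: "kernel_norm (\<lambda>u. \<bar>\<kappa> u\<bar>) = kernel_norm \<kappa>"
  by (simp add: kernel_norm_def)

lemma nn_integral_kernel:
  assumes "kernel \<kappa>"
  shows "(\<integral>\<^sup>+u. ennreal (indicator {0..h b - h a} u * \<bar>\<kappa> u\<bar>) \<partial>lborel) = ennreal (kernel_norm \<kappa>)"
  using kernel_abs[OF assms] unfolding kernel_norm_def kernel_def
  by (intro nn_integral_eq_integral) auto

lemma nn_integral_kernel_left:
  assumes \<kappa>: "kernel \<kappa>" and t: "t \<in> {a..b}"
  shows "(\<integral>\<^sup>+s. ennreal (\<bar>\<kappa> (h t - h s)\<bar> * h' s) \<partial>M) \<le> ennreal (kernel_norm \<kappa>)"
proof -
  note [measurable] = kernel_measurable[OF \<kappa>]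
  have "(\<integral>\<^sup>+s. ennreal (\<bar>\<kappa> (h t - h s)\<bar> * h' s) \<partial>M) =
      (\<integral>\<^sup>+v. ennreal (\<bar>\<kappa> (h t - v)\<bar> * indicator {h a..h b} v) \<partial>lborel)"
    by (rule nn_integral_substitution_h) auto
  also have "\<dots> = (\<integral>\<^sup>+u. ennreal (\<bar>\<kappa> u\<bar> * indicator {h a..h b} (h t - u)) \<partial>lborel)"
    by (subst nn_integral_real_affine[where c = "-1" and t = "h t"]) auto
  also have "\<dots> \<le> (\<integral>\<^sup>+u. ennreal (indicator {0..h b - h a} u * \<bar>\<kappa> u\<bar>) \<partial>lborel)"
  proof (intro nn_integral_mono ennreal_leI)
    fix u
    show "\<bar>\<kappa> u\<bar> * indicator {h a..h b} (h t - u) \<le> indicator {0..h b - h a} u * \<bar>\<kappa> u\<bar>"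
      using \<kappa> t h_le_iff[of t b] ab unfolding kernel_def
      by (cases "u \<le> 0") (auto simp: indicator_def)
  qed
  finally show ?thesis by (simp add: nn_integral_kernel[OF \<kappa>])
qed

lemma nn_integral_kernel_right:
  assumes \<kappa>: "kernel \<kappa>" and s: "s \<in> {a..b}"
  shows "(\<integral>\<^sup>+t. ennreal \<bar>\<kappa> (h t - h s)\<bar> \<partial>M) \<le> ennreal (kernel_norm \<kappa> / h'_min)"
proof -
  note [measurable] = kernel_measurable[OF \<kappa>]
  have "(\<integral>\<^sup>+t. ennreal \<bar>\<kappa> (h t - h s)\<bar> \<partial>M) \<le>
      (\<integral>\<^sup>+t. ennreal (1 / h'_min) * ennreal (\<bar>\<kappa> (h t - h s)\<bar> * h' t) \<partial>M)"
  proof (intro nn_integral_mono)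
    fix t assume "t \<in> space M"
    then have t: "t \<in> {a..b}" by simp
    have "\<bar>\<kappa> (h t - h s)\<bar> * h'_min \<le> \<bar>\<kappa> (h t - h s)\<bar> * h' t"
      using h'_bounds(2)[OF t] by (intro mult_left_mono) auto
    then have "\<bar>\<kappa> (h t - h s)\<bar> \<le> 1 / h'_min * (\<bar>\<kappa> (h t - h s)\<bar> * h' t)"
      using h'_bounds(1) by (simp add: field_simps)
    then show "ennreal \<bar>\<kappa> (h t - h s)\<bar> \<le> ennreal (1 / h'_min) * ennreal (\<bar>\<kappa> (h t - h s)\<bar> * h' t)"
      using h'_bounds(1) h'_nonneg[OF t] by (simp add: ennreal_mult[symmetric])
  qed
  also have "\<dots> = ennreal (1 / h'_min) * (\<integral>\<^sup>+t. ennreal (\<bar>\<kappa> (h t - h s)\<bar> * h' t) \<partial>M)"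
    by (rule nn_integral_cmult) measurable
  also have "(\<integral>\<^sup>+t. ennreal (\<bar>\<kappa> (h t - h s)\<bar> * h' t) \<partial>M) =
      (\<integral>\<^sup>+v. ennreal (\<bar>\<kappa> (v - h s)\<bar> * indicator {h a..h b} v) \<partial>lborel)"
    by (rule nn_integral_substitution_h) auto
  also have "\<dots> = (\<integral>\<^sup>+u. ennreal (\<bar>\<kappa> u\<bar> * indicator {h a..h b} (h s + u)) \<partial>lborel)"
    by (subst nn_integral_real_affine[where c = 1 and t = "h s"]) auto
  also have "\<dots> \<le> (\<integral>\<^sup>+u. ennreal (indicator {0..h b - h a} u * \<bar>\<kappa> u\<bar>) \<partial>lborel)"
  proof (intro nn_integral_mono ennreal_leI)
    fix u
    show "\<bar>\<kappa> u\<bar> * indicator {h a..h b} (h s + u) \<le> indicator {0..h b - h a} u * \<bar>\<kappa> u\<bar>"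
      using \<kappa> s h_le_iff[of a s] ab unfolding kernel_def
      by (cases "u \<le> 0") (auto simp: indicator_def)
  qed
  finally show ?thesis
    using h'_bounds(1) kernel_norm_nonneg[of \<kappa>]
    by (simp add: nn_integral_kernel[OF \<kappa>] mult_left_mono ennreal_mult[symmetric])
qed

definition conv_op :: "(real \<Rightarrow> real) \<Rightarrow> (real \<Rightarrow> real) \<Rightarrow> real \<Rightarrow> real" where
  "conv_op \<kappa> f t = (LINT s|M. \<kappa> (h t - h s) * f s * h' s)"

lemma conv_op_measurable [measurable]:
  assumes [measurable]: "\<kappa> \<in> borel_measurable borel" "f \<in> borel_measurable M"
  shows "conv_op \<kappa> f \<in> borel_measurable M"
  unfolding conv_op_def by measurable

text \<open>
  By Tonelli's theorem, since the integral of the kernel over \<open>t\<close> is bounded independently of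
  \<open>s\<close>. Finiteness shows that the singular integrals exist for almost every \<open>t\<close>.
\<close>

lemma nn_integral_conv_op:
  assumes \<kappa>: "kernel \<kappa>" and f: "integrable M f"
  shows "(\<integral>\<^sup>+t. (\<integral>\<^sup>+s. ennreal \<bar>\<kappa> (h t - h s) * f s * h' s\<bar> \<partial>M) \<partial>M) \<le>
     ennreal (h'_max / h'_min * kernel_norm \<kappa> * (LINT s|M. \<bar>f s\<bar>))"
proof -
  note [measurable] = kernel_measurable[OF \<kappa>] borel_measurable_integrable[OF f]
  have "(\<integral>\<^sup>+t. (\<integral>\<^sup>+s. ennreal \<bar>\<kappa> (h t - h s) * f s * h' s\<bar> \<partial>M) \<partial>M) =
      (\<integral>\<^sup>+s. (\<integral>\<^sup>+t. ennreal \<bar>\<kappa> (h t - h s) * f s * h' s\<bar> \<partial>M) \<partial>M)"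
    by (rule MM.Fubini'[symmetric]) measurable
  also have "\<dots> \<le> (\<integral>\<^sup>+s. ennreal (h'_max / h'_min * kernel_norm \<kappa>) * ennreal \<bar>f s\<bar> \<partial>M)"
  proof (intro nn_integral_mono)
    fix s assume "s \<in> space M"
    then have s: "s \<in> {a..b}" by simp
    have "(\<integral>\<^sup>+t. ennreal \<bar>\<kappa> (h t - h s) * f s * h' s\<bar> \<partial>M) =
        (\<integral>\<^sup>+t. ennreal (\<bar>f s\<bar> * h' s) * ennreal \<bar>\<kappa> (h t - h s)\<bar> \<partial>M)"
      using h'_nonneg[OF s] by (intro nn_integral_cong) (simp add: abs_mult ennreal_mult[symmetric] mult_ac)
    also have "\<dots> = ennreal (\<bar>f s\<bar> * h' s) * (\<integral>\<^sup>+t. ennreal \<bar>\<kappa> (h t - h s)\<bar> \<partial>M)"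
      by (rule nn_integral_cmult) measurable
    also have "\<dots> \<le> ennreal (\<bar>f s\<bar> * h'_max) * ennreal (kernel_norm \<kappa> / h'_min)"
      using h'_bounds(3)[OF s]
      by (intro mult_mono nn_integral_kernel_right[OF \<kappa> s] ennreal_leI mult_left_mono) auto
    also have "\<dots> = ennreal (h'_max / h'_min * kernel_norm \<kappa>) * ennreal \<bar>f s\<bar>"
      using kernel_norm_nonneg[of \<kappa>] h'_bounds(1,4) by (simp add: ennreal_mult[symmetric] mult_ac)
    finally show "(\<integral>\<^sup>+t. ennreal \<bar>\<kappa> (h t - h s) * f s * h' s\<bar> \<partial>M) \<le>
      ennreal (h'_max / h'_min * kernel_norm \<kappa>) * ennreal \<bar>f s\<bar>" .
  qed
  also have "\<dots> = ennreal (h'_max / h'_min * kernel_norm \<kappa>) * (\<integral>\<^sup>+s. ennreal \<bar>f s\<bar> \<partial>M)"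
    by (rule nn_integral_cmult) measurable
  also have "(\<integral>\<^sup>+s. ennreal \<bar>f s\<bar> \<partial>M) = ennreal (LINT s|M. \<bar>f s\<bar>)"
    using f by (intro nn_integral_eq_integral) auto
  finally show ?thesis
    using kernel_norm_nonneg[of \<kappa>] h'_bounds(1,4) by (simp add: ennreal_mult[symmetric])
qed

lemma conv_op_integrable_AE:
  assumes \<kappa>: "kernel \<kappa>" and f: "integrable M f"
  shows "AE t in M. integrable M (\<lambda>s. \<kappa> (h t - h s) * f s * h' s)"
proof -
  note [measurable] = kernel_measurable[OF \<kappa>] borel_measurable_integrable[OF f]
  have "AE t in M. (\<integral>\<^sup>+s. ennreal \<bar>\<kappa> (h t - h s) * f s * h' s\<bar> \<partial>M) \<noteq> \<infinity>"
    using nn_integral_conv_op[OF \<kappa> f] by (intro nn_integral_PInf_AE) (auto simp: top_unique)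
  then show ?thesis
  proof (eventually_elim)
    case (elim t)
    then show ?case by (subst integrable_iff_bounded) (auto simp: less_top)
  qed
qed

lemma conv_op_L1:
  assumes \<kappa>: "kernel \<kappa>" and f: "integrable M f"
  shows "integrable M (conv_op \<kappa> f)"
    and "(LINT t|M. \<bar>conv_op \<kappa> f t\<bar>) \<le> h'_max / h'_min * kernel_norm \<kappa> * (LINT s|M. \<bar>f s\<bar>)"
proof -
  note [measurable] = kernel_measurable[OF \<kappa>] borel_measurable_integrable[OF f]
  have "(\<integral>\<^sup>+t. ennreal \<bar>conv_op \<kappa> f t\<bar> \<partial>M) \<le>
      (\<integral>\<^sup>+t. (\<integral>\<^sup>+s. ennreal \<bar>\<kappa> (h t - h s) * f s * h' s\<bar> \<partial>M) \<partial>M)"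
  proof (intro nn_integral_mono_AE)
    show "AE t in M. ennreal \<bar>conv_op \<kappa> f t\<bar> \<le> (\<integral>\<^sup>+s. ennreal \<bar>\<kappa> (h t - h s) * f s * h' s\<bar> \<partial>M)"
      using conv_op_integrable_AE[OF \<kappa> f]
    proof eventually_elim
      case (elim t)
      show ?case
        using integral_norm_bound_ennreal[OF elim] by (simp only: conv_op_def real_norm_def)
    qed
  qed
  also note nn_integral_conv_op[OF \<kappa> f]
  finally have le: "(\<integral>\<^sup>+t. ennreal \<bar>conv_op \<kappa> f t\<bar> \<partial>M) \<le>
     ennreal (h'_max / h'_min * kernel_norm \<kappa> * (LINT s|M. \<bar>f s\<bar>))" .
  show int: "integrable M (conv_op \<kappa> f)"
    using le by (subst integrable_iff_bounded) (auto simp: le_less_trans)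
  have "(\<integral>\<^sup>+t. ennreal \<bar>conv_op \<kappa> f t\<bar> \<partial>M) = ennreal (LINT t|M. \<bar>conv_op \<kappa> f t\<bar>)"
    using int by (intro nn_integral_eq_integral) auto
  moreover have "0 \<le> h'_max / h'_min * kernel_norm \<kappa> * (LINT s|M. \<bar>f s\<bar>)"
    using h'_bounds(1,4) kernel_norm_nonneg[of \<kappa>] by (intro mult_nonneg_nonneg) auto
  ultimately show "(LINT t|M. \<bar>conv_op \<kappa> f t\<bar>) \<le> h'_max / h'_min * kernel_norm \<kappa> * (LINT s|M. \<bar>f s\<bar>)"
    using le by (simp add: ennreal_le_iff)
qed

end

context increasing_C1 begin

subsection \<open>Boundedness\<close>

lemma kernel_weight:
  assumes \<kappa>: "kernel \<kappa>" and t: "t \<in> {a..b}"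
  shows "integrable M (\<lambda>s. \<bar>\<kappa> (h t - h s)\<bar> * \<bar>h' s\<bar>)"
    and "(LINT s|M. \<bar>\<kappa> (h t - h s)\<bar> * \<bar>h' s\<bar>) \<le> kernel_norm \<kappa>"
proof -
  note [measurable] = kernel_measurable[OF \<kappa>]
  have "(\<integral>\<^sup>+s. ennreal (\<bar>\<kappa> (h t - h s)\<bar> * \<bar>h' s\<bar>) \<partial>M) =
      (\<integral>\<^sup>+s. ennreal (\<bar>\<kappa> (h t - h s)\<bar> * h' s) \<partial>M)"
    using h'_nonneg by (intro nn_integral_cong) simp
  also note nn_integral_kernel_left[OF \<kappa> t]
  finally have le: "(\<integral>\<^sup>+s. ennreal (\<bar>\<kappa> (h t - h s)\<bar> * \<bar>h' s\<bar>) \<partial>M) \<le> ennreal (kernel_norm \<kappa>)" .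
  show int: "integrable M (\<lambda>s. \<bar>\<kappa> (h t - h s)\<bar> * \<bar>h' s\<bar>)"
    using le by (subst integrable_iff_bounded) (auto simp: abs_mult intro: le_less_trans)
  have "(\<integral>\<^sup>+s. ennreal (\<bar>\<kappa> (h t - h s)\<bar> * \<bar>h' s\<bar>) \<partial>M) =
      ennreal (LINT s|M. \<bar>\<kappa> (h t - h s)\<bar> * \<bar>h' s\<bar>)"
    using int by (intro nn_integral_eq_integral) auto
  then show "(LINT s|M. \<bar>\<kappa> (h t - h s)\<bar> * \<bar>h' s\<bar>) \<le> kernel_norm \<kappa>"
    using le kernel_norm_nonneg by (simp add: ennreal_le_iff)
qed

definition "young_const = (1 + measure M (space M)) * (h'_max / h'_min)"

lemma young_const_ge_1: "1 \<le> h'_max / h'_min" "h'_max / h'_min \<le> young_const" "0 < young_const"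
proof -
  show 1: "1 \<le> h'_max / h'_min" using h'_bounds(1,4) by simp
  have "1 * (h'_max / h'_min) \<le> young_const"
    unfolding young_const_def using 1 by (intro mult_right_mono) auto
  then show "h'_max / h'_min \<le> young_const" by simp
  then show "0 < young_const" using 1 by linarith
qed

text \<open>
  Young's convolution inequality. The constant exceeds 1 because the norms refer to \<open>dt\<close> and the
  kernel is integrated against \<open>dh\<close>; it matters only that it does not depend on the kernel.
\<close>

lemma conv_op_Lp:
  assumes p: "1 \<le> p" and \<kappa>: "kernel \<kappa>" and f: "f \<in> Lp_space p M"
  shows "conv_op \<kappa> f \<in> Lp_space p M"
    and "Lp_norm p M (conv_op \<kappa> f) \<le> young_const * kernel_norm \<kappa> * Lp_norm p M f"
proof -
  note fm[measurable] = Lp_space_measurable[OF f]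
  note [measurable] = kernel_measurable[OF \<kappa>]
  let ?K = "kernel_norm \<kappa>" and ?N = "Lp_norm p M f"
  have K: "0 \<le> ?K" by (rule kernel_norm_nonneg)
  have N: "0 \<le> ?N" by (rule Lp_norm_nonneg)
  have m: "conv_op \<kappa> f \<in> borel_measurable M" by measurable
  have "conv_op \<kappa> f \<in> Lp_space p M \<and> Lp_norm p M (conv_op \<kappa> f) \<le> young_const * ?K * ?N"
  proof (cases "p = \<infinity>")
    case True
    have bound: "AE t in M. \<bar>conv_op \<kappa> f t\<bar> \<le> ?K * ?N"
    proof (rule AE_I2)
      fix t assume "t \<in> space M"
      then have t: "t \<in> {a..b}" by simp
      have ae: "AE s in M. norm (\<kappa> (h t - h s) * f s * h' s) \<le> \<bar>\<kappa> (h t - h s)\<bar> * \<bar>h' s\<bar> * ?N"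
        using AE_le_Lp_norm_infinity[OF f[unfolded True]]
      proof eventually_elim
        case (elim s)
        then show ?case
          using mult_left_mono[OF elim, of "\<bar>\<kappa> (h t - h s)\<bar> * \<bar>h' s\<bar>"] True
          by (simp add: abs_mult mult_ac)
      qed
      have int: "integrable M (\<lambda>s. \<bar>\<kappa> (h t - h s)\<bar> * \<bar>h' s\<bar> * ?N)"
        using kernel_weight(1)[OF \<kappa> t] by simp
      have "\<bar>conv_op \<kappa> f t\<bar> \<le> (LINT s|M. \<bar>\<kappa> (h t - h s)\<bar> * \<bar>h' s\<bar> * ?N)"
      proof -
        have int': "integrable M (\<lambda>s. \<kappa> (h t - h s) * f s * h' s)"
          by (rule Bochner_Integration.integrable_bound[OF int]) (use ae K N in auto)
        have "\<bar>conv_op \<kappa> f t\<bar> \<le> (LINT s|M. \<bar>\<kappa> (h t - h s) * f s * h' s\<bar>)"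
          unfolding conv_op_def by (rule integral_abs_bound)
        also have "\<dots> \<le> (LINT s|M. \<bar>\<kappa> (h t - h s)\<bar> * \<bar>h' s\<bar> * ?N)"
          using int int' ae by (intro integral_mono_AE) auto
        finally show ?thesis .
      qed
      also have "\<dots> \<le> ?K * ?N"
        using kernel_weight(2)[OF \<kappa> t] N by (simp add: mult_right_mono)
      finally show "\<bar>conv_op \<kappa> f t\<bar> \<le> ?K * ?N" .
    qed
    have KN: "0 \<le> ?K * ?N" using K N by simp
    have "Lp_norm p M (conv_op \<kappa> f) \<le> (1 + measure M (space M)) * (?K * ?N)"
      by (rule Lp_bounded_function(2)[OF p m KN bound])
    also have "\<dots> \<le> (1 + measure M (space M)) * (?K * ?N) * (h'_max / h'_min)"
      using young_const_ge_1(1) KN mult_left_mono[of 1 "h'_max / h'_min" "(1 + measure M (space M)) * (?K * ?N)"]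
      by simp
    also have "\<dots> = young_const * ?K * ?N" by (simp add: young_const_def)
    finally show ?thesis using Lp_bounded_function(1)[OF p m KN bound] by simp
  next
    case False
    define q where "q = enn2real p"
    have q: "1 \<le> q" using enn2real_ge_1[OF p False] by (simp add: q_def)
    have intf: "integrable M f" by (rule Lp_imp_L1(1)[OF p f])
    have intq: "integrable M (\<lambda>x. \<bar>f x\<bar> powr q)"
      using f False by (simp add: Lp_space_def q_def)
    have \<kappa>': "kernel (\<lambda>u. \<bar>\<kappa> u\<bar>)" by (rule kernel_abs[OF \<kappa>])
    let ?g = "conv_op (\<lambda>u. \<bar>\<kappa> u\<bar>) (\<lambda>s. \<bar>f s\<bar> powr q)"
    have pt: "AE t in M. \<bar>conv_op \<kappa> f t\<bar> powr q \<le> ?K powr (q - 1) * ?g t"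
      using conv_op_integrable_AE[OF \<kappa> intf] conv_op_integrable_AE[OF \<kappa>' intq] AE_space
    proof eventually_elim
      case (elim t)
      then have t: "t \<in> {a..b}" by simp
      let ?w = "\<lambda>s. \<bar>\<kappa> (h t - h s)\<bar> * \<bar>h' s\<bar>"
      have i1: "integrable M (\<lambda>s. ?w s * \<bar>f s\<bar>)"
        using integrable_abs[OF elim(1)] by (simp add: abs_mult mult_ac)
      have i2: "integrable M (\<lambda>s. ?w s * \<bar>\<bar>f s\<bar>\<bar> powr q)"
        using integrable_abs[OF elim(2)] by (simp add: abs_mult mult_ac)
      have "\<bar>conv_op \<kappa> f t\<bar> \<le> (LINT s|M. ?w s * \<bar>f s\<bar>)"
        unfolding conv_op_def
        using integral_abs_bound[of M "\<lambda>s. \<kappa> (h t - h s) * f s * h' s"]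
        by (simp add: abs_mult mult_ac)
      then have "\<bar>conv_op \<kappa> f t\<bar> powr q \<le> \<bar>LINT s|M. ?w s * \<bar>f s\<bar>\<bar> powr q"
        using q by (intro powr_mono2) auto
      also have "\<dots> \<le> ?K powr (q - 1) * (LINT s|M. ?w s * \<bar>\<bar>f s\<bar>\<bar> powr q)"
        using kernel_weight[OF \<kappa> t] by (intro weighted_powr_mean[OF q _ _ _ i2 i1]) auto
      also have "(LINT s|M. ?w s * \<bar>\<bar>f s\<bar>\<bar> powr q) = ?g t"
        unfolding conv_op_def using h'_nonneg
        by (intro Bochner_Integration.integral_cong) (auto simp: mult_ac)
      finally show ?case .
    qed
    have intg: "integrable M (\<lambda>t. ?K powr (q - 1) * ?g t)"
      using conv_op_L1(1)[OF \<kappa>' intq] by simp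
    have int: "integrable M (\<lambda>t. \<bar>conv_op \<kappa> f t\<bar> powr q)"
      by (rule Bochner_Integration.integrable_bound[OF intg])
        (use pt in \<open>auto elim!: eventually_mono\<close>)
    have "Lp_norm p M (conv_op \<kappa> f) powr q = (LINT t|M. \<bar>conv_op \<kappa> f t\<bar> powr q)"
      using Lp_norm_powr[OF p False] by (simp add: q_def)
    also have "\<dots> \<le> (LINT t|M. ?K powr (q - 1) * ?g t)"
      by (rule integral_mono_AE[OF int intg pt])
    also have "\<dots> = ?K powr (q - 1) * (LINT t|M. ?g t)" by simp
    also have "(LINT t|M. ?g t) \<le> h'_max / h'_min * ?K * ?N powr q"
    proof -
      have "(LINT t|M. ?g t) \<le> (LINT t|M. \<bar>?g t\<bar>)"
        using conv_op_L1(1)[OF \<kappa>' intq] by (intro integral_mono) auto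
      also have "\<dots> \<le> h'_max / h'_min * ?K * (LINT s|M. \<bar>f s\<bar> powr q)"
        using conv_op_L1(2)[OF \<kappa>' intq] by simp
      finally show ?thesis using Lp_norm_powr[OF p False, of M f] by (simp add: q_def)
    qed
    also have "?K powr (q - 1) * (h'_max / h'_min * ?K * ?N powr q) = h'_max / h'_min * (?K * ?N) powr q"
      using K powr_add[of ?K "q - 1" 1] by (simp add: powr_mult)
    also have "\<dots> \<le> young_const powr q * (?K * ?N) powr q"
    proof (intro mult_right_mono)
      have "h'_max / h'_min \<le> young_const powr 1" using young_const_ge_1 by simp
      also have "\<dots> \<le> young_const powr q"
        using young_const_ge_1 q by (intro powr_mono) linarith+
      finally show "h'_max / h'_min \<le> young_const powr q" .
    qed auto
    also have "\<dots> = (young_const * ?K * ?N) powr q"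
      by (simp add: powr_mult mult.assoc)
    finally have "Lp_norm p M (conv_op \<kappa> f) \<le> young_const * ?K * ?N"
      by (rule powr_le_cancel)
        (use q K N young_const_ge_1(3) in \<open>auto intro!: Lp_norm_nonneg mult_nonneg_nonneg mult_left_mono\<close>)
    then show ?thesis using int m False by (simp add: Lp_space_def q_def)
  qed
  then show "conv_op \<kappa> f \<in> Lp_space p M"
    "Lp_norm p M (conv_op \<kappa> f) \<le> young_const * ?K * ?N" by auto
qed

lemma conv_op_cong_AE:
  assumes "kernel \<kappa>" "f \<in> borel_measurable M" "g \<in> borel_measurable M" "AE s in M. f s = g s"
  shows "conv_op \<kappa> f t = conv_op \<kappa> g t"
proof -
  note [measurable] = kernel_measurable[OF assms(1)] assms(2,3)
  show ?thesis
    unfolding conv_op_def using assms(4)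
    by (intro integral_cong_AE) (auto elim!: eventually_mono)
qed

lemma conv_op_bounded_operator:
  assumes p: "1 \<le> p" and \<kappa>: "kernel \<kappa>"
  shows "Lp_bounded_operator p M (conv_op \<kappa>)"
  unfolding Lp_bounded_operator_def
proof (intro conjI ballI allI impI)
  fix f g assume f: "f \<in> Lp_space p M" and g: "g \<in> Lp_space p M"
  show "conv_op \<kappa> f \<in> Lp_space p M" by (rule conv_op_Lp(1)[OF p \<kappa> f])
  show "AE x in M. conv_op \<kappa> f x = conv_op \<kappa> g x" if "AE x in M. f x = g x"
    using conv_op_cong_AE[OF \<kappa> Lp_space_measurable[OF f] Lp_space_measurable[OF g] that] by simp
  show "AE x in M. conv_op \<kappa> (\<lambda>y. f y + g y) x = conv_op \<kappa> f x + conv_op \<kappa> g x"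
    using conv_op_integrable_AE[OF \<kappa> Lp_imp_L1(1)[OF p f]] conv_op_integrable_AE[OF \<kappa> Lp_imp_L1(1)[OF p g]]
    by eventually_elim (simp add: conv_op_def distrib_left distrib_right)
  show "AE x in M. conv_op \<kappa> (\<lambda>y. c * f y) x = c * conv_op \<kappa> f x" for c
  proof (rule AE_I2)
    fix x
    have "conv_op \<kappa> (\<lambda>y. c * f y) x = (LINT s|M. c * (\<kappa> (h x - h s) * f s * h' s))"
      unfolding conv_op_def by (simp add: mult_ac)
    then show "conv_op \<kappa> (\<lambda>y. c * f y) x = c * conv_op \<kappa> f x"
      by (simp add: conv_op_def)
  qed
next
  show "\<exists>C. \<forall>f\<in>Lp_space p M. Lp_norm p M (conv_op \<kappa> f) \<le> C * Lp_norm p M f"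
    using conv_op_Lp(2)[OF p \<kappa>] by blast
qed

subsection \<open>Composition\<close>

lemma nn_integral_conv_kernels:
  assumes [measurable]: "\<kappa> \<in> borel_measurable borel" "\<nu> \<in> borel_measurable borel"
    and nn: "\<And>u. 0 \<le> \<kappa> u" "\<And>u. 0 \<le> \<nu> u" and z: "\<And>u. u \<le> 0 \<Longrightarrow> \<kappa> u = 0" "\<And>u. u \<le> 0 \<Longrightarrow> \<nu> u = 0"
    and r: "r \<in> {a..b}" and t: "t \<in> {a..b}"
  shows "(\<integral>\<^sup>+s. ennreal (\<kappa> (h t - h s) * \<nu> (h s - h r) * h' s) \<partial>M) =
    (\<integral>\<^sup>+v. ennreal (\<kappa> (h t - h r - v) * \<nu> v) \<partial>lborel)"
proof -
  have "(\<integral>\<^sup>+s. ennreal (\<kappa> (h t - h s) * \<nu> (h s - h r) * h' s) \<partial>M) =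
      (\<integral>\<^sup>+v. ennreal (\<kappa> (h t - v) * \<nu> (v - h r) * indicator {h a..h b} v) \<partial>lborel)"
    by (rule nn_integral_substitution_h[of "\<lambda>v. \<kappa> (h t - v) * \<nu> (v - h r)"]) (use nn in auto)
  also have "\<dots> = (\<integral>\<^sup>+v. ennreal (\<kappa> (h t - v) * \<nu> (v - h r)) \<partial>lborel)"
  proof (intro nn_integral_cong arg_cong[where f = ennreal])
    fix v
    show "\<kappa> (h t - v) * \<nu> (v - h r) * indicator {h a..h b} v = \<kappa> (h t - v) * \<nu> (v - h r)"
    proof (cases "v \<in> {h a..h b}")
      case False
      moreover have "h a \<le> h r" "h t \<le> h b"
        using h_le_iff[of a r] h_le_iff[of t b] r t by auto
      ultimately have "h t - v \<le> 0 \<or> v - h r \<le> 0" by auto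
      then show ?thesis using z by auto
    qed auto
  qed
  also have "\<dots> = (\<integral>\<^sup>+v. ennreal (\<kappa> (h t - (h r + v)) * \<nu> v) \<partial>lborel)"
    by (subst nn_integral_real_affine[where c = 1 and t = "h r"]) auto
  finally show ?thesis by (simp add: algebra_simps)
qed

text \<open>
  Two convolution operators compose to the operator of the convolved kernel. Integrability is
  asked for at a single point because for singular kernels it is known only almost everywhere,
  while for bounded ones the identity is needed at the right end point.
\<close>

lemma conv_op_conv_op:
  assumes \<kappa>: "kernel \<kappa>" "\<And>u. 0 \<le> \<kappa> u" and \<nu>: "kernel \<nu>" "\<And>u. 0 \<le> \<nu> u"
    and \<mu>: "\<mu> \<in> borel_measurable borel" "\<And>u. 0 \<le> \<mu> u"
    and conv: "\<And>u. (\<integral>\<^sup>+v. ennreal (\<kappa> (u - v) * \<nu> v) \<partial>lborel) = ennreal (\<mu> u)"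
    and f: "f \<in> borel_measurable M" and t: "t \<in> {a..b}"
    and int: "integrable M (\<lambda>r. \<mu> (h t - h r) * f r * h' r)"
  shows "conv_op \<kappa> (conv_op \<nu> f) t = conv_op \<mu> f t"
proof -
  note [measurable] = kernel_measurable[OF \<kappa>(1)] kernel_measurable[OF \<nu>(1)] \<mu>(1) f
  let ?F = "\<lambda>s r. \<kappa> (h t - h s) * \<nu> (h s - h r) * h' s * (f r * h' r)"
  have inner: "(\<integral>\<^sup>+s. ennreal (\<kappa> (h t - h s) * \<nu> (h s - h r) * h' s) \<partial>M) = ennreal (\<mu> (h t - h r))"
    if "r \<in> {a..b}" for r
    using \<kappa> \<nu> that t
    by (subst nn_integral_conv_kernels) (auto simp: kernel_def conv)
  have innerL: "(LINT s|M. \<kappa> (h t - h s) * \<nu> (h s - h r) * h' s) = \<mu> (h t - h r)"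
    if r: "r \<in> {a..b}" for r
    using h'_nonneg \<kappa> \<nu> \<mu>(2)
    by (subst integral_eq_nn_integral) (auto intro!: AE_I2 simp: inner[OF r])
  have "(\<integral>\<^sup>+x. ennreal (norm (case_prod ?F x)) \<partial>(M \<Otimes>\<^sub>M M)) = (\<integral>\<^sup>+r. (\<integral>\<^sup>+s. ennreal (norm (?F s r)) \<partial>M) \<partial>M)"
    by (subst MM.nn_integral_snd[symmetric]) auto
  also have "\<dots> = (\<integral>\<^sup>+r. ennreal \<bar>\<mu> (h t - h r) * f r * h' r\<bar> \<partial>M)"
  proof (intro nn_integral_cong)
    fix r assume "r \<in> space M"
    then have r: "r \<in> {a..b}" by simp
    have "(\<integral>\<^sup>+s. ennreal (norm (?F s r)) \<partial>M) =
        (\<integral>\<^sup>+s. ennreal (\<kappa> (h t - h s) * \<nu> (h s - h r) * h' s) * ennreal \<bar>f r * h' r\<bar> \<partial>M)"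
      using \<kappa>(2) \<nu>(2) h'_nonneg
      by (intro nn_integral_cong) (auto simp: abs_mult ennreal_mult[symmetric])
    also have "\<dots> = ennreal (\<mu> (h t - h r)) * ennreal \<bar>f r * h' r\<bar>"
      by (subst nn_integral_multc) (auto simp: inner[OF r])
    also have "\<dots> = ennreal \<bar>\<mu> (h t - h r) * f r * h' r\<bar>"
      using \<mu>(2)[of "h t - h r"] by (simp add: abs_mult ennreal_mult[symmetric])
    finally show "(\<integral>\<^sup>+s. ennreal (norm (?F s r)) \<partial>M) = ennreal \<bar>\<mu> (h t - h r) * f r * h' r\<bar>" .
  qed
  also have "\<dots> < \<infinity>" using int by (simp add: integrable_iff_bounded)
  finally have intF: "integrable (M \<Otimes>\<^sub>M M) (case_prod ?F)"
    by (intro integrableI_bounded) auto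
  have "conv_op \<kappa> (conv_op \<nu> f) t = (LINT s|M. (LINT r|M. ?F s r))"
    unfolding conv_op_def
  proof (intro Bochner_Integration.integral_cong refl)
    fix s
    have "(LINT r|M. ?F s r) = (LINT r|M. (\<kappa> (h t - h s) * h' s) * (\<nu> (h s - h r) * f r * h' r))"
      by (intro Bochner_Integration.integral_cong) (auto simp: mult_ac)
    then show "\<kappa> (h t - h s) * (LINT r|M. \<nu> (h s - h r) * f r * h' r) * h' s = (LINT r|M. ?F s r)"
      by simp
  qed
  also have "\<dots> = (LINT r|M. (LINT s|M. ?F s r))"
    by (rule MM.Fubini_integral[OF intF, symmetric])
  also have "\<dots> = conv_op \<mu> f t"
    unfolding conv_op_def
    by (intro Bochner_Integration.integral_cong) (auto simp: innerL)
  finally show ?thesis .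
qed

text \<open>
  The case in which the second operator is replaced by a point mass at the left end point. It
  evaluates convolutions on powers and on exponentials of \<open>h(s) - h(a)\<close>.
\<close>

lemma conv_op_shifted_kernel:
  assumes \<kappa>: "kernel \<kappa>" "\<And>u. 0 \<le> \<kappa> u" and \<nu>: "kernel \<nu>" "\<And>u. 0 \<le> \<nu> u" and \<mu>: "\<And>u. 0 \<le> \<mu> u"
    and conv: "\<And>u. (\<integral>\<^sup>+v. ennreal (\<kappa> (u - v) * \<nu> v) \<partial>lborel) = ennreal (\<mu> u)"
    and t: "t \<in> {a..b}"
  shows "conv_op \<kappa> (\<lambda>s. \<nu> (h s - h a)) t = \<mu> (h t - h a)"
proof -
  note [measurable] = kernel_measurable[OF \<kappa>(1)] kernel_measurable[OF \<nu>(1)]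
  have "(\<integral>\<^sup>+s. ennreal (\<kappa> (h t - h s) * \<nu> (h s - h a) * h' s) \<partial>M) = ennreal (\<mu> (h t - h a))"
    using \<kappa> \<nu> t ab by (subst nn_integral_conv_kernels) (auto simp: kernel_def conv)
  then show ?thesis
    unfolding conv_op_def using h'_nonneg \<kappa> \<nu> \<mu>
    by (subst integral_eq_nn_integral) (auto intro!: AE_I2)
qed

end

section \<open>Fractional integrals\<close>

text \<open>
  In the variable \<open>u = h(t) - h(s)\<close> the fractional integral of order \<open>\<alpha>\<close> is convolution with
  \<open>u\<^bsup>\<alpha>-1\<^esup>/\<Gamma>(\<alpha>)\<close>; the constant is such that these kernels form a semigroup under convolution.
\<close>

definition frac_kernel :: "real \<Rightarrow> real \<Rightarrow> real" where
  "frac_kernel \<alpha> u = (if u > 0 then u powr (\<alpha> - 1) / Gamma \<alpha> else 0)"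

text \<open>
  Convolution with this kernel solves Volterra's equation of the second kind: if
  \<open>y(t) = r(t) + x \<integral>\<^sub>0\<^sup>t y\<close>, then \<open>\<integral>\<^sub>0\<^sup>t y\<close> is the convolution of \<open>exp (x u)\<close> with \<open>r\<close>.
\<close>

definition exp_kernel :: "real \<Rightarrow> real \<Rightarrow> real" where
  "exp_kernel x u = (if u > 0 then exp (x * u) else 0)"

lemma frac_kernel_measurable [measurable]: "frac_kernel \<alpha> \<in> borel_measurable borel"
  unfolding frac_kernel_def by measurable

lemma exp_kernel_measurable [measurable]: "exp_kernel x \<in> borel_measurable borel"
  unfolding exp_kernel_def by measurable

lemma frac_kernel_nonneg: "0 < \<alpha> \<Longrightarrow> 0 \<le> frac_kernel \<alpha> u"
  by (auto simp: frac_kernel_def intro!: divide_nonneg_nonneg less_imp_le[OF Gamma_real_pos])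

lemma exp_kernel_nonneg: "0 \<le> exp_kernel x u"
  by (simp add: exp_kernel_def)

lemma frac_kernel_1: "frac_kernel 1 u = (if u > 0 then 1 else 0)"
  by (simp add: frac_kernel_def)

lemma nn_integral_conv_commute:
  fixes \<kappa> \<nu> :: "real \<Rightarrow> real"
  assumes [measurable]: "\<kappa> \<in> borel_measurable borel" "\<nu> \<in> borel_measurable borel"
  shows "(\<integral>\<^sup>+v. ennreal (\<kappa> (u - v) * \<nu> v) \<partial>lborel) = (\<integral>\<^sup>+v. ennreal (\<nu> (u - v) * \<kappa> v) \<partial>lborel)"
  by (subst nn_integral_real_affine[where c = "-1" and t = u]) (auto simp: mult.commute)

text \<open>Euler's Beta integral, rescaled to the interval \<open>[0, u]\<close>.\<close>

lemma frac_kernel_conv: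
  assumes \<alpha>: "0 < \<alpha>" and \<beta>: "0 < \<beta>"
  shows "(\<integral>\<^sup>+v. ennreal (frac_kernel \<alpha> (u - v) * frac_kernel \<beta> v) \<partial>lborel) = ennreal (frac_kernel (\<alpha> + \<beta>) u)"
proof (cases "0 < u")
  case False
  then have "frac_kernel \<alpha> (u - v) * frac_kernel \<beta> v = 0" for v
    by (auto simp: frac_kernel_def)
  then show ?thesis using False by (simp only:) (simp add: frac_kernel_def)
next
  case u: True
  have G: "Gamma \<alpha> > 0" "Gamma \<beta> > 0" "Gamma (\<alpha> + \<beta>) > 0"
    using \<alpha> \<beta> by (auto intro!: Gamma_real_pos)
  define c where "c = u powr (\<alpha> + \<beta> - 2) / (Gamma \<alpha> * Gamma \<beta>)"
  have c: "0 \<le> c" using G by (simp add: c_def)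
  define B where "B w = w powr (\<beta> - 1) * (1 - w) powr (\<alpha> - 1)" for w :: real
  have pt: "frac_kernel \<alpha> (0 + u * w) * frac_kernel \<beta> (u - (0 + u * w)) =
     c * (B (1 - w) * indicator {0..1} w)" for w
  proof -
    have *: "u - u * w = u * (1 - w)" "0 + u * w = u * w" by (simp_all add: algebra_simps)
    consider "w < 0" | "w > 1" | "w = 0" | "w = 1" | "0 < w" "w < 1" by linarith
    then show ?thesis
    proof cases
      case 1
      then have "\<not> 0 < u * w" using u by (simp add: zero_less_mult_iff)
      then show ?thesis using 1 by (simp add: frac_kernel_def)
    next
      case 2
      then have "frac_kernel \<beta> (u * (1 - w)) = 0"
        using u mult_nonneg_nonpos[of u "1 - w"] unfolding frac_kernel_def by auto
      then show ?thesis using 2 unfolding * by (simp only: mult_zero_right indicator_def) simp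
    next
      case 5
      have "frac_kernel \<alpha> (u * w) * frac_kernel \<beta> (u * (1 - w)) =
         (u powr (\<alpha> - 1) * u powr (\<beta> - 1)) * (w powr (\<alpha> - 1) * (1 - w) powr (\<beta> - 1)) / (Gamma \<alpha> * Gamma \<beta>)"
        using 5 u by (simp add: frac_kernel_def powr_mult)
      also have "u powr (\<alpha> - 1) * u powr (\<beta> - 1) = u powr (\<alpha> + \<beta> - 2)"
        using u by (simp add: powr_add[symmetric])
      finally show ?thesis using 5 unfolding * by (simp add: c_def B_def mult_ac)
    qed (auto simp: frac_kernel_def B_def)
  qed
  have "(\<integral>\<^sup>+v. ennreal (frac_kernel \<alpha> (u - v) * frac_kernel \<beta> v) \<partial>lborel) =
      (\<integral>\<^sup>+v. ennreal (frac_kernel \<alpha> v * frac_kernel \<beta> (u - v)) \<partial>lborel)"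
    by (subst nn_integral_conv_commute) (auto simp: mult.commute)
  also have "\<dots> = ennreal u * (\<integral>\<^sup>+w. ennreal (c * (B (1 - w) * indicator {0..1} w)) \<partial>lborel)"
    using u by (subst nn_integral_real_affine[where c = u and t = 0]) (auto simp only: pt abs_of_pos frac_kernel_measurable, measurable)
  also have "(\<integral>\<^sup>+w. ennreal (c * (B (1 - w) * indicator {0..1} w)) \<partial>lborel) =
      ennreal c * (\<integral>\<^sup>+w. ennreal (B (1 - w) * indicator {0..1} w) \<partial>lborel)"
    using c by (subst nn_integral_cmult[symmetric]) (auto simp: ennreal_mult' B_def)
  also have "(\<integral>\<^sup>+w. ennreal (B (1 - w) * indicator {0..1} w) \<partial>lborel) =
      (\<integral>\<^sup>+w. ennreal (w powr (\<alpha> - 1) * (1 - w) powr (\<beta> - 1)) * indicator {0..1} w \<partial>lborel)"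
    by (intro nn_integral_cong) (auto simp: B_def indicator_def mult_ac)
  also have "\<dots> = ennreal (Beta \<alpha> \<beta>)"
    using \<alpha> \<beta> by (intro nn_integral_has_integral_lebesgue' has_integral_Beta_real) auto
  also have "ennreal u * (ennreal c * ennreal (Beta \<alpha> \<beta>)) = ennreal (u * (c * Beta \<alpha> \<beta>))"
  proof -
    have "0 \<le> Beta \<alpha> \<beta>" using G by (simp add: Beta_def)
    then show ?thesis using u c by (simp add: ennreal_mult')
  qed
  also have "u * (c * Beta \<alpha> \<beta>) = (u powr 1 * u powr (\<alpha> + \<beta> - 2)) / Gamma (\<alpha> + \<beta>)"
    using u G by (simp add: c_def Beta_def)
  also have "u powr 1 * u powr (\<alpha> + \<beta> - 2) = u powr (\<alpha> + \<beta> - 1)"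
    unfolding powr_add[symmetric] by simp
  finally show ?thesis using u by (simp add: frac_kernel_def)
qed

lemma exp_kernel_conv:
  assumes x: "x \<noteq> 0"
  shows "(\<integral>\<^sup>+v. ennreal (exp_kernel x (u - v) * frac_kernel 1 v) \<partial>lborel) =
     ennreal ((exp_kernel x u - frac_kernel 1 u) / x)"
proof (cases "0 < u")
  case False
  then have "exp_kernel x (u - v) * frac_kernel 1 v = 0" for v
    by (auto simp: frac_kernel_def exp_kernel_def)
  then show ?thesis using False by (simp only:) (simp add: frac_kernel_def exp_kernel_def)
next
  case u: True
  have "((\<lambda>v. exp (x * (u - v))) has_integral (- exp (x * (u - u)) / x - (- exp (x * (u - 0)) / x))) {0..u}"
    using u x
    by (intro fundamental_theorem_of_calculus)
      (auto simp flip: has_real_derivative_iff_has_vector_derivative intro!: derivative_eq_intros)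
  then have int: "((\<lambda>v. exp (x * (u - v))) has_integral ((exp (x * u) - 1) / x)) {0<..<u}"
    by (simp add: has_integral_Icc_iff_Ioo diff_divide_distrib)
  have "(\<integral>\<^sup>+v. ennreal (exp_kernel x (u - v) * frac_kernel 1 v) \<partial>lborel) =
      (\<integral>\<^sup>+v. ennreal (exp (x * (u - v))) * indicator {0<..<u} v \<partial>lborel)"
    by (intro nn_integral_cong) (auto simp: frac_kernel_1 exp_kernel_def indicator_def)
  also have "\<dots> = ennreal ((exp (x * u) - 1) / x)"
    using int by (intro nn_integral_has_integral_lebesgue') auto
  finally show ?thesis using u by (simp add: frac_kernel_1 exp_kernel_def)
qed

lemma frac_kernel_integrable:
  assumes "0 < \<alpha>" "0 \<le> l"
  shows "integrable lborel (\<lambda>u. indicator {0..l} u * frac_kernel \<alpha> u)"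
proof (rule integrableI_bounded)
  have "((\<lambda>u. u powr (\<alpha> - 1) * (1 / Gamma \<alpha>)) has_integral (l powr (\<alpha> - 1 + 1) / (\<alpha> - 1 + 1)) * (1 / Gamma \<alpha>)) {0..l}"
    using assms by (intro has_integral_mult_left has_integral_powr_from_0) auto
  then have int: "((\<lambda>u. u powr (\<alpha> - 1) / Gamma \<alpha>) has_integral (l powr \<alpha> / \<alpha>) * (1 / Gamma \<alpha>)) {0..l}"
    by simp
  have "(\<integral>\<^sup>+u. ennreal (norm (indicator {0..l} u * frac_kernel \<alpha> u)) \<partial>lborel) =
     (\<integral>\<^sup>+u. ennreal (u powr (\<alpha> - 1) / Gamma \<alpha>) * indicator {0..l} u \<partial>lborel)"
    using frac_kernel_nonneg[OF assms(1)]
    by (intro nn_integral_cong) (auto simp: indicator_def frac_kernel_def)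
  also have "\<dots> = ennreal ((l powr \<alpha> / \<alpha>) * (1 / Gamma \<alpha>))"
    using int assms(1) by (intro nn_integral_has_integral_lebesgue') (auto intro!: divide_nonneg_nonneg less_imp_le[OF Gamma_real_pos])
  finally show "(\<integral>\<^sup>+u. ennreal (norm (indicator {0..l} u * frac_kernel \<alpha> u)) \<partial>lborel) < \<infinity>" by simp
qed auto

text \<open>
  Near \<open>\<alpha>\<close> all kernels are dominated by one integrable function, since
  \<open>u\<^bsup>\<beta>-1\<^esup> \<le> u\<^bsup>\<alpha>/2-1\<^esup> + u\<^bsup>2\<alpha>-1\<^esup>\<close> for \<open>\<alpha>/2 \<le> \<beta> \<le> 2\<alpha>\<close>.
\<close>

lemma frac_kernel_L1_continuous:
  assumes \<alpha>: "0 < \<alpha>" and l: "0 \<le> l"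
  shows "((\<lambda>\<beta>. LINT u|lborel. indicator {0..l} u * \<bar>frac_kernel \<beta> u - frac_kernel \<alpha> u\<bar>) \<longlongrightarrow> 0)
    (at \<alpha> within {0<..})"
  unfolding tendsto_at_iff_sequentially
proof (intro allI impI)
  fix X :: "nat \<Rightarrow> real" assume X: "X \<longlonglongrightarrow> \<alpha>"
  define Y where "Y n = max (\<alpha>/2) (min (2*\<alpha>) (X n))" for n
  have Y: "Y n \<in> {\<alpha>/2..2*\<alpha>}" for n using \<alpha> by (auto simp: Y_def)
  have "Y \<longlonglongrightarrow> max (\<alpha>/2) (min (2*\<alpha>) \<alpha>)"
    unfolding Y_def by (intro tendsto_intros X)
  then have limY: "Y \<longlonglongrightarrow> \<alpha>" using \<alpha> by (simp add: max_def min_def)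
  have "\<forall>\<^sub>F n in sequentially. X n \<in> {\<alpha>/2<..<2*\<alpha>}"
    using X \<alpha> by (intro topological_tendstoD) auto
  then have ev: "\<forall>\<^sub>F n in sequentially. Y n = X n"
    by eventually_elim (auto simp: Y_def)
  have "Gamma \<beta> \<noteq> 0" if "\<beta> \<in> {\<alpha>/2..2*\<alpha>}" for \<beta>
    using Gamma_real_pos[of \<beta>] that \<alpha> by fastforce
  then have "continuous_on {\<alpha>/2..2*\<alpha>} (\<lambda>\<beta>. inverse (Gamma \<beta>))"
    using \<alpha> by (intro continuous_intros continuous_on_inverse) (auto dest!: nonpos_Ints_nonpos)
  then have "bounded ((\<lambda>\<beta>. inverse (Gamma \<beta>)) ` {\<alpha>/2..2*\<alpha>})"
    by (intro compact_imp_bounded compact_continuous_image) auto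
  then obtain B where "\<forall>y\<in>(\<lambda>\<beta>. inverse (Gamma \<beta>)) ` {\<alpha>/2..2*\<alpha>}. norm y \<le> B"
    unfolding bounded_iff by blast
  then have B: "\<bar>inverse (Gamma \<beta>)\<bar> \<le> B" if "\<beta> \<in> {\<alpha>/2..2*\<alpha>}" for \<beta>
    using that by fastforce
  define w where "w u = B * Gamma (\<alpha>/2) * (indicator {0..l} u * frac_kernel (\<alpha>/2) u) +
     B * Gamma (2*\<alpha>) * (indicator {0..l} u * frac_kernel (2*\<alpha>) u) + indicator {0..l} u * frac_kernel \<alpha> u" for u
  have "(\<lambda>n. LINT u|lborel. indicator {0..l} u * \<bar>frac_kernel (Y n) u - frac_kernel \<alpha> u\<bar>)
     \<longlonglongrightarrow> (LINT u|(lborel :: real measure). 0)"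
  proof (rule integral_dominated_convergence[where w = w])
    show "integrable lborel w"
      unfolding w_def using \<alpha> l
      by (intro Bochner_Integration.integrable_add integrable_mult_right frac_kernel_integrable) auto
    show "AE u in lborel. (\<lambda>n. indicator {0..l} u * \<bar>frac_kernel (Y n) u - frac_kernel \<alpha> u\<bar>) \<longlonglongrightarrow> 0"
    proof (rule AE_I2)
      fix u :: real
      have "(\<lambda>n. frac_kernel (Y n) u) \<longlonglongrightarrow> frac_kernel \<alpha> u"
      proof (cases "u > 0")
        case True
        have "(\<lambda>n. u powr (Y n - 1) / Gamma (Y n)) \<longlonglongrightarrow> u powr (\<alpha> - 1) / Gamma \<alpha>"
          using True \<alpha> less_imp_neq[OF Gamma_real_pos[OF \<alpha>]]
          by (intro tendsto_intros limY) (auto dest: nonpos_Ints_nonpos)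
        then show ?thesis using True by (simp add: frac_kernel_def)
      qed (simp add: frac_kernel_def)
      then have "(\<lambda>n. indicator {0..l} u * \<bar>frac_kernel (Y n) u - frac_kernel \<alpha> u\<bar>) \<longlonglongrightarrow>
          indicator {0..l} u * \<bar>frac_kernel \<alpha> u - frac_kernel \<alpha> u\<bar>"
        by (intro tendsto_intros)
      then show "(\<lambda>n. indicator {0..l} u * \<bar>frac_kernel (Y n) u - frac_kernel \<alpha> u\<bar>) \<longlonglongrightarrow> 0" by simp
    qed
    show "AE u in lborel. norm (indicator {0..l} u * \<bar>frac_kernel (Y n) u - frac_kernel \<alpha> u\<bar>) \<le> w u" for n
    proof (rule AE_I2)
      fix u :: real
      let ?\<beta> = "Y n"
      have \<beta>: "\<alpha>/2 \<le> ?\<beta>" "?\<beta> \<le> 2*\<alpha>" "0 < ?\<beta>" using Y[of n] \<alpha> by auto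
      have B0: "0 \<le> B" using order_trans[OF abs_ge_zero B[OF Y[of n]]] .
      have Gp: "0 < Gamma (\<alpha>/2)" "0 < Gamma (2*\<alpha>)" using \<alpha> by (auto intro!: Gamma_real_pos)
      have "frac_kernel ?\<beta> u \<le> B * Gamma (\<alpha>/2) * frac_kernel (\<alpha>/2) u + B * Gamma (2*\<alpha>) * frac_kernel (2*\<alpha>) u"
      proof (cases "u > 0")
        case True
        have "u powr (?\<beta> - 1) \<le> u powr (\<alpha>/2 - 1) + u powr (2*\<alpha> - 1)"
        proof (cases "u \<le> 1")
          case True
          then have "u powr (?\<beta> - 1) \<le> u powr (\<alpha>/2 - 1)"
            using \<open>u > 0\<close> \<beta> by (intro powr_mono') auto
          then show ?thesis by (simp add: add_increasing2)
        next
          case False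
          then have "u powr (?\<beta> - 1) \<le> u powr (2*\<alpha> - 1)"
            using \<beta> by (intro powr_mono) auto
          then show ?thesis by (simp add: add_increasing)
        qed
        then have "u powr (?\<beta> - 1) * inverse (Gamma ?\<beta>) \<le> (u powr (\<alpha>/2 - 1) + u powr (2*\<alpha> - 1)) * B"
          using B[OF Y[of n]] Gamma_real_pos[OF \<beta>(3)] by (intro mult_mono) auto
        then show ?thesis using True Gp by (simp add: frac_kernel_def field_simps)
      qed (simp add: frac_kernel_def)
      moreover have "0 \<le> frac_kernel ?\<beta> u" "0 \<le> frac_kernel \<alpha> u"
        using \<beta> \<alpha> by (auto intro!: frac_kernel_nonneg)
      ultimately show "norm (indicator {0..l} u * \<bar>frac_kernel ?\<beta> u - frac_kernel \<alpha> u\<bar>) \<le> w u"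
        by (auto simp: w_def indicator_def)
    qed
  qed auto
  then have "(\<lambda>n. LINT u|lborel. indicator {0..l} u * \<bar>frac_kernel (Y n) u - frac_kernel \<alpha> u\<bar>) \<longlonglongrightarrow> 0"
    by simp
  then have "(\<lambda>n. LINT u|lborel. indicator {0..l} u * \<bar>frac_kernel (X n) u - frac_kernel \<alpha> u\<bar>) \<longlonglongrightarrow> 0"
    by (rule Lim_transform_eventually) (use ev in \<open>auto elim!: eventually_mono\<close>)
  then show "((\<lambda>\<beta>. LINT u|lborel. indicator {0..l} u * \<bar>frac_kernel \<beta> u - frac_kernel \<alpha> u\<bar>) \<circ> X) \<longlonglongrightarrow> 0"
    by (simp add: o_def)
qed

context increasing_C1 begin

lemma h_range_pos: "0 < h b - h a"
  using h_less[of a b] ab by simp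

lemma kernel_frac: "0 < \<alpha> \<Longrightarrow> kernel (frac_kernel \<alpha>)"
  using frac_kernel_integrable[of \<alpha> "h b - h a"] h_range_pos
  unfolding kernel_def by (auto simp: frac_kernel_def[of _ "_::real"])

lemma kernel_exp: "kernel (exp_kernel x)"
  unfolding kernel_def
proof (intro conjI allI impI)
  show "integrable lborel (\<lambda>u. indicator {0..h b - h a} u * exp_kernel x u)"
  proof (rule Bochner_Integration.integrable_bound)
    show "integrable lborel (\<lambda>u. exp (\<bar>x\<bar> * (h b - h a)) * indicator {0..h b - h a} u)"
      by (intro integrable_mult_right integrable_real_indicator) (auto simp: emeasure_lborel_Icc_eq)
    show "AE u in lborel. norm (indicator {0..h b - h a} u * exp_kernel x u) \<le>
        norm (exp (\<bar>x\<bar> * (h b - h a)) * indicator {0..h b - h a} u)"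
    proof (rule AE_I2)
      fix u
      have "x * u \<le> \<bar>x\<bar> * (h b - h a)" if "u \<in> {0..h b - h a}"
        using that by (intro mult_mono) auto
      then show "norm (indicator {0..h b - h a} u * exp_kernel x u) \<le>
        norm (exp (\<bar>x\<bar> * (h b - h a)) * indicator {0..h b - h a} u)"
        by (auto simp: exp_kernel_def indicator_def)
    qed
  qed auto
qed (auto simp: exp_kernel_def)

abbreviation frac_int :: "real \<Rightarrow> (real \<Rightarrow> real) \<Rightarrow> real \<Rightarrow> real" where
  "frac_int \<alpha> \<equiv> conv_op (frac_kernel \<alpha>)"

abbreviation V :: "(real \<Rightarrow> real) \<Rightarrow> real \<Rightarrow> real" where
  "V \<equiv> frac_int 1"

lemma RL_integral_eq_frac_int:
  assumes t: "t \<in> {a..b}"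
  shows "RL_integral h h' a \<alpha> f t = frac_int \<alpha> f t"
proof -
  have "RL_integral h h' a \<alpha> f t =
      (LINT s|lebesgue. indicator {a..b} s *\<^sub>R (frac_kernel \<alpha> (h t - h s) * f s * h' s))"
    unfolding RL_integral_def set_lebesgue_integral_def
  proof (intro Bochner_Integration.integral_cong refl)
    fix s
    show "indicator {a..t} s *\<^sub>R ((h t - h s) powr (\<alpha> - 1) / Gamma \<alpha> * f s * h' s) =
      indicator {a..b} s *\<^sub>R (frac_kernel \<alpha> (h t - h s) * f s * h' s)"
      using t h_less_iff[of s t] by (cases "s = t") (auto simp: indicator_def frac_kernel_def)
  qed
  also have "\<dots> = frac_int \<alpha> f t"
    unfolding conv_op_def by (subst integral_restrict_space) auto
  finally show ?thesis .
qed

lemma V_eq_primitive: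
  assumes "t \<in> {a..b}"
  shows "V f t = (LINT s|M. (if s < t then f s * h' s else 0))"
  unfolding conv_op_def using assms h_less_iff
  by (intro Bochner_Integration.integral_cong) (auto simp: frac_kernel_1)

lemma V_continuous:
  assumes "integrable M f"
  shows "continuous_on {a..b} (V f)"
  using continuous_on_primitive[OF integrable_times_h'[OF assms]]
  by (subst continuous_on_cong[OF refl V_eq_primitive]) auto

lemma V_injective:
  assumes f: "integrable M f" and "AE t in M. V f t = 0"
  shows "AE t in M. f t = 0"
proof -
  have "AE t in M. (LINT s|M. (if s < t then f s * h' s else 0)) = 0"
    using assms(2) AE_space by eventually_elim (simp add: V_eq_primitive)
  then have "AE s in M. f s * h' s = 0"
    by (rule AE_zero_if_primitive_zero[OF ab integrable_times_h'[OF f]])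
  then show ?thesis
    using AE_space by eventually_elim (use h'_pos in fastforce)
qed

text \<open>The index law, from the semigroup property of the kernels.\<close>

lemma frac_int_frac_int:
  assumes "0 < \<alpha>" "0 < \<beta>" and f: "integrable M f"
  shows "AE t in M. frac_int \<alpha> (frac_int \<beta> f) t = frac_int (\<alpha> + \<beta>) f t"
proof -
  have "kernel (frac_kernel (\<alpha> + \<beta>))" using assms by (intro kernel_frac) auto
  from conv_op_integrable_AE[OF this f] AE_space
  show ?thesis
  proof eventually_elim
    case (elim t)
    then show ?case
      using assms
      by (intro conv_op_conv_op kernel_frac frac_kernel_conv frac_kernel_nonneg) auto
  qed
qed

lemma frac_int_power:
  assumes "0 < \<alpha>" "0 < \<beta>" "t \<in> {a..b}"
  shows "frac_int \<alpha> (\<lambda>s. frac_kernel \<beta> (h s - h a)) t = frac_kernel (\<alpha> + \<beta>) (h t - h a)"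
  using assms by (intro conv_op_shifted_kernel kernel_frac frac_kernel_conv frac_kernel_nonneg) auto

lemma frac_kernel_1_AE: "AE s in M. frac_kernel 1 (h s - h a) = 1"
proof -
  have "AE s in M. s \<noteq> a"
    using AE_completion[OF AE_lborel_singleton[of a]] by (auto simp: AE_restrict_space_iff)
  then show ?thesis
    using AE_space by eventually_elim (use h_less_iff[of a] ab in \<open>auto simp: frac_kernel_1\<close>)
qed

lemma frac_int_1:
  assumes "0 < \<alpha>" "t \<in> {a..b}"
  shows "frac_int \<alpha> (\<lambda>s. 1) t = frac_kernel (\<alpha> + 1) (h t - h a)"
proof -
  have "frac_int \<alpha> (\<lambda>s. 1) t = frac_int \<alpha> (\<lambda>s. frac_kernel 1 (h s - h a)) t"
    using frac_kernel_1_AE assms(1) by (intro conv_op_cong_AE kernel_frac) auto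
  then show ?thesis using frac_int_power[of \<alpha> 1 t] assms by simp
qed

text \<open>
  The family of fractional integrals is norm continuous because operator norms are
  bounded by \<open>L\<^sup>1\<close> norms of kernels.
\<close>

lemma frac_int_onorm_continuous:
  assumes p: "1 \<le> p" and \<alpha>: "0 < \<alpha>"
  shows "((\<lambda>\<beta>. Lp_onorm p M (\<lambda>f t. RL_integral h h' a \<beta> f t - RL_integral h h' a \<alpha> f t)) \<longlongrightarrow> 0)
     (at \<alpha> within {0<..})"
proof (rule tendsto_sandwich)
  let ?D = "\<lambda>\<beta> u. frac_kernel \<beta> u - frac_kernel \<alpha> u"
  let ?T = "\<lambda>\<beta> f t. RL_integral h h' a \<beta> f t - RL_integral h h' a \<alpha> f t"
  have bound: "0 \<le> Lp_onorm p M (?T \<beta>)" "Lp_onorm p M (?T \<beta>) \<le> young_const * kernel_norm (?D \<beta>)"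
    if \<beta>: "0 < \<beta>" for \<beta>
  proof -
    have kD: "kernel (?D \<beta>)" using \<alpha> \<beta> by (intro kernel_diff kernel_frac)
    have C: "0 \<le> young_const * kernel_norm (?D \<beta>)"
      using young_const_ge_1(3) kernel_norm_nonneg[of "?D \<beta>"] by (intro mult_nonneg_nonneg) auto
    have le: "Lp_norm p M (?T \<beta> f) \<le> young_const * kernel_norm (?D \<beta>) * Lp_norm p M f"
      if f: "f \<in> Lp_space p M" for f
    proof -
      have fi: "integrable M f" by (rule Lp_imp_L1(1)[OF p f])
      have "AE t in M. \<bar>?T \<beta> f t\<bar> \<le> 1 * \<bar>conv_op (?D \<beta>) f t\<bar>"
        using conv_op_integrable_AE[OF kernel_frac[OF \<beta>] fi] conv_op_integrable_AE[OF kernel_frac[OF \<alpha>] fi] AE_space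
      proof eventually_elim
        case (elim t)
        then have "t \<in> {a..b}" by simp
        then have "?T \<beta> f t = frac_int \<beta> f t - frac_int \<alpha> f t" by (simp add: RL_integral_eq_frac_int)
        also have "\<dots> = conv_op (?D \<beta>) f t"
          using elim unfolding conv_op_def by (simp add: left_diff_distrib)
        finally show ?case by simp
      qed
      moreover have "?T \<beta> f \<in> borel_measurable M"
      proof -
        have "(\<lambda>t. frac_int \<beta> f t - frac_int \<alpha> f t) \<in> borel_measurable M" using fi by simp
        then show ?thesis
          by (subst measurable_cong[of M _ "\<lambda>t. frac_int \<beta> f t - frac_int \<alpha> f t"])
            (auto simp: RL_integral_eq_frac_int)
      qed
      ultimately have "Lp_norm p M (?T \<beta> f) \<le> 1 * Lp_norm p M (conv_op (?D \<beta>) f)"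
        by (intro Lp_dominated(2)[OF p conv_op_Lp(1)[OF p kD f]]) auto
      then show ?thesis using conv_op_Lp(2)[OF p kD f] by simp
    qed
    show "0 \<le> Lp_onorm p M (?T \<beta>)" "Lp_onorm p M (?T \<beta>) \<le> young_const * kernel_norm (?D \<beta>)"
      using Lp_onorm_le[OF p C le] by auto
  qed
  have pos: "\<forall>\<^sub>F \<beta> in at \<alpha> within {0<..}. 0 < \<beta>"
    by (simp add: eventually_at_filter)
  show "\<forall>\<^sub>F \<beta> in at \<alpha> within {0<..}. 0 \<le> Lp_onorm p M (?T \<beta>)"
    using pos by eventually_elim (rule bound(1))
  show "\<forall>\<^sub>F \<beta> in at \<alpha> within {0<..}. Lp_onorm p M (?T \<beta>) \<le> young_const * kernel_norm (?D \<beta>)"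
    using pos by eventually_elim (rule bound(2))
  have "((\<lambda>\<beta>. kernel_norm (?D \<beta>)) \<longlongrightarrow> 0) (at \<alpha> within {0<..})"
    unfolding kernel_norm_def using \<alpha> h_range_pos by (intro frac_kernel_L1_continuous) auto
  then show "((\<lambda>\<beta>. young_const * kernel_norm (?D \<beta>)) \<longlongrightarrow> 0) (at \<alpha> within {0<..})"
    by (rule tendsto_mult_right_zero)
qed auto

lemma Lp_bounded_operator_cong:
  assumes p: "1 \<le> p" and T: "Lp_bounded_operator p M T"
    and eq: "\<And>f t. t \<in> {a..b} \<Longrightarrow> S f t = T f t"
  shows "Lp_bounded_operator p M S"
proof -
  have ae: "AE t in M. S f t = T f t" for f by (rule AE_I2) (simp add: eq)
  have Tf: "T f \<in> Lp_space p M" if "f \<in> Lp_space p M" for f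
    using T that by (simp add: Lp_bounded_operator_def)
  have S: "S f \<in> Lp_space p M \<and> Lp_norm p M (S f) \<le> Lp_norm p M (T f)" if f: "f \<in> Lp_space p M" for f
  proof -
    have m: "S f \<in> borel_measurable M"
      using Lp_space_measurable[OF Tf[OF f]] by (subst measurable_cong[of M _ "T f"]) (auto simp: eq)
    show ?thesis
    proof -
      have "AE t in M. \<bar>S f t\<bar> \<le> 1 * \<bar>T f t\<bar>" using ae[of f] by eventually_elim simp
      from Lp_dominated[OF p Tf[OF f] m _ this] show ?thesis by simp
    qed
  qed
  obtain C where "\<forall>f\<in>Lp_space p M. Lp_norm p M (T f) \<le> C * Lp_norm p M f"
    using T unfolding Lp_bounded_operator_def by blast
  then have "\<forall>f\<in>Lp_space p M. Lp_norm p M (S f) \<le> C * Lp_norm p M f"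
    using S by (meson order_trans)
  moreover have "AE t in M. S f t = S g t" if "f \<in> Lp_space p M" "g \<in> Lp_space p M" "AE t in M. f t = g t" for f g
  proof -
    have "AE t in M. T f t = T g t" using T that by (auto simp: Lp_bounded_operator_def)
    with ae[of f] ae[of g] show ?thesis by eventually_elim simp
  qed
  moreover have "AE t in M. S (\<lambda>y. f y + g y) t = S f t + S g t" if "f \<in> Lp_space p M" "g \<in> Lp_space p M" for f g
  proof -
    have "AE t in M. T (\<lambda>y. f y + g y) t = T f t + T g t" using T that by (auto simp: Lp_bounded_operator_def)
    with ae[of f] ae[of g] ae[of "\<lambda>y. f y + g y"] show ?thesis by eventually_elim simp
  qed
  moreover have "AE t in M. S (\<lambda>y. c * f y) t = c * S f t" if "f \<in> Lp_space p M" for c f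
  proof -
    have "AE t in M. T (\<lambda>y. c * f y) t = c * T f t" using T that by (auto simp: Lp_bounded_operator_def)
    with ae[of f] ae[of "\<lambda>y. c * f y"] show ?thesis by eventually_elim simp
  qed
  ultimately show ?thesis using S unfolding Lp_bounded_operator_def by blast
qed

lemma RL_integral_family:
  assumes p: "1 \<le> p"
  shows "fractional_integral_family p a b h' (RL_integral h h' a)"
  unfolding fractional_integral_family_def
proof (intro conjI allI impI)
  fix \<alpha> :: real assume \<alpha>: "0 < \<alpha>"
  show "Lp_bounded_operator p M (RL_integral h h' a \<alpha>)"
    by (rule Lp_bounded_operator_cong[OF p conv_op_bounded_operator[OF p kernel_frac[OF \<alpha>]]])
      (rule RL_integral_eq_frac_int)
  show "((\<lambda>\<beta>. Lp_onorm p M (\<lambda>f t. RL_integral h h' a \<beta> f t - RL_integral h h' a \<alpha> f t)) \<longlongrightarrow> 0) (at \<alpha> within {0<..})"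
    by (rule frac_int_onorm_continuous[OF p \<alpha>])
  fix \<beta> :: real assume \<beta>: "0 < \<beta>"
  show "Lp_op_eq p M (RL_integral h h' a \<alpha> \<circ> RL_integral h h' a \<beta>) (RL_integral h h' a (\<alpha> + \<beta>))"
    unfolding Lp_op_eq_def
  proof
    fix f assume f: "f \<in> Lp_space p M"
    show "AE t in M. (RL_integral h h' a \<alpha> \<circ> RL_integral h h' a \<beta>) f t = RL_integral h h' a (\<alpha> + \<beta>) f t"
      using frac_int_frac_int[OF \<alpha> \<beta> Lp_imp_L1(1)[OF p f]] AE_space
    proof eventually_elim
      case (elim t)
      have "frac_int \<alpha> (RL_integral h h' a \<beta> f) t = frac_int \<alpha> (frac_int \<beta> f) t"
        unfolding conv_op_def[of "frac_kernel \<alpha>"]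
        by (intro Bochner_Integration.integral_cong) (auto simp: RL_integral_eq_frac_int)
      then show ?case using elim by (simp add: RL_integral_eq_frac_int)
    qed
  qed
next
  show "Lp_op_eq p M (RL_integral h h' a 1) (\<lambda>f t. LINT s:{a..t}|lebesgue. f s * h' s)"
    unfolding Lp_op_eq_def
  proof
    fix f assume f: "f \<in> Lp_space p M"
    have G: "integrable M (\<lambda>s. f s * h' s)" by (rule integrable_times_h'[OF Lp_imp_L1(1)[OF p f]])
    show "AE t in M. RL_integral h h' a 1 f t = (LINT s:{a..t}|lebesgue. f s * h' s)"
    proof (rule AE_I2)
      fix t assume "t \<in> space M"
      then have t: "t \<in> {a..b}" by simp
      have Gt: "integrable (lebesgue_on {a..t}) (\<lambda>s. f s * h' s)"
        using integrable_subinterval[of a b _ a t] G t by auto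
      have "RL_integral h h' a 1 f t = integral {a..t} (\<lambda>s. f s * h' s)"
        using t by (simp add: RL_integral_eq_frac_int V_eq_primitive primitive_eq_HK_integral[OF G])
      also have "\<dots> = (LINT s|lebesgue_on {a..t}. f s * h' s)"
        using lebesgue_integral_eq_integral[OF Gt] by simp
      also have "\<dots> = (LINT s:{a..t}|lebesgue. f s * h' s)"
        unfolding set_lebesgue_integral_def by (subst integral_restrict_space) auto
      finally show "RL_integral h h' a 1 f t = (LINT s:{a..t}|lebesgue. f s * h' s)" .
    qed
  qed
qed

end

section \<open>Exponential moments\<close>

text \<open>
  Mikusinski's moment argument. The functions \<open>1 - exp (- exp (n (w - c)))\<close> tend to the indicator
  of \<open>{w > c}\<close>; expanding the outer exponential expresses their integrals against \<open>G\<close> through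
  the exponential moments of \<open>G\<close>, and moments of size \<open>exp (\<epsilon> x)\<close> with \<open>\<epsilon> < c\<close> make
  the resulting series tend to \<open>0\<close>.
\<close>

lemma integral_superlevel_zero_if_moments_small:
  fixes G w :: "'a \<Rightarrow> real"
  assumes G: "integrable N G" and w[measurable]: "w \<in> borel_measurable N"
    and W: "\<And>s. s \<in> space N \<Longrightarrow> w s \<le> W"
    and \<epsilon>: "\<epsilon> < c" and bound: "\<And>x. x0 \<le> x \<Longrightarrow> \<bar>LINT s|N. exp (x * w s) * G s\<bar> \<le> C * exp (\<epsilon> * x)"
    and null: "AE s in N. w s \<noteq> c"
  shows "(LINT s|N. (if c < w s then G s else 0)) = 0"
proof -
  note [measurable] = borel_measurable_integrable[OF G]
  define y where "y n s = exp (real n * (w s - c))" for n s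
  have [measurable]: "y n \<in> borel_measurable N" for n unfolding y_def by measurable
  define F where "F n s = (1 - exp (- y n s)) * G s" for n s
  have lim1: "(\<lambda>n. LINT s|N. F n s) \<longlonglongrightarrow> (LINT s|N. (if c < w s then G s else 0))"
  proof (rule integral_dominated_convergence[where w = "\<lambda>s. \<bar>G s\<bar>"])
    show "AE s in N. (\<lambda>n. F n s) \<longlonglongrightarrow> (if c < w s then G s else 0)"
      using null
    proof eventually_elim
      case (elim s)
      show ?case
      proof (cases "c < w s")
        case True
        have "filterlim (\<lambda>n. real n * (w s - c)) at_top sequentially"
          using filterlim_tendsto_pos_mult_at_top[OF tendsto_const[of "w s - c"] _ filterlim_real_sequentially] True
          by (simp add: mult.commute)
        then have "filterlim (\<lambda>n. y n s) at_top sequentially"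
          unfolding y_def by (rule filterlim_compose[OF exp_at_top])
        then have "filterlim (\<lambda>n. - y n s) at_bot sequentially"
          by (simp add: filterlim_uminus_at_bot)
        then have "(\<lambda>n. exp (- y n s)) \<longlonglongrightarrow> 0"
          by (rule filterlim_compose[OF exp_at_bot])
        then have "(\<lambda>n. F n s) \<longlonglongrightarrow> (1 - 0) * G s"
          unfolding F_def by (intro tendsto_intros)
        then show ?thesis using True by simp
      next
        case False
        then have neg: "w s - c < 0" using elim by simp
        have "(\<lambda>n. y n s) \<longlonglongrightarrow> 0"
        proof -
          have "(\<lambda>n. exp (w s - c) ^ n) \<longlonglongrightarrow> 0"
            using neg by (intro LIMSEQ_power_zero) simp
          then show ?thesis by (simp add: y_def exp_of_nat_mult)
        qed
        then have "(\<lambda>n. F n s) \<longlonglongrightarrow> (1 - exp (- 0)) * G s"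
          unfolding F_def by (intro tendsto_intros)
        then show ?thesis using False by simp
      qed
    qed
    show "AE s in N. norm (F n s) \<le> \<bar>G s\<bar>" for n
    proof (rule AE_I2)
      fix s
      have "0 \<le> y n s" by (simp add: y_def)
      then have "\<bar>1 - exp (- y n s)\<bar> \<le> 1" by simp
      then show "norm (F n s) \<le> \<bar>G s\<bar>"
        using mult_right_mono[of "\<bar>1 - exp (- y n s)\<bar>" 1 "\<bar>G s\<bar>"] by (simp add: F_def abs_mult)
    qed
  qed (use G in \<open>auto simp: F_def\<close>)
  have series: "\<bar>LINT s|N. F n s\<bar> \<le> C * (exp (exp (- (real n * (c - \<epsilon>)))) - 1)" if n: "x0 \<le> real n" "0 < n" for n
  proof -
    define f where "f k s = - ((- y n s) ^ Suc k / fact (Suc k)) * G s" for k s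
    have [measurable]: "f k \<in> borel_measurable N" for k unfolding f_def by measurable
    have exp_series: "(\<lambda>k. z ^ Suc k / fact (Suc k)) sums (exp z - 1)" for z :: real
    proof -
      have "(\<lambda>k. z ^ k / fact k) sums exp z"
        using exp_converges[of z] by (simp add: scaleR_conv_of_real divide_inverse mult.commute)
      from sums_split_initial_segment[OF this, of 1] show ?thesis by simp
    qed
    have f_sums: "(\<lambda>k. f k s) sums F n s" for s
      using sums_mult2[OF sums_minus[OF exp_series[of "- y n s"]], of "G s"] by (simp add: f_def F_def)
    define Y where "Y = exp (real n * (W - c))"
    have yY: "y n s \<le> Y" if "s \<in> space N" for s
      using W[OF that] by (simp add: y_def Y_def mult_left_mono)
    have y0: "0 \<le> y n s" for s by (simp add: y_def)
    have normf: "norm (f k s) \<le> Y ^ Suc k / fact (Suc k) * \<bar>G s\<bar>" if "s \<in> space N" for k s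
    proof -
      have "norm (f k s) = y n s ^ Suc k / fact (Suc k) * \<bar>G s\<bar>"
        using y0[of s] by (simp add: f_def abs_mult power_abs)
      also have "\<dots> \<le> Y ^ Suc k / fact (Suc k) * \<bar>G s\<bar>"
        using yY[OF that] y0[of s] by (intro mult_right_mono divide_right_mono power_mono) auto
      finally show ?thesis .
    qed
    have intf: "integrable N (f k)" for k
      by (rule Bochner_Integration.integrable_bound[where f = "\<lambda>s. Y ^ Suc k / fact (Suc k) * \<bar>G s\<bar>"])
        (use G normf in \<open>auto simp: Y_def intro!: AE_I2 intro: order_trans[OF _ abs_ge_self]\<close>)
    have sumG: "summable (\<lambda>k. Y ^ Suc k / fact (Suc k) * z)" for z :: real
      using exp_series[of Y] by (intro summable_mult2) (auto simp: sums_iff)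
    have "(\<lambda>k. LINT s|N. f k s) sums (LINT s|N. (\<Sum>k. f k s))"
    proof (rule sums_integral[OF intf])
      show "AE s in N. summable (\<lambda>k. norm (f k s))"
        using normf by (intro AE_I2 summable_comparison_test'[OF sumG[of "\<bar>G _\<bar>"], of 0]) auto
      show "summable (\<lambda>k. LINT s|N. norm (f k s))"
      proof (rule summable_comparison_test'[OF sumG[of "LINT s|N. \<bar>G s\<bar>"], of 0])
        fix k
        have "(LINT s|N. norm (f k s)) \<le> (LINT s|N. Y ^ Suc k / fact (Suc k) * \<bar>G s\<bar>)"
          using intf G normf by (intro integral_mono) auto
        then show "norm (LINT s|N. norm (f k s)) \<le> Y ^ Suc k / fact (Suc k) * (LINT s|N. \<bar>G s\<bar>)"
          by simp
      qed
    qed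
    also have "(LINT s|N. (\<Sum>k. f k s)) = (LINT s|N. F n s)"
      using f_sums by (simp add: sums_iff)
    finally have sums: "(\<lambda>k. LINT s|N. f k s) sums (LINT s|N. F n s)" .
    define z where "z = exp (- (real n * (c - \<epsilon>)))"
    have le: "\<bar>LINT s|N. f k s\<bar> \<le> C * (z ^ Suc k / fact (Suc k))" for k
    proof -
      let ?m = "real (Suc k) * real n"
      have "f k s = ((-1) ^ k * exp (- (?m * c)) / fact (Suc k)) * (exp (?m * w s) * G s)" for s
      proof -
        have "y n s ^ Suc k = exp (real (Suc k) * (real n * (w s - c)))"
          unfolding y_def by (rule exp_of_nat_mult[symmetric])
        also have "\<dots> = exp (- (?m * c)) * exp (?m * w s)"
          by (simp add: exp_add[symmetric] algebra_simps)
        finally show ?thesis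
          unfolding f_def power_minus[of "y n s"] by (simp add: mult_ac)
      qed
      then have "(LINT s|N. f k s) = ((-1) ^ k * exp (- (?m * c)) / fact (Suc k)) * (LINT s|N. exp (?m * w s) * G s)"
        by simp
      then have "\<bar>LINT s|N. f k s\<bar> = exp (- (?m * c)) / fact (Suc k) * \<bar>LINT s|N. exp (?m * w s) * G s\<bar>"
        by (simp add: abs_mult power_abs)
      also have "\<dots> \<le> exp (- (?m * c)) / fact (Suc k) * (C * exp (\<epsilon> * ?m))"
      proof (intro mult_left_mono bound)
        have "real n \<le> ?m" by (simp add: mult_le_cancel_right1 distrib_right)
        then show "x0 \<le> ?m" using n by linarith
      qed auto
      also have "\<dots> = C * ((exp (- (?m * c)) * exp (\<epsilon> * ?m)) / fact (Suc k))" by simp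
      also have "exp (- (?m * c)) * exp (\<epsilon> * ?m) = z ^ Suc k"
        unfolding z_def exp_of_nat_mult[symmetric] by (simp add: exp_add[symmetric] algebra_simps)
      finally show ?thesis .
    qed
    have zs: "(\<lambda>k. C * (z ^ Suc k / fact (Suc k))) sums (C * (exp z - 1))"
      by (rule sums_mult[OF exp_series])
    have "(LINT s|N. F n s) \<le> C * (exp z - 1)"
      by (rule sums_le[OF _ sums zs]) (use le in \<open>auto simp: abs_le_iff\<close>)
    moreover have "- (LINT s|N. F n s) \<le> C * (exp z - 1)"
      by (rule sums_le[OF _ sums_minus[OF sums] zs]) (use le in \<open>auto simp: abs_le_iff\<close>)
    ultimately show ?thesis by (simp add: z_def abs_le_iff)
  qed
  have lim2: "(\<lambda>n. LINT s|N. F n s) \<longlonglongrightarrow> 0"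
  proof (rule Lim_null_comparison)
    show "\<forall>\<^sub>F n in sequentially. norm (LINT s|N. F n s) \<le> C * (exp (exp (- (real n * (c - \<epsilon>)))) - 1)"
      using eventually_ge_at_top[of "Suc (nat \<lceil>x0\<rceil>)"]
    proof eventually_elim
      case (elim n)
      then have "x0 \<le> real n" "0 < n" by linarith+
      from series[OF this] show ?case by simp
    qed
    have "(\<lambda>n. exp (- (c - \<epsilon>)) ^ n) \<longlonglongrightarrow> 0"
      using \<epsilon> by (intro LIMSEQ_power_zero) simp
    then have "(\<lambda>n. exp (- (real n * (c - \<epsilon>)))) \<longlonglongrightarrow> 0"
      by (simp add: exp_of_nat_mult[symmetric] right_diff_distrib)
    then have "(\<lambda>n. C * (exp (exp (- (real n * (c - \<epsilon>)))) - 1)) \<longlonglongrightarrow> C * (exp 0 - 1)"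
      by (intro tendsto_intros)
    then show "(\<lambda>n. C * (exp (exp (- (real n * (c - \<epsilon>)))) - 1)) \<longlonglongrightarrow> 0" by simp
  qed
  show ?thesis by (rule LIMSEQ_unique[OF lim1 lim2])
qed

section \<open>Operators commuting with integration\<close>

lemma Lp_bounded_operatorD:
  assumes "Lp_bounded_operator p N T" and f: "f \<in> Lp_space p N"
  shows "T f \<in> Lp_space p N"
    and "g \<in> Lp_space p N \<Longrightarrow> AE x in N. f x = g x \<Longrightarrow> AE x in N. T f x = T g x"
    and "g \<in> Lp_space p N \<Longrightarrow> AE x in N. T (\<lambda>y. f y + g y) x = T f x + T g x"
    and "AE x in N. T (\<lambda>y. c * f y) x = c * T f x"
  using assms unfolding Lp_bounded_operator_def by blast+

lemma Lp_bounded_operator_bound: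
  assumes "Lp_bounded_operator p N T"
  obtains C where "0 \<le> C" "\<And>f. f \<in> Lp_space p N \<Longrightarrow> Lp_norm p N (T f) \<le> C * Lp_norm p N f"
proof -
  obtain C where C: "\<And>f. f \<in> Lp_space p N \<Longrightarrow> Lp_norm p N (T f) \<le> C * Lp_norm p N f"
    using assms unfolding Lp_bounded_operator_def by blast
  have "Lp_norm p N (T f) \<le> max C 0 * Lp_norm p N f" if "f \<in> Lp_space p N" for f
    using C[OF that] mult_right_mono[of C "max C 0" "Lp_norm p N f"] Lp_norm_nonneg[of p N f] by simp
  then show ?thesis using that[of "max C 0"] by simp
qed

lemma Lp_bounded_operator_lincomb:
  assumes p: "1 \<le> p" and T: "Lp_bounded_operator p N T"
    and f: "f \<in> Lp_space p N" and g: "g \<in> Lp_space p N"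
  shows "AE x in N. T (\<lambda>y. c * f y + d * g y) x = c * T f x + d * T g x"
proof -
  note cf = Lp_scale(1)[OF p f, of c] and dg = Lp_scale(1)[OF p g, of d]
  show ?thesis
    using Lp_bounded_operatorD(3)[OF T cf dg] Lp_bounded_operatorD(4)[OF T f, of c]
      Lp_bounded_operatorD(4)[OF T g, of d]
    by eventually_elim simp
qed

lemma Lp_bounded_operator_compose:
  assumes p: "1 \<le> p" and S: "Lp_bounded_operator p N S" and T: "Lp_bounded_operator p N T"
  shows "Lp_bounded_operator p N (S \<circ> T)"
  unfolding Lp_bounded_operator_def o_apply
proof (intro conjI ballI allI impI)
  note Tp = Lp_bounded_operatorD(1)[OF T]
  fix f g assume f: "f \<in> Lp_space p N" and g: "g \<in> Lp_space p N"
  show "S (T f) \<in> Lp_space p N" using Lp_bounded_operatorD(1)[OF S Tp[OF f]] .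
  show "AE x in N. S (T f) x = S (T g) x" if "AE x in N. f x = g x"
    using Lp_bounded_operatorD(2)[OF S Tp[OF f] Tp[OF g] Lp_bounded_operatorD(2)[OF T f g that]] .
  show "AE x in N. S (T (\<lambda>y. f y + g y)) x = S (T f) x + S (T g) x"
    using Lp_bounded_operatorD(2)[OF S Tp[OF Lp_add(1)[OF p f g]] Lp_add(1)[OF p Tp[OF f] Tp[OF g]]
        Lp_bounded_operatorD(3)[OF T f g]]
      Lp_bounded_operatorD(3)[OF S Tp[OF f] Tp[OF g]]
    by eventually_elim simp
  show "AE x in N. S (T (\<lambda>y. c * f y)) x = c * S (T f) x" for c
    using Lp_bounded_operatorD(2)[OF S Tp[OF Lp_scale(1)[OF p f, of c]] Lp_scale(1)[OF p Tp[OF f], of c]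
        Lp_bounded_operatorD(4)[OF T f, of c]]
      Lp_bounded_operatorD(4)[OF S Tp[OF f], of c]
    by eventually_elim simp
next
  obtain C where C: "0 \<le> C" "\<And>f. f \<in> Lp_space p N \<Longrightarrow> Lp_norm p N (S f) \<le> C * Lp_norm p N f"
    by (rule Lp_bounded_operator_bound[OF S]) blast
  obtain D where D: "0 \<le> D" "\<And>f. f \<in> Lp_space p N \<Longrightarrow> Lp_norm p N (T f) \<le> D * Lp_norm p N f"
    by (rule Lp_bounded_operator_bound[OF T]) blast
  have "Lp_norm p N (S (T f)) \<le> C * D * Lp_norm p N f" if f: "f \<in> Lp_space p N" for f
    using C(2)[OF Lp_bounded_operatorD(1)[OF T f]] mult_left_mono[OF D(2)[OF f] C(1)] by simp
  then show "\<exists>C. \<forall>f\<in>Lp_space p N. Lp_norm p N (S (T f)) \<le> C * Lp_norm p N f" by blast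
qed

context increasing_C1 begin

lemma conv_op_integrable_bounded:
  assumes [measurable]: "\<kappa> \<in> borel_measurable borel" and B: "\<And>u. u \<le> h b - h a \<Longrightarrow> \<bar>\<kappa> u\<bar> \<le> B"
    and f: "integrable M f" and t: "t \<in> {a..b}"
  shows "integrable M (\<lambda>s. \<kappa> (h t - h s) * f s * h' s)"
proof (rule Bochner_Integration.integrable_bound)
  note [measurable] = borel_measurable_integrable[OF f]
  show "integrable M (\<lambda>s. B * (f s * h' s))"
    using integrable_times_h'[OF f] by simp
  show "AE s in M. norm (\<kappa> (h t - h s) * f s * h' s) \<le> norm (B * (f s * h' s))"
  proof (rule AE_I2)
    fix s assume "s \<in> space M"
    then have "h t - h s \<le> h b - h a" using t h_le_iff[of t b] h_le_iff[of a s] by auto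
    from B[OF this] have "\<bar>\<kappa> (h t - h s)\<bar> \<le> \<bar>B\<bar>" by simp
    then show "norm (\<kappa> (h t - h s) * f s * h' s) \<le> norm (B * (f s * h' s))"
      by (simp add: abs_mult mult.assoc mult_right_mono)
  qed
  show "(\<lambda>s. \<kappa> (h t - h s) * f s * h' s) \<in> borel_measurable M" by measurable
qed

lemma V_integrable:
  "integrable M f \<Longrightarrow> t \<in> {a..b} \<Longrightarrow> integrable M (\<lambda>s. frac_kernel 1 (h t - h s) * f s * h' s)"
  by (rule conv_op_integrable_bounded[where B = 1]) (auto simp: frac_kernel_1)

lemma exp_kernel_conv_integrable:
  assumes "integrable M f" "t \<in> {a..b}"
  shows "integrable M (\<lambda>s. exp_kernel x (h t - h s) * f s * h' s)"
proof (rule conv_op_integrable_bounded[where B = "exp (\<bar>x\<bar> * (h b - h a))"])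
  fix u assume u: "u \<le> h b - h a"
  show "\<bar>exp_kernel x u\<bar> \<le> exp (\<bar>x\<bar> * (h b - h a))"
  proof (cases "0 < u")
    case True
    then have "x * u \<le> \<bar>x\<bar> * (h b - h a)" using u by (intro mult_mono) auto
    then show ?thesis by (simp add: exp_kernel_def)
  qed (simp add: exp_kernel_def)
qed (use assms in auto)

lemma conv_op_lincomb:
  assumes "integrable M (\<lambda>s. \<kappa> (h t - h s) * f s * h' s)" "integrable M (\<lambda>s. \<kappa> (h t - h s) * g s * h' s)"
  shows "conv_op \<kappa> (\<lambda>s. c * f s + d * g s) t = c * conv_op \<kappa> f t + d * conv_op \<kappa> g t"
proof -
  have "conv_op \<kappa> (\<lambda>s. c * f s + d * g s) t =
      (LINT s|M. c * (\<kappa> (h t - h s) * f s * h' s) + d * (\<kappa> (h t - h s) * g s * h' s))"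
    unfolding conv_op_def by (intro Bochner_Integration.integral_cong) (auto simp: algebra_simps)
  also have "\<dots> = c * conv_op \<kappa> f t + d * conv_op \<kappa> g t"
    using assms unfolding conv_op_def by simp
  finally show ?thesis .
qed

lemma V_bound:
  assumes f: "integrable M f"
  shows "\<bar>V f t\<bar> \<le> h'_max * (LINT s|M. \<bar>f s\<bar>)"
proof -
  note [measurable] = borel_measurable_integrable[OF f]
  have "\<bar>V f t\<bar> \<le> (LINT s|M. \<bar>frac_kernel 1 (h t - h s) * f s * h' s\<bar>)"
    unfolding conv_op_def by (rule integral_abs_bound)
  also have "\<dots> \<le> (LINT s|M. h'_max * \<bar>f s\<bar>)"
  proof (rule integral_mono_AE')
    show "AE s in M. \<bar>frac_kernel 1 (h t - h s) * f s * h' s\<bar> \<le> h'_max * \<bar>f s\<bar>"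
    proof (rule AE_I2)
      fix s assume "s \<in> space M"
      then have s: "s \<in> {a..b}" by simp
      have "\<bar>f s\<bar> * h' s \<le> \<bar>f s\<bar> * h'_max" using h'_bounds(3)[OF s] by (intro mult_left_mono) auto
      moreover have "0 \<le> h'_max * \<bar>f s\<bar>" using h'_bounds(1,4) by (intro mult_nonneg_nonneg) auto
      ultimately show "\<bar>frac_kernel 1 (h t - h s) * f s * h' s\<bar> \<le> h'_max * \<bar>f s\<bar>"
        using h'_nonneg[OF s] by (simp add: frac_kernel_1 abs_mult mult.commute)
    qed
  qed (use f h'_bounds(1,4) in auto)
  finally show ?thesis by simp
qed

definition exp_fun :: "real \<Rightarrow> real \<Rightarrow> real" where
  "exp_fun x t = exp (x * (h t - h a))"

text \<open>The Laplace transform, taken in the variable \<open>u = h(s) - h(a)\<close>.\<close>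

definition laplace :: "(real \<Rightarrow> real) \<Rightarrow> real \<Rightarrow> real" where
  "laplace g x = (LINT s|M. exp (- (x * (h s - h a))) * g s * h' s)"

lemma exp_fun_measurable [measurable]: "exp_fun x \<in> borel_measurable M"
  unfolding exp_fun_def by measurable

lemma AE_not_point: "AE s in M. s \<noteq> c"
  using AE_completion[OF AE_lborel_singleton[of c]] by (auto simp: AE_restrict_space_iff)

lemma exp_fun_bounded: "t \<in> {a..b} \<Longrightarrow> \<bar>exp_fun x t\<bar> \<le> exp (\<bar>x\<bar> * (h b - h a))"
  unfolding exp_fun_def using h_le_iff[of a t] h_le_iff[of t b] ab
  by (auto intro!: mult_mono)

lemma exp_fun_Lp: "1 \<le> p \<Longrightarrow> exp_fun x \<in> Lp_space p M"
  using exp_fun_bounded by (intro Lp_bounded_function(1)[where B = "exp (\<bar>x\<bar> * (h b - h a))"]) auto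

lemma V_exp_fun:
  assumes x: "0 < x" and t: "t \<in> {a..b}"
  shows "V (exp_fun x) t = (exp_fun x t - 1) / x"
proof -
  have "AE s in M. exp_fun x s = exp_kernel x (h s - h a)"
    using AE_not_point[of a] AE_space
    by eventually_elim (use h_less_iff[of a] ab in \<open>auto simp: exp_fun_def exp_kernel_def\<close>)
  then have "V (exp_fun x) t = V (\<lambda>s. exp_kernel x (h s - h a)) t"
    by (intro conv_op_cong_AE kernel_frac) auto
  also have "\<dots> = (exp_kernel x (h t - h a) - frac_kernel 1 (h t - h a)) / x"
  proof (rule conv_op_shifted_kernel)
    show "0 \<le> (exp_kernel x u - frac_kernel 1 u) / x" for u
      using x by (simp add: exp_kernel_def frac_kernel_1)
    show "(\<integral>\<^sup>+v. ennreal (frac_kernel 1 (u - v) * exp_kernel x v) \<partial>lborel) =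
        ennreal ((exp_kernel x u - frac_kernel 1 u) / x)" for u
      using exp_kernel_conv[of x u] x by (subst nn_integral_conv_commute) auto
  qed (use t in \<open>auto intro!: kernel_frac kernel_exp frac_kernel_nonneg exp_kernel_nonneg\<close>)
  also have "\<dots> = (exp_fun x t - 1) / x"
    using t h_le_iff[of a t] ab by (auto simp: exp_kernel_def frac_kernel_1 exp_fun_def)
  finally show ?thesis .
qed

lemma exp_conv_V:
  assumes y: "integrable M y" and x: "0 < x" and t: "t \<in> {a..b}"
  shows "conv_op (exp_kernel x) (V y) t = (conv_op (exp_kernel x) y t - V y t) / x"
proof -
  let ?\<mu> = "\<lambda>u. (exp_kernel x u - frac_kernel 1 u) / x"
  have eq: "?\<mu> (h t - h s) * y s * h' s =
      (exp_kernel x (h t - h s) * y s * h' s - frac_kernel 1 (h t - h s) * y s * h' s) / x" for s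
    by (simp add: left_diff_distrib diff_divide_distrib)
  have "conv_op (exp_kernel x) (V y) t = conv_op ?\<mu> y t"
  proof (rule conv_op_conv_op)
    show "integrable M (\<lambda>r. ?\<mu> (h t - h r) * y r * h' r)"
      unfolding eq using exp_kernel_conv_integrable[OF y t] V_integrable[OF y t] by simp
    show "(\<integral>\<^sup>+v. ennreal (exp_kernel x (u - v) * frac_kernel 1 v) \<partial>lborel) = ennreal (?\<mu> u)" for u
      using x by (intro exp_kernel_conv) auto
  qed (use t x y in \<open>auto intro!: kernel_frac kernel_exp frac_kernel_nonneg exp_kernel_nonneg
        simp: exp_kernel_def frac_kernel_1\<close>)
  also have "\<dots> = (conv_op (exp_kernel x) y t - V y t) / x"
    unfolding conv_op_def eq using exp_kernel_conv_integrable[OF y t] V_integrable[OF y t] by simp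
  finally show ?thesis .
qed

subsection \<open>The Laplace transform of an operator\<close>

definition commutes_with_V :: "ennreal \<Rightarrow> ((real \<Rightarrow> real) \<Rightarrow> real \<Rightarrow> real) \<Rightarrow> bool" where
  "commutes_with_V p R \<longleftrightarrow> Lp_bounded_operator p M R \<and>
     (\<forall>f\<in>Lp_space p M. AE t in M. R (V f) t = V (R f) t)"

lemma V_Lp: "1 \<le> p \<Longrightarrow> f \<in> Lp_space p M \<Longrightarrow> V f \<in> Lp_space p M"
  by (rule conv_op_Lp(1)) (auto intro: kernel_frac)

lemma V_cong_AE:
  "f \<in> borel_measurable M \<Longrightarrow> g \<in> borel_measurable M \<Longrightarrow> AE s in M. f s = g s \<Longrightarrow> V f t = V g t"
  by (rule conv_op_cong_AE[OF kernel_frac]) auto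

lemma commutes_with_V_compose:
  assumes p: "1 \<le> p" and S: "commutes_with_V p S" and T: "commutes_with_V p T"
  shows "commutes_with_V p (S \<circ> T)"
  unfolding commutes_with_V_def
proof (intro conjI ballI)
  have bS: "Lp_bounded_operator p M S" and bT: "Lp_bounded_operator p M T"
    using S T by (auto simp: commutes_with_V_def)
  show "Lp_bounded_operator p M (S \<circ> T)" by (rule Lp_bounded_operator_compose[OF p bS bT])
  fix f assume f: "f \<in> Lp_space p M"
  note Tf = Lp_bounded_operatorD(1)[OF bT f]
  have "AE t in M. T (V f) t = V (T f) t" using T f by (auto simp: commutes_with_V_def)
  then have "AE t in M. S (T (V f)) t = S (V (T f)) t"
    by (intro Lp_bounded_operatorD(2)[OF bS] Lp_bounded_operatorD(1)[OF bT] V_Lp p f Tf)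
  moreover have "AE t in M. S (V (T f)) t = V (S (T f)) t"
    using S Tf by (auto simp: commutes_with_V_def)
  ultimately show "AE t in M. (S \<circ> T) (V f) t = V ((S \<circ> T) f) t"
    by eventually_elim simp
qed

lemma Lp_bounded_operator_L1_bound:
  assumes p: "1 \<le> p" and R: "Lp_bounded_operator p M R"
  obtains C where "0 \<le> C" "\<And>f B. f \<in> borel_measurable M \<Longrightarrow> 0 \<le> B \<Longrightarrow>
    (\<And>t. t \<in> {a..b} \<Longrightarrow> \<bar>f t\<bar> \<le> B) \<Longrightarrow> (LINT t|M. \<bar>R f t\<bar>) \<le> C * B"
proof -
  obtain D where D: "0 \<le> D" "\<And>f. f \<in> Lp_space p M \<Longrightarrow> Lp_norm p M (R f) \<le> D * Lp_norm p M f"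
    by (rule Lp_bounded_operator_bound[OF R]) blast
  let ?m = "1 + measure M (space M)"
  have m: "0 \<le> ?m" by simp
  show ?thesis
  proof (rule that[of "?m * (D * ?m)"])
    fix f B assume f: "f \<in> borel_measurable M" and B: "0 \<le> B" "\<And>t. t \<in> {a..b} \<Longrightarrow> \<bar>f t\<bar> \<le> (B::real)"
    have ae: "AE t in M. \<bar>f t\<bar> \<le> B" using B(2) by (intro AE_I2) auto
    note fp = Lp_bounded_function(1)[OF p f B(1) ae] and fn = Lp_bounded_function(2)[OF p f B(1) ae]
    have "(LINT t|M. \<bar>R f t\<bar>) \<le> ?m * Lp_norm p M (R f)"
      by (rule Lp_imp_L1(2)[OF p Lp_bounded_operatorD(1)[OF R fp]])
    also have "\<dots> \<le> ?m * (D * (?m * B))"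
      using D fn m by (intro mult_left_mono order_trans[OF D(2)[OF fp]]) auto
    finally show "(LINT t|M. \<bar>R f t\<bar>) \<le> ?m * (D * ?m) * B" by (simp add: mult_ac)
  qed (use D m in auto)
qed

text \<open>
  The exponential \<open>y = R e\<close> solves \<open>y = R 1 + x V y\<close>, because \<open>e = 1 + x V e\<close>. So its
  primitive is the convolution of \<open>R 1\<close> with an exponential, by variation of constants.
\<close>

lemma V_apply_exp_fun:
  assumes p: "1 \<le> p" and R: "commutes_with_V p R" and x: "0 < x" and t: "t \<in> {a..b}"
  shows "V (R (exp_fun x)) t = conv_op (exp_kernel x) (R (\<lambda>_. 1)) t"
proof -
  have bR: "Lp_bounded_operator p M R" using R by (simp add: commutes_with_V_def)
  note e = exp_fun_Lp[OF p, of x] and one = Lp_const_1(1)[OF p]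
  let ?y = "R (exp_fun x)"
  note yp = Lp_bounded_operatorD(1)[OF bR e] and rp = Lp_bounded_operatorD(1)[OF bR one]
  have y: "integrable M ?y" and r: "integrable M (R (\<lambda>_. 1))"
    by (rule Lp_imp_L1(1)[OF p yp], rule Lp_imp_L1(1)[OF p rp])
  have Vy: "integrable M (V ?y)" by (rule Lp_imp_L1(1)[OF p V_Lp[OF p yp]])
  have lin: "(\<lambda>s. 1 * 1 + x * V (exp_fun x) s) \<in> Lp_space p M"
    using Lp_add(1)[OF p one Lp_scale(1)[OF p V_Lp[OF p e], of x]] by simp
  have "AE s in M. exp_fun x s = 1 * 1 + x * V (exp_fun x) s"
    using x by (intro AE_I2) (simp add: V_exp_fun)
  then have "AE s in M. ?y s = R (\<lambda>s. 1 * 1 + x * V (exp_fun x) s) s"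
    by (rule Lp_bounded_operatorD(2)[OF bR e lin])
  moreover have "AE s in M. R (\<lambda>s. 1 * 1 + x * V (exp_fun x) s) s = 1 * R (\<lambda>_. 1) s + x * R (V (exp_fun x)) s"
    by (rule Lp_bounded_operator_lincomb[OF p bR one V_Lp[OF p e]])
  moreover have "AE s in M. R (V (exp_fun x)) s = V ?y s"
    using R e by (auto simp: commutes_with_V_def)
  ultimately have "AE s in M. R (\<lambda>_. 1) s = 1 * ?y s + (- x) * V ?y s"
    by eventually_elim simp
  then have "conv_op (exp_kernel x) (R (\<lambda>_. 1)) t = conv_op (exp_kernel x) (\<lambda>s. 1 * ?y s + (- x) * V ?y s) t"
    using y r Vy by (intro conv_op_cong_AE kernel_exp) auto
  also have "\<dots> = 1 * conv_op (exp_kernel x) ?y t + (- x) * conv_op (exp_kernel x) (V ?y) t"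
    using y Vy t by (intro conv_op_lincomb exp_kernel_conv_integrable)
  also have "\<dots> = V ?y t" using x by (simp add: exp_conv_V[OF y x t])
  finally show ?thesis by simp
qed

lemma exp_weight_integrable:
  assumes "integrable M f"
  shows "integrable M (\<lambda>s. exp (x * (c - h s)) * f s * h' s)"
proof (rule Bochner_Integration.integrable_bound)
  note [measurable] = borel_measurable_integrable[OF assms]
  let ?B = "exp (\<bar>x\<bar> * (\<bar>c\<bar> + \<bar>h a\<bar> + \<bar>h b\<bar>))"
  show "integrable M (\<lambda>s. ?B * (f s * h' s))"
    using integrable_times_h'[OF assms] by simp
  show "AE s in M. norm (exp (x * (c - h s)) * f s * h' s) \<le> norm (?B * (f s * h' s))"
  proof (rule AE_I2)
    fix s assume "s \<in> space M"
    then have "\<bar>c - h s\<bar> \<le> \<bar>c\<bar> + \<bar>h a\<bar> + \<bar>h b\<bar>"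
      using h_le_iff[of a s] h_le_iff[of s b] ab by auto
    then have "\<bar>x * (c - h s)\<bar> \<le> \<bar>x\<bar> * (\<bar>c\<bar> + \<bar>h a\<bar> + \<bar>h b\<bar>)"
      by (simp add: abs_mult mult_left_mono)
    then have "exp (x * (c - h s)) \<le> ?B" by simp
    then show "norm (exp (x * (c - h s)) * f s * h' s) \<le> norm (?B * (f s * h' s))"
      by (simp add: abs_mult mult.assoc mult_right_mono)
  qed
  show "(\<lambda>s. exp (x * (c - h s)) * f s * h' s) \<in> borel_measurable M" by measurable
qed

lemma laplace_times_exp_fun:
  "laplace g x * exp_fun x t = (LINT s|M. exp (x * (h t - h s)) * g s * h' s)"
proof -
  have "laplace g x * exp_fun x t = (LINT s|M. exp_fun x t * (exp (- (x * (h s - h a))) * g s * h' s))"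
    unfolding laplace_def by simp
  also have "\<dots> = (LINT s|M. exp (x * (h t - h s)) * g s * h' s)"
  proof (intro Bochner_Integration.integral_cong refl)
    fix s
    have "exp_fun x t * exp (- (x * (h s - h a))) = exp (x * (h t - h s))"
      by (simp add: exp_fun_def exp_add[symmetric] algebra_simps)
    then show "exp_fun x t * (exp (- (x * (h s - h a))) * g s * h' s) = exp (x * (h t - h s)) * g s * h' s"
      by (simp add: mult.assoc[symmetric])
  qed
  finally show ?thesis .
qed

lemma exp_conv_right_end:
  assumes "integrable M g"
  shows "conv_op (exp_kernel x) g b = laplace g x * exp_fun x b"
  unfolding laplace_times_exp_fun conv_op_def
proof (rule integral_cong_AE)
  note [measurable] = borel_measurable_integrable[OF assms]
  show "AE s in M. exp_kernel x (h b - h s) * g s * h' s = exp (x * (h b - h s)) * g s * h' s"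
    using AE_not_point[of b] AE_space
    by eventually_elim (use h_less_iff[of _ b] ab in \<open>auto simp: exp_kernel_def\<close>)
  show "(\<lambda>s. exp_kernel x (h b - h s) * g s * h' s) \<in> borel_measurable M"
    "(\<lambda>s. exp (x * (h b - h s)) * g s * h' s) \<in> borel_measurable M" by measurable
qed

lemma exp_conv_remainder:
  assumes g: "integrable M g" and x: "0 < x" and t: "t \<in> {a..b}"
  shows "\<bar>laplace g x * exp_fun x t - conv_op (exp_kernel x) g t\<bar> \<le> (LINT s|M. \<bar>g s * h' s\<bar>)"
proof -
  have i1: "integrable M (\<lambda>s. exp (x * (h t - h s)) * g s * h' s)"
    by (rule exp_weight_integrable[OF g])
  note i2 = exp_kernel_conv_integrable[OF g t]
  let ?d = "\<lambda>s. exp (x * (h t - h s)) * g s * h' s - exp_kernel x (h t - h s) * g s * h' s"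
  have eq: "laplace g x * exp_fun x t - conv_op (exp_kernel x) g t = (LINT s|M. ?d s)"
    unfolding laplace_times_exp_fun conv_op_def using i1 i2 by simp
  have "\<bar>laplace g x * exp_fun x t - conv_op (exp_kernel x) g t\<bar> \<le> (LINT s|M. \<bar>?d s\<bar>)"
    unfolding eq by (rule integral_abs_bound)
  also have "\<dots> \<le> (LINT s|M. \<bar>g s * h' s\<bar>)"
  proof (rule integral_mono_AE)
    show "integrable M (\<lambda>s. \<bar>?d s\<bar>)" by (intro integrable_abs Bochner_Integration.integrable_diff i1 i2)
    show "integrable M (\<lambda>s. \<bar>g s * h' s\<bar>)" by (rule integrable_abs[OF integrable_times_h'[OF g]])
    show "AE s in M. \<bar>?d s\<bar> \<le> \<bar>g s * h' s\<bar>"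
    proof (rule AE_I2)
      fix s
      show "\<bar>?d s\<bar> \<le> \<bar>g s * h' s\<bar>"
      proof (cases "0 < h t - h s")
        case False
        then have "exp (x * (h t - h s)) \<le> 1"
          using x by (simp add: mult_nonneg_nonpos)
        then have "exp (x * (h t - h s)) * \<bar>g s * h' s\<bar> \<le> 1 * \<bar>g s * h' s\<bar>"
          by (intro mult_right_mono) auto
        then show ?thesis using False by (simp add: exp_kernel_def abs_mult mult.assoc)
      qed (simp add: exp_kernel_def)
    qed
  qed
  finally show ?thesis .
qed

text \<open>
  The number \<open>x * laplace (R 1) x\<close> is almost multiplicative in \<open>R\<close>. Indeed
  \<open>V (T e) = laplace (T 1) x * e - \<rho>\<close> where the remainder is bounded independently of
  \<open>x\<close>, so \<open>e\<close> is an eigenvector of \<open>V T\<close> up to an error which is exponentially small relative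
  to \<open>e\<close> at the right end point.
\<close>

lemma laplace_multiplicative:
  assumes p: "1 \<le> p" and S: "commutes_with_V p S" and T: "commutes_with_V p T"
  obtains C where "0 \<le> C"
    "\<And>x. 1 \<le> x \<Longrightarrow> \<bar>laplace (S (\<lambda>_. 1)) x * laplace (T (\<lambda>_. 1)) x - laplace (S (T (\<lambda>_. 1))) x / x\<bar>
       \<le> C * exp (- (x * (h b - h a)))"
proof -
  have bS: "Lp_bounded_operator p M S" and bT: "Lp_bounded_operator p M T"
    using S T by (auto simp: commutes_with_V_def)
  note one = Lp_const_1(1)[OF p]
  let ?\<sigma> = "S (\<lambda>_. 1)" and ?\<tau> = "T (\<lambda>_. 1)" and ?\<omega> = "S (T (\<lambda>_. 1))"
  have ST: "commutes_with_V p (S \<circ> T)" by (rule commutes_with_V_compose[OF p S T])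
  note \<tau>p = Lp_bounded_operatorD(1)[OF bT one]
  have \<tau>: "integrable M ?\<tau>" by (rule Lp_imp_L1(1)[OF p \<tau>p])
  have \<sigma>: "integrable M ?\<sigma>" by (rule Lp_imp_L1(1)[OF p Lp_bounded_operatorD(1)[OF bS one]])
  have \<omega>: "integrable M ?\<omega>" by (rule Lp_imp_L1(1)[OF p Lp_bounded_operatorD(1)[OF bS \<tau>p]])
  define B where "B = (LINT s|M. \<bar>?\<tau> s * h' s\<bar>)"
  have B: "0 \<le> B" unfolding B_def by (intro Bochner_Integration.integral_nonneg) auto
  obtain D where D: "0 \<le> D" "\<And>f B. f \<in> borel_measurable M \<Longrightarrow> 0 \<le> B \<Longrightarrow>
    (\<And>t. t \<in> {a..b} \<Longrightarrow> \<bar>f t\<bar> \<le> B) \<Longrightarrow> (LINT t|M. \<bar>S f t\<bar>) \<le> D * B"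
    by (rule Lp_bounded_operator_L1_bound[OF p bS]) blast
  have bmem: "b \<in> {a..b}" using ab by simp
  define K where "K = h'_max * (D * B) + \<bar>V ?\<omega> b\<bar>"
  have hm: "0 \<le> h'_max" using h'_bounds(1,4) by simp
  show ?thesis
  proof (rule that[of K])
    show "0 \<le> K" unfolding K_def using hm D(1) B by (intro add_nonneg_nonneg mult_nonneg_nonneg) auto
    fix x :: real assume x1: "1 \<le> x"
    then have x: "0 < x" by simp
    note ep = exp_fun_Lp[OF p, of x]
    let ?e = "exp_fun x"
    note Tep = Lp_bounded_operatorD(1)[OF bT ep] and Sep = Lp_bounded_operatorD(1)[OF bS ep]
    note VTep = V_Lp[OF p Tep]
    define \<phi> where "\<phi> = laplace ?\<tau> x"
    define \<rho> where "\<rho> t = \<phi> * ?e t + (-1) * V (T ?e) t" for t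
    have \<rho>p: "\<rho> \<in> Lp_space p M"
      using Lp_add(1)[OF p Lp_scale(1)[OF p ep, of \<phi>] Lp_scale(1)[OF p VTep, of "-1"]]
      unfolding \<rho>_def .
    note S\<rho>p = Lp_bounded_operatorD(1)[OF bS \<rho>p]
    have \<rho>_le: "\<bar>\<rho> t\<bar> \<le> B" if t: "t \<in> {a..b}" for t
      using exp_conv_remainder[OF \<tau> x t] V_apply_exp_fun[OF p T x t]
      by (simp add: \<rho>_def \<phi>_def B_def)
    have S\<rho>: "(LINT t|M. \<bar>S \<rho> t\<bar>) \<le> D * B"
      using \<rho>_le by (intro D(2) B Lp_space_measurable[OF \<rho>p])
    have iS\<rho>: "integrable M (S \<rho>)" and iSe: "integrable M (S ?e)"
      by (rule Lp_imp_L1(1)[OF p S\<rho>p], rule Lp_imp_L1(1)[OF p Sep])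
    have "AE t in M. V (T ?e) t = \<phi> * ?e t + (-1) * \<rho> t"
      by (intro AE_I2) (simp add: \<rho>_def)
    then have "AE t in M. S (V (T ?e)) t = S (\<lambda>t. \<phi> * ?e t + (-1) * \<rho> t) t"
      using Lp_add(1)[OF p Lp_scale(1)[OF p ep, of \<phi>] Lp_scale(1)[OF p \<rho>p, of "-1"]]
      by (intro Lp_bounded_operatorD(2)[OF bS VTep])
    with Lp_bounded_operator_lincomb[OF p bS ep \<rho>p, of \<phi> "-1"]
    have e1: "AE t in M. S (V (T ?e)) t = \<phi> * S ?e t + (-1) * S \<rho> t"
      by eventually_elim simp
    have mSVT: "S (V (T ?e)) \<in> borel_measurable M"
      by (rule Lp_space_measurable[OF Lp_bounded_operatorD(1)[OF bS VTep]])
    have "V (S (V (T ?e))) b = V (\<lambda>t. \<phi> * S ?e t + (-1) * S \<rho> t) b"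
      using iSe iS\<rho> by (intro V_cong_AE e1 mSVT) auto
    also have "\<dots> = \<phi> * V (S ?e) b + (-1) * V (S \<rho>) b"
      by (intro conv_op_lincomb V_integrable iSe iS\<rho> bmem)
    also have "V (S ?e) b = laplace ?\<sigma> x * ?e b"
      using V_apply_exp_fun[OF p S x bmem] exp_conv_right_end[OF \<sigma>] by simp
    finally have left: "V (S (V (T ?e))) b = \<phi> * (laplace ?\<sigma> x * ?e b) - V (S \<rho>) b" by simp

    note Vep = V_Lp[OF p ep]
    have "AE t in M. T (V ?e) t = V (T ?e) t" using T ep by (auto simp: commutes_with_V_def)
    then have e2: "AE t in M. S (T (V ?e)) t = S (V (T ?e)) t"
      by (intro Lp_bounded_operatorD(2)[OF bS Lp_bounded_operatorD(1)[OF bT Vep] VTep])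
    have bST: "Lp_bounded_operator p M (S \<circ> T)" using ST by (simp add: commutes_with_V_def)
    have "AE t in M. V ?e t = (1/x) * ?e t + (-1/x) * 1"
      using x by (intro AE_I2) (simp add: V_exp_fun diff_divide_distrib)
    then have "AE t in M. (S \<circ> T) (V ?e) t = (S \<circ> T) (\<lambda>t. (1/x) * ?e t + (-1/x) * 1) t"
      using Lp_add(1)[OF p Lp_scale(1)[OF p ep, of "1/x"] Lp_scale(1)[OF p one, of "-1/x"]]
      by (intro Lp_bounded_operatorD(2)[OF bST Vep])
    with Lp_bounded_operator_lincomb[OF p bST ep one, of "1/x" "-1/x"] e2
    have e3: "AE t in M. S (V (T ?e)) t = (1/x) * S (T ?e) t + (-1/x) * ?\<omega> t"
      by eventually_elim simp
    have iSTe: "integrable M (S (T ?e))"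
      by (rule Lp_imp_L1(1)[OF p Lp_bounded_operatorD(1)[OF bS Tep]])
    have "V (S (V (T ?e))) b = V (\<lambda>t. (1/x) * S (T ?e) t + (-1/x) * ?\<omega> t) b"
      using iSTe \<omega> by (intro V_cong_AE e3 mSVT) auto
    also have "\<dots> = (1/x) * V (S (T ?e)) b + (-1/x) * V ?\<omega> b"
      by (intro conv_op_lincomb V_integrable iSTe \<omega> bmem)
    also have "V (S (T ?e)) b = laplace ?\<omega> x * ?e b"
      using V_apply_exp_fun[OF p ST x bmem] exp_conv_right_end[OF \<omega>] by simp
    finally have right: "V (S (V (T ?e))) b = (laplace ?\<omega> x * ?e b - V ?\<omega> b) / x"
      by (simp add: diff_divide_distrib)

    have "(laplace ?\<sigma> x * \<phi> - laplace ?\<omega> x / x) * ?e b = V (S \<rho>) b - V ?\<omega> b / x"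
      using left right by (simp add: algebra_simps diff_divide_distrib)
    then have "\<bar>laplace ?\<sigma> x * \<phi> - laplace ?\<omega> x / x\<bar> * ?e b = \<bar>V (S \<rho>) b - V ?\<omega> b / x\<bar>"
      by (metis abs_mult abs_of_pos exp_fun_def exp_gt_zero)
    also have "\<dots> \<le> \<bar>V (S \<rho>) b\<bar> + \<bar>V ?\<omega> b\<bar> / x"
      using x abs_triangle_ineq4[of "V (S \<rho>) b" "V ?\<omega> b / x"] by simp
    also have "\<dots> \<le> K"
    proof -
      have "\<bar>V (S \<rho>) b\<bar> \<le> h'_max * (D * B)"
        using V_bound[OF iS\<rho>, of b] mult_left_mono[OF S\<rho> hm] by linarith
      moreover have "\<bar>V ?\<omega> b\<bar> / x \<le> \<bar>V ?\<omega> b\<bar>"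
        using x1 by (simp add: divide_le_eq mult_le_cancel_left1)
      ultimately show ?thesis by (simp add: K_def)
    qed
    finally have "\<bar>laplace ?\<sigma> x * \<phi> - laplace ?\<omega> x / x\<bar> * ?e b * exp (- (x * (h b - h a))) \<le> K * exp (- (x * (h b - h a)))"
      by (intro mult_right_mono) auto
    then show "\<bar>laplace ?\<sigma> x * laplace ?\<tau> x - laplace ?\<omega> x / x\<bar> \<le> K * exp (- (x * (h b - h a)))"
      by (simp add: \<phi>_def exp_fun_def mult.assoc exp_add[symmetric])
  qed
qed

end

context increasing_C1 begin

lemma laplace_cong_AE:
  assumes "f \<in> borel_measurable M" "g \<in> borel_measurable M" "AE s in M. f s = g s"
  shows "laplace f x = laplace g x"
  unfolding laplace_def using assms
  by (intro integral_cong_AE) (auto elim!: eventually_mono)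

lemma laplace_integrable:
  assumes "integrable M g"
  shows "integrable M (\<lambda>s. exp (- (x * (h s - h a))) * g s * h' s)"
proof -
  have "(\<lambda>s. exp (- (x * (h s - h a))) * g s * h' s) = (\<lambda>s. exp (x * (h a - h s)) * g s * h' s)"
    by (simp add: algebra_simps)
  then show ?thesis using exp_weight_integrable[OF assms, of x "h a"] by simp
qed

text \<open>
  The fractional integral of \<open>1\<close> is positive right from the left end point on, so its Laplace
  transform decays more slowly than any exponential.
\<close>

lemma laplace_frac_int_lower:
  fixes p :: ennreal
  assumes p: "1 \<le> p" and \<beta>: "0 < \<beta>" and x: "0 \<le> x" and t: "t \<in> {a..b}"
  shows "frac_kernel (1 + (\<beta> + 1)) (h t - h a) * exp (- (x * (h t - h a))) \<le> laplace (frac_int \<beta> (\<lambda>_. 1)) x"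
proof -
  let ?k = "\<lambda>s. frac_kernel (\<beta> + 1) (h s - h a)"
  have B1: "integrable M (frac_int \<beta> (\<lambda>_. 1))"
    using Lp_imp_L1(1)[OF p conv_op_Lp(1)[OF p kernel_frac[OF \<beta>] Lp_const_1(1)[OF p]]] .
  have ik: "integrable M ?k"
    using B1 by (rule Bochner_Integration.integrable_cong[THEN iffD1, rotated 2])
      (auto simp: frac_int_1[OF \<beta>])
  have "frac_kernel (1 + (\<beta> + 1)) (h t - h a) * exp (- (x * (h t - h a))) = V ?k t * exp (- (x * (h t - h a)))"
    using frac_int_power[of 1 "\<beta> + 1" t] \<beta> t by simp
  also have "\<dots> = (LINT s|M. exp (- (x * (h t - h a))) * (frac_kernel 1 (h t - h s) * ?k s * h' s))"
    unfolding conv_op_def by simp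
  also have "\<dots> \<le> (LINT s|M. exp (- (x * (h s - h a))) * frac_int \<beta> (\<lambda>_. 1) s * h' s)"
  proof (rule integral_mono)
    show "integrable M (\<lambda>s. exp (- (x * (h t - h a))) * (frac_kernel 1 (h t - h s) * ?k s * h' s))"
      using V_integrable[OF ik t] by simp
    show "integrable M (\<lambda>s. exp (- (x * (h s - h a))) * frac_int \<beta> (\<lambda>_. 1) s * h' s)"
      by (rule laplace_integrable[OF B1])
    fix s assume "s \<in> space M"
    then have s: "s \<in> {a..b}" by simp
    have k0: "0 \<le> ?k s * h' s"
      using \<beta> h'_nonneg[OF s] by (intro mult_nonneg_nonneg frac_kernel_nonneg) auto
    have "exp (- (x * (h t - h a))) * frac_kernel 1 (h t - h s) \<le> exp (- (x * (h s - h a)))"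
    proof (cases "0 < h t - h s")
      case True
      then have "x * (h s - h a) \<le> x * (h t - h a)" using x by (intro mult_left_mono) auto
      then show ?thesis using True by (simp add: frac_kernel_1)
    qed (simp add: frac_kernel_1)
    from mult_right_mono[OF this k0]
    show "exp (- (x * (h t - h a))) * (frac_kernel 1 (h t - h s) * ?k s * h' s)
        \<le> exp (- (x * (h s - h a))) * frac_int \<beta> (\<lambda>_. 1) s * h' s"
      by (simp add: frac_int_1[OF \<beta> s] mult.assoc)
  qed
  finally show ?thesis by (simp add: laplace_def)
qed

lemma frac_int_commutes_with_V:
  assumes p: "1 \<le> p" and \<beta>: "0 < \<beta>"
  shows "commutes_with_V p (frac_int \<beta>)"
  unfolding commutes_with_V_def
proof (intro conjI ballI)
  show "Lp_bounded_operator p M (frac_int \<beta>)"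
    by (rule conv_op_bounded_operator[OF p kernel_frac[OF \<beta>]])
  fix f assume "f \<in> Lp_space p M"
  then have f: "integrable M f" by (rule Lp_imp_L1(1)[OF p])
  have "AE t in M. frac_int \<beta> (V f) t = frac_int (\<beta> + 1) f t"
    using \<beta> f by (intro frac_int_frac_int) auto
  moreover have "AE t in M. V (frac_int \<beta> f) t = frac_int (1 + \<beta>) f t"
    using \<beta> f by (intro frac_int_frac_int) auto
  ultimately show "AE t in M. frac_int \<beta> (V f) t = V (frac_int \<beta> f) t"
    by eventually_elim (simp add: add.commute)
qed

subsection \<open>Uniqueness of the square root\<close>

text \<open>
  An operator \<open>A\<close> and the fractional integral \<open>B\<close> with the same square have almost the same
  squared Laplace transforms. The sign is settled because \<open>A\<close> is itself a square:
  its transform is nonnegative up to an exponentially small error. Hence the sum of the two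
  transforms is at least of the size of the transform of \<open>B\<close>, and their difference is of order
  \<open>exp (- x (h(b) - h(a) - \<delta>))\<close> for every \<open>\<delta> > 0\<close>; for the difference of \<open>A 1\<close> and \<open>B 1\<close> this
  is the hypothesis of the moment lemma.
\<close>

lemma square_root_apply_one:
  assumes p: "1 \<le> p" and \<beta>: "0 < \<beta>" and A: "commutes_with_V p A" and C: "commutes_with_V p C"
    and CC: "\<And>f. f \<in> Lp_space p M \<Longrightarrow> AE t in M. C (C f) t = A f t"
    and AA: "\<And>f. f \<in> Lp_space p M \<Longrightarrow> AE t in M. A (A f) t = frac_int \<beta> (frac_int \<beta> f) t"
  shows "AE t in M. A (\<lambda>_. 1) t = frac_int \<beta> (\<lambda>_. 1) t"
proof -
  let ?B = "frac_int \<beta>" and ?L = "h b - h a"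
  have B: "commutes_with_V p ?B" by (rule frac_int_commutes_with_V[OF p \<beta>])
  have bA: "Lp_bounded_operator p M A" and bB: "Lp_bounded_operator p M ?B" and bC: "Lp_bounded_operator p M C"
    using A B C by (auto simp: commutes_with_V_def)
  note one = Lp_const_1(1)[OF p]
  note A1 = Lp_bounded_operatorD(1)[OF bA one] and B1 = Lp_bounded_operatorD(1)[OF bB one]
    and C1 = Lp_bounded_operatorD(1)[OF bC one]
  note meas = Lp_space_measurable[OF Lp_bounded_operatorD(1)[OF bA A1]]
    Lp_space_measurable[OF Lp_bounded_operatorD(1)[OF bB B1]]
    Lp_space_measurable[OF Lp_bounded_operatorD(1)[OF bC C1]] Lp_space_measurable[OF A1]
  have iA: "integrable M (A (\<lambda>_. 1))" and iB: "integrable M (?B (\<lambda>_. 1))"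
    by (rule Lp_imp_L1(1)[OF p A1], rule Lp_imp_L1(1)[OF p B1])
  define \<phi>A where "\<phi>A = laplace (A (\<lambda>_. 1))"
  define \<phi>B where "\<phi>B = laplace (?B (\<lambda>_. 1))"
  define \<phi>C where "\<phi>C = laplace (C (\<lambda>_. 1))"
  define \<psi> where "\<psi> = laplace (?B (?B (\<lambda>_. 1)))"
  have psi: "laplace (A (A (\<lambda>_. 1))) = \<psi>"
    unfolding \<psi>_def by (rule ext, rule laplace_cong_AE[OF meas(1,2) AA[OF one]])
  have phi: "laplace (C (C (\<lambda>_. 1))) = \<phi>A"
    unfolding \<phi>A_def by (rule ext, rule laplace_cong_AE[OF meas(3,4) CC[OF one]])
  obtain K1 where K1: "0 \<le> K1" "\<And>x. 1 \<le> x \<Longrightarrow> \<bar>\<phi>A x * \<phi>A x - \<psi> x / x\<bar> \<le> K1 * exp (- (x * ?L))"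
    using laplace_multiplicative[OF p A A] unfolding psi \<phi>A_def[symmetric] by blast
  obtain K2 where K2: "0 \<le> K2" "\<And>x. 1 \<le> x \<Longrightarrow> \<bar>\<phi>B x * \<phi>B x - \<psi> x / x\<bar> \<le> K2 * exp (- (x * ?L))"
    using laplace_multiplicative[OF p B B] unfolding \<psi>_def[symmetric] \<phi>B_def[symmetric] by blast
  obtain K3 where K3: "0 \<le> K3" "\<And>x. 1 \<le> x \<Longrightarrow> \<bar>\<phi>C x * \<phi>C x - \<phi>A x / x\<bar> \<le> K3 * exp (- (x * ?L))"
    using laplace_multiplicative[OF p C C] unfolding phi \<phi>C_def[symmetric] by blast
  define G where "G s = (A (\<lambda>_. 1) s - ?B (\<lambda>_. 1) s) * h' s" for s
  have iD: "integrable M (\<lambda>s. A (\<lambda>_. 1) s - ?B (\<lambda>_. 1) s)" using iA iB by simp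
  have iG: "integrable M G" unfolding G_def by (rule integrable_times_h'[OF iD])
  have momG: "(LINT s|M. exp (x * (h b - h s)) * G s) = (\<phi>A x - \<phi>B x) * exp (x * ?L)" for x
  proof -
    have "(LINT s|M. exp (x * (h b - h s)) * G s) = laplace (\<lambda>s. A (\<lambda>_. 1) s - ?B (\<lambda>_. 1) s) x * exp_fun x b"
      unfolding laplace_times_exp_fun by (simp add: G_def mult.assoc)
    also have "laplace (\<lambda>s. A (\<lambda>_. 1) s - ?B (\<lambda>_. 1) s) x = \<phi>A x - \<phi>B x"
      unfolding \<phi>A_def \<phi>B_def laplace_def
      using laplace_integrable[OF iA, of x] laplace_integrable[OF iB, of x]
      by (subst Bochner_Integration.integral_diff[symmetric]) (auto simp: algebra_simps)
    finally show ?thesis by (simp add: exp_fun_def)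
  qed
  have zero: "(LINT s|M. (if s < t then G s else 0)) = 0" if t: "a < t" "t < b" for t
  proof -
    define c where "c = h b - h t"
    define \<delta> where "\<delta> = c / 2"
    have c: "0 < c" "c < ?L" using h_less[of t b] h_less[of a t] t by (auto simp: c_def)
    have "\<exists>t1. a \<le> t1 \<and> t1 \<le> b \<and> h t1 = h a + \<delta>"
      using c h_cont ab by (intro IVT') (auto simp: \<delta>_def)
    then obtain t1 where t1: "t1 \<in> {a..b}" "h t1 - h a = \<delta>" by auto
    define \<kappa> where "\<kappa> = frac_kernel (1 + (\<beta> + 1)) \<delta>"
    have \<kappa>: "0 < \<kappa>" using c \<beta> by (auto simp: \<kappa>_def frac_kernel_def \<delta>_def intro!: Gamma_real_pos)
    define d where "d = ?L - \<delta>"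
    have d: "0 < d" using c by (simp add: d_def \<delta>_def)
    \<comment> \<open>Beyond this bound the possible negative part of \<open>\<phi>A\<close> is at most half the lower bound
      for \<open>\<phi>B\<close>, since \<open>exp (- x d) \<le> 2 / (x d)\<^sup>2\<close>.\<close>
    define x0 where "x0 = max 1 (4 * K3 / (\<kappa> * d\<^sup>2))"
    have bound: "\<bar>LINT s|M. exp (x * (h b - h s)) * G s\<bar> \<le> ((K1 + K2) * 2 / \<kappa>) * exp (\<delta> * x)"
      if x: "x0 \<le> x" for x
    proof -
      have x1: "1 \<le> x" and xp: "0 < x" and xK: "4 * K3 / (\<kappa> * d\<^sup>2) \<le> x" using x by (auto simp: x0_def)
      let ?E = "exp (- (x * ?L))" and ?e = "exp (- (x * \<delta>))"
      have E: "?E = ?e * exp (- (x * d))"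
        by (simp add: exp_add[symmetric] d_def algebra_simps)
      have lowB: "\<kappa> * ?e \<le> \<phi>B x"
        using laplace_frac_int_lower[OF p \<beta> _ t1(1), of x] xp by (simp add: \<phi>B_def \<kappa>_def t1(2))
      have "x * K3 * exp (- (x * d)) \<le> \<kappa> / 2"
      proof -
        have xd: "0 < x * d" using xp d by simp
        have "(x * d)\<^sup>2 / 2 \<le> exp (x * d)"
          using exp_lower_Taylor_quadratic[of "x * d"] xd by simp
        then have "inverse (exp (x * d)) \<le> inverse ((x * d)\<^sup>2 / 2)"
          using xd by (intro le_imp_inverse_le) auto
        then have "exp (- (x * d)) \<le> 2 / (x * d)\<^sup>2" by (simp add: exp_minus)
        then have "x * K3 * exp (- (x * d)) \<le> x * K3 * (2 / (x * d)\<^sup>2)"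
          using xp K3(1) by (intro mult_left_mono) auto
        also have "\<dots> = (2 * K3 / d\<^sup>2) / x"
          using xp d by (simp add: power2_eq_square field_simps)
        also have "\<dots> \<le> \<kappa> / 2"
          using xK xp \<kappa> d by (simp add: field_simps)
        finally show ?thesis .
      qed
      then have small: "x * K3 * ?E \<le> \<kappa> / 2 * ?e"
        unfolding E using mult_right_mono[of "x * K3 * exp (- (x * d))" "\<kappa> / 2" ?e] by (simp add: mult_ac)
      have "- (K3 * ?E) \<le> \<phi>A x / x"
        using K3(2)[OF x1] zero_le_square[of "\<phi>C x"] unfolding abs_le_iff by linarith
      then have "- (x * K3 * ?E) \<le> \<phi>A x"
        using xp by (simp add: field_simps)
      then have sum: "\<kappa> / 2 * ?e \<le> \<phi>A x + \<phi>B x" using small lowB by simp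
      have "\<bar>\<phi>A x * \<phi>A x - \<phi>B x * \<phi>B x\<bar> \<le> (K1 + K2) * ?E"
        using K1(2)[OF x1] K2(2)[OF x1] by (simp add: distrib_right abs_le_iff)
      then have "\<bar>\<phi>A x - \<phi>B x\<bar> * \<bar>\<phi>A x + \<phi>B x\<bar> \<le> (K1 + K2) * ?E"
        by (simp add: abs_mult[symmetric] algebra_simps)
      moreover have "\<bar>\<phi>A x - \<phi>B x\<bar> * (\<kappa> / 2 * ?e) \<le> \<bar>\<phi>A x - \<phi>B x\<bar> * \<bar>\<phi>A x + \<phi>B x\<bar>"
        by (intro mult_left_mono order_trans[OF sum abs_ge_self]) auto
      ultimately have "\<bar>\<phi>A x - \<phi>B x\<bar> * (\<kappa> / 2 * ?e) \<le> (K1 + K2) * ?E" by linarith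
      then have "\<bar>\<phi>A x - \<phi>B x\<bar> * (\<kappa> / 2 * ?e) * (exp (x * ?L) * exp (x * \<delta>)) \<le>
          (K1 + K2) * ?E * (exp (x * ?L) * exp (x * \<delta>))"
        by (intro mult_right_mono) auto
      then have "\<bar>\<phi>A x - \<phi>B x\<bar> * exp (x * ?L) * (\<kappa> / 2) * (?e * exp (x * \<delta>)) \<le>
          (K1 + K2) * exp (x * \<delta>) * (?E * exp (x * ?L))"
        by (simp add: mult_ac)
      then have "\<bar>\<phi>A x - \<phi>B x\<bar> * exp (x * ?L) * (\<kappa> / 2) \<le> (K1 + K2) * exp (x * \<delta>)"
        by (simp add: exp_minus)
      then have "\<bar>\<phi>A x - \<phi>B x\<bar> * exp (x * ?L) \<le> (K1 + K2) * exp (x * \<delta>) / (\<kappa> / 2)"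
        using \<kappa> by (subst pos_le_divide_eq) auto
      also have "(K1 + K2) * exp (x * \<delta>) / (\<kappa> / 2) = ((K1 + K2) * 2 / \<kappa>) * exp (\<delta> * x)"
        by (simp add: mult.commute[of x \<delta>])
      finally show ?thesis unfolding momG by (simp only: abs_mult abs_exp_cancel)
    qed
    have "(LINT s|M. (if c < h b - h s then G s else 0)) = 0"
    proof (rule integral_superlevel_zero_if_moments_small[OF iG _ _ _ bound])
      show "h b - h s \<le> ?L" if "s \<in> space M" for s
        using that h_le_iff[of a s] ab by simp
      show "\<delta> < c" using c by (simp add: \<delta>_def)
      show "AE s in M. h b - h s \<noteq> c"
        using AE_not_point[of t] AE_space
        by eventually_elim (use t h_less_iff[of _ t] h_less_iff[of t] in \<open>auto simp: c_def neq_iff\<close>)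
    qed auto
    also have "(LINT s|M. (if c < h b - h s then G s else 0)) = (LINT s|M. (if s < t then G s else 0))"
      using t h_less_iff[of _ t] by (intro Bochner_Integration.integral_cong) (auto simp: c_def)
    finally show ?thesis .
  qed
  have "AE t in M. (LINT s|M. (if s < t then G s else 0)) = 0"
    using AE_not_point[of a] AE_not_point[of b] AE_space
    by eventually_elim (use zero in auto)
  then have "AE s in M. G s = 0"
    by (rule AE_zero_if_primitive_zero[OF ab iG])
  then show ?thesis
    using AE_space by eventually_elim (use h'_pos in \<open>fastforce simp: G_def\<close>)
qed

text \<open>
  An operator commuting with \<open>V\<close> is determined by its value at \<open>1\<close>: this determines it on
  all \<open>V\<^sup>n 1\<close>, hence on polynomials in \<open>h\<close>, which approximate every \<open>V f\<close> uniformly; finally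
  \<open>V\<close> is injective. Passing to \<open>V f\<close> avoids approximating \<open>f\<close> itself, which would be impossible
  for \<open>p = \<infinity>\<close>.
\<close>

lemma commutes_with_V_eqI:
  assumes p: "1 \<le> p" and A: "commutes_with_V p A" and B: "commutes_with_V p B"
    and eq1: "AE t in M. A (\<lambda>_. 1) t = B (\<lambda>_. 1) t" and f: "f \<in> Lp_space p M"
  shows "AE t in M. A f t = B f t"
proof -
  have bA: "Lp_bounded_operator p M A" and bB: "Lp_bounded_operator p M B"
    using A B by (auto simp: commutes_with_V_def)
  define agree where "agree g \<longleftrightarrow> g \<in> Lp_space p M \<and> (AE t in M. A g t = B g t)" for g
  have agree_cong: "agree g'" if g: "agree g" "g' \<in> Lp_space p M" "AE t in M. g' t = g t" for g g'
  proof -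
    have gp: "g \<in> Lp_space p M" and gAB: "AE t in M. A g t = B g t" using g(1) by (auto simp: agree_def)
    have "AE t in M. A g' t = A g t" by (rule Lp_bounded_operatorD(2)[OF bA g(2) gp g(3)])
    moreover have "AE t in M. B g' t = B g t" by (rule Lp_bounded_operatorD(2)[OF bB g(2) gp g(3)])
    ultimately have "AE t in M. A g' t = B g' t" using gAB by eventually_elim simp
    then show ?thesis using g(2) by (simp add: agree_def)
  qed
  have agree_lin: "agree (\<lambda>t. c * g t + d * g' t)" if "agree g" "agree g'" for g g' c d
  proof -
    have gp: "g \<in> Lp_space p M" "g' \<in> Lp_space p M" and ae: "AE t in M. A g t = B g t" "AE t in M. A g' t = B g' t"
      using that by (auto simp: agree_def)
    have "AE t in M. A (\<lambda>t. c * g t + d * g' t) t = B (\<lambda>t. c * g t + d * g' t) t"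
      using Lp_bounded_operator_lincomb[OF p bA gp, of c d] Lp_bounded_operator_lincomb[OF p bB gp, of c d] ae
      by eventually_elim simp
    then show ?thesis
      using Lp_add(1)[OF p Lp_scale(1)[OF p gp(1)] Lp_scale(1)[OF p gp(2)]] by (simp add: agree_def)
  qed
  have agree_V: "agree (V g)" if "agree g" for g
  proof -
    have gp: "g \<in> Lp_space p M" and ae: "AE t in M. A g t = B g t"
      using that by (auto simp: agree_def)
    have "V (A g) t = V (B g) t" for t
      by (rule V_cong_AE[OF Lp_space_measurable[OF Lp_bounded_operatorD(1)[OF bA gp]]
            Lp_space_measurable[OF Lp_bounded_operatorD(1)[OF bB gp]] ae])
    moreover have "AE t in M. A (V g) t = V (A g) t" "AE t in M. B (V g) t = V (B g) t"
      using A B gp by (auto simp: commutes_with_V_def)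
    ultimately have "AE t in M. A (V g) t = B (V g) t" by auto
    then show ?thesis using V_Lp[OF p gp] by (simp add: agree_def)
  qed
  have one: "agree (\<lambda>_. 1)" using eq1 Lp_const_1(1)[OF p] by (simp add: agree_def)
  have power_Lp: "(\<lambda>t. (h t - h a) ^ n) \<in> Lp_space p M" for n
  proof (rule Lp_bounded_function(1)[OF p, where B = "(h b - h a) ^ n"])
    show "AE t in M. \<bar>(h t - h a) ^ n\<bar> \<le> (h b - h a) ^ n"
      using h_le_iff[of a] h_le_iff[of _ b] ab by (intro AE_I2) (auto simp: power_abs intro!: power_mono)
  qed (use h_range_pos in auto)
  have agree_power: "agree (\<lambda>t. (h t - h a) ^ n)" for n
  proof (induction n)
    case 0
    show ?case using one by simp
  next
    case (Suc n)
    have fk: "frac_kernel (real k + 1) u = u ^ k / fact k" if "0 < u" for k u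
      using that Gamma_fact[of k, where 'a = real] by (simp add: frac_kernel_def powr_realpow add.commute)
    have "agree (V (\<lambda>t. (h t - h a) ^ n))" by (rule agree_V[OF Suc])
    from agree_lin[OF this this, of "real (Suc n)" 0]
    have "agree (\<lambda>t. real (Suc n) * V (\<lambda>t. (h t - h a) ^ n) t)" by simp
    then show ?case
    proof (rule agree_cong[OF _ power_Lp])
      have eq: "V (\<lambda>t. (h t - h a) ^ n) t = fact n * frac_kernel (1 + (real n + 1)) (h t - h a)"
        if t: "t \<in> {a..b}" for t
      proof -
        have "AE s in M. (h s - h a) ^ n = fact n * frac_kernel (real n + 1) (h s - h a)"
          using AE_not_point[of a] AE_space
          by eventually_elim (use h_less_iff[of a] ab in \<open>auto simp: fk\<close>)
        then have "V (\<lambda>t. (h t - h a) ^ n) t = V (\<lambda>s. fact n * frac_kernel (real n + 1) (h s - h a)) t"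
          by (intro V_cong_AE) auto
        also have "\<dots> = fact n * V (\<lambda>s. frac_kernel (real n + 1) (h s - h a)) t"
          unfolding conv_op_def by (simp add: mult_ac)
        also have "V (\<lambda>s. frac_kernel (real n + 1) (h s - h a)) t = frac_kernel (1 + (real n + 1)) (h t - h a)"
          using t by (intro frac_int_power) auto
        finally show ?thesis .
      qed
      show "AE t in M. (h t - h a) ^ Suc n = real (Suc n) * V (\<lambda>t. (h t - h a) ^ n) t"
        using AE_not_point[of a] AE_space
      proof eventually_elim
        case (elim t)
        then have t: "t \<in> {a..b}" and pos: "0 < h t - h a" using h_less_iff[of a t] ab by auto
        have "frac_kernel (1 + (real n + 1)) (h t - h a) = (h t - h a) ^ Suc n / (real (Suc n) * fact n)"
          using fk[OF pos, of "Suc n"] by (simp add: add_ac del: power_Suc)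
        then show ?case unfolding eq[OF t] by (simp del: power_Suc of_nat_Suc)
      qed
    qed
  qed
  have agree_poly: "agree (\<lambda>t. poly q (h t - h a))" for q
  proof -
    have "agree (\<lambda>t. \<Sum>i<n. coeff q i * (h t - h a) ^ i)" for n
    proof (induction n)
      case 0
      show ?case using agree_lin[OF one one, of 0 0] by simp
    next
      case (Suc n)
      show ?case using agree_lin[OF Suc agree_power, of 1 "coeff q n" n] by simp
    qed
    from this[of "Suc (degree q)"] show ?thesis
      by (simp add: poly_altdef lessThan_Suc_atMost)
  qed
  obtain CA where CA: "0 \<le> CA" "\<And>f B. f \<in> borel_measurable M \<Longrightarrow> 0 \<le> B \<Longrightarrow>
    (\<And>t. t \<in> {a..b} \<Longrightarrow> \<bar>f t\<bar> \<le> B) \<Longrightarrow> (LINT t|M. \<bar>A f t\<bar>) \<le> CA * B"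
    by (rule Lp_bounded_operator_L1_bound[OF p bA]) blast
  obtain CB where CB: "0 \<le> CB" "\<And>f D. f \<in> borel_measurable M \<Longrightarrow> 0 \<le> D \<Longrightarrow>
    (\<And>t. t \<in> {a..b} \<Longrightarrow> \<bar>f t\<bar> \<le> D) \<Longrightarrow> (LINT t|M. \<bar>B f t\<bar>) \<le> CB * D"
    by (rule Lp_bounded_operator_L1_bound[OF p bB]) blast
  note Vf = V_Lp[OF p f]
  note AVf = Lp_bounded_operatorD(1)[OF bA Vf] and BVf = Lp_bounded_operatorD(1)[OF bB Vf]
  have iAV: "integrable M (A (V f))" and iBV: "integrable M (B (V f))"
    by (rule Lp_imp_L1(1)[OF p AVf], rule Lp_imp_L1(1)[OF p BVf])
  interpret R: function_ring_on "range (\<lambda>q t. poly q (h t - h a))" "{a..b}"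
  proof
    show "compact {a..b}" by simp
    show "continuous_on {a..b} g" if "g \<in> range (\<lambda>q t. poly q (h t - h a))" for g
      using that by (auto intro!: continuous_intros h_cont)
    show "(\<lambda>t. g t + g' t) \<in> range (\<lambda>q t. poly q (h t - h a))"
      if "g \<in> range (\<lambda>q t. poly q (h t - h a))" "g' \<in> range (\<lambda>q t. poly q (h t - h a))" for g g'
      using that by (auto simp: poly_add[symmetric] simp del: poly_add)
    show "(\<lambda>t. g t * g' t) \<in> range (\<lambda>q t. poly q (h t - h a))"
      if "g \<in> range (\<lambda>q t. poly q (h t - h a))" "g' \<in> range (\<lambda>q t. poly q (h t - h a))" for g g'
      using that by (auto simp: poly_mult[symmetric] simp del: poly_mult)
    show "(\<lambda>_. c) \<in> range (\<lambda>q t. poly q (h t - h a))" for c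
      by (rule range_eqI[of _ _ "[:c:]"]) simp
    show "\<exists>g\<in>range (\<lambda>q t. poly q (h t - h a)). g x \<noteq> g y" if "x \<in> {a..b}" "y \<in> {a..b}" "x \<noteq> y" for x y
    proof -
      have "poly [:0, 1:] (h x - h a) \<noteq> poly [:0, 1:] (h y - h a)"
        using that h_less[of x y] h_less[of y x] by (cases x y rule: linorder_cases) auto
      then show ?thesis
        by (intro bexI[where x = "\<lambda>t. poly [:0, 1:] (h t - h a)"]) (auto intro: range_eqI[where x = "[:0, 1:]"])
    qed
  qed
  have small: "(LINT t|M. \<bar>A (V f) t - B (V f) t\<bar>) \<le> (CA + CB) * e" if e: "0 < e" for e
  proof -
    obtain q where q: "\<forall>t\<in>{a..b}. \<bar>V f t - poly q (h t - h a)\<bar> < e"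
      using R.Stone_Weierstrass_basic[OF V_continuous[OF Lp_imp_L1(1)[OF p f]] e] by auto
    let ?P = "\<lambda>t. poly q (h t - h a)"
    let ?g = "\<lambda>t. 1 * V f t + (-1) * ?P t"
    have P: "?P \<in> Lp_space p M" and PAB: "AE t in M. A ?P t = B ?P t"
      using agree_poly[of q] by (auto simp: agree_def)
    have gp: "?g \<in> Lp_space p M"
      by (rule Lp_add(1)[OF p Lp_scale(1)[OF p Vf] Lp_scale(1)[OF p P]])
    have iAg: "integrable M (A ?g)" and iBg: "integrable M (B ?g)"
      by (rule Lp_imp_L1(1)[OF p Lp_bounded_operatorD(1)[OF bA gp]],
          rule Lp_imp_L1(1)[OF p Lp_bounded_operatorD(1)[OF bB gp]])
    have "AE t in M. \<bar>A (V f) t - B (V f) t\<bar> \<le> \<bar>A ?g t\<bar> + \<bar>B ?g t\<bar>"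
      using Lp_bounded_operator_lincomb[OF p bA Vf P, of 1 "-1"]
        Lp_bounded_operator_lincomb[OF p bB Vf P, of 1 "-1"] PAB
      by eventually_elim simp
    then have "(LINT t|M. \<bar>A (V f) t - B (V f) t\<bar>) \<le> (LINT t|M. \<bar>A ?g t\<bar> + \<bar>B ?g t\<bar>)"
      using iAg iBg iAV iBV
      by (intro integral_mono_AE integrable_abs Bochner_Integration.integrable_diff Bochner_Integration.integrable_add)
    also have "\<dots> = (LINT t|M. \<bar>A ?g t\<bar>) + (LINT t|M. \<bar>B ?g t\<bar>)"
      using integrable_abs[OF iAg] integrable_abs[OF iBg] by (rule Bochner_Integration.integral_add)
    also have "\<dots> \<le> CA * e + CB * e"
      using q e less_imp_le by (intro add_mono CA(2) CB(2) Lp_space_measurable[OF gp]) fastforce+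
    finally show ?thesis by (simp add: distrib_right)
  qed
  have "(LINT t|M. \<bar>A (V f) t - B (V f) t\<bar>) \<le> 0"
  proof (rule field_le_epsilon)
    fix e :: real assume e: "0 < e"
    have "(LINT t|M. \<bar>A (V f) t - B (V f) t\<bar>) \<le> (CA + CB) * (e / (CA + CB + 1))"
      using e CA(1) CB(1) by (intro small) simp
    also have "\<dots> \<le> e" using e CA(1) CB(1) by (simp add: field_simps)
    finally show "(LINT t|M. \<bar>A (V f) t - B (V f) t\<bar>) \<le> 0 + e" by simp
  qed
  then have "(LINT t|M. \<bar>A (V f) t - B (V f) t\<bar>) = 0"
    by (intro antisym) (auto intro!: Bochner_Integration.integral_nonneg)
  moreover have "integrable M (\<lambda>t. \<bar>A (V f) t - B (V f) t\<bar>)"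
    by (intro integrable_abs Bochner_Integration.integrable_diff iAV iBV)
  ultimately have "AE t in M. \<bar>A (V f) t - B (V f) t\<bar> = 0"
    using integral_nonneg_eq_0_iff_AE[of M "\<lambda>t. \<bar>A (V f) t - B (V f) t\<bar>"] by simp
  moreover have "AE t in M. A (V f) t = V (A f) t" "AE t in M. B (V f) t = V (B f) t"
    using A B f by (auto simp: commutes_with_V_def)
  ultimately have VAB: "AE t in M. V (A f) t - V (B f) t = 0" by eventually_elim simp
  have iA: "integrable M (A f)" and iB: "integrable M (B f)"
    by (rule Lp_imp_L1(1)[OF p Lp_bounded_operatorD(1)[OF bA f]],
        rule Lp_imp_L1(1)[OF p Lp_bounded_operatorD(1)[OF bB f]])
  have V0: "AE t in M. V (\<lambda>s. 1 * A f s + (-1) * B f s) t = 0"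
    using VAB AE_space
  proof eventually_elim
    case (elim t)
    then have t: "t \<in> {a..b}" by simp
    show ?case
      unfolding conv_op_lincomb[OF V_integrable[OF iA t] V_integrable[OF iB t]] using elim(1) by simp
  qed
  have "integrable M (\<lambda>s. 1 * A f s + (-1) * B f s)"
    by (intro Bochner_Integration.integrable_add integrable_mult_right iA iB)
  then have "AE t in M. 1 * A f t + (-1) * B f t = 0"
    using V0 by (rule V_injective)
  then show ?thesis by eventually_elim simp
qed

end

section \<open>Uniqueness of the family\<close>

lemma Lp_norm_diff_le_onorm:
  assumes p: "1 \<le> p" and S: "Lp_bounded_operator p N S" and T: "Lp_bounded_operator p N T"
    and f: "f \<in> Lp_space p N"
  shows "Lp_norm p N (\<lambda>t. S f t - T f t) \<le> Lp_onorm p N (\<lambda>f t. S f t - T f t) * Lp_norm p N f"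
proof -
  obtain C where C: "0 \<le> C" "\<And>f. f \<in> Lp_space p N \<Longrightarrow> Lp_norm p N (S f) \<le> C * Lp_norm p N f"
    by (rule Lp_bounded_operator_bound[OF S]) blast
  obtain D where D: "0 \<le> D" "\<And>f. f \<in> Lp_space p N \<Longrightarrow> Lp_norm p N (T f) \<le> D * Lp_norm p N f"
    by (rule Lp_bounded_operator_bound[OF T]) blast
  show ?thesis
  proof (rule Lp_norm_le_onorm[OF p, where C = "4 * (C + D)"])
    fix g assume g: "g \<in> Lp_space p N"
    note Sg = Lp_bounded_operatorD(1)[OF S g] and Tg = Lp_bounded_operatorD(1)[OF T g]
    show "(\<lambda>t. S g t - T g t) \<in> Lp_space p N" by (rule Lp_diff(1)[OF p Sg Tg])
    show "Lp_norm p N (\<lambda>t. S g t - T g t) \<le> 4 * (C + D) * Lp_norm p N g"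
      using Lp_diff(2)[OF p Sg Tg] C(2)[OF g] D(2)[OF g] by (simp add: distrib_right)
    show "AE t in N. S (\<lambda>y. c * g y) t - T (\<lambda>y. c * g y) t = c * (S g t - T g t)" for c
      using Lp_bounded_operatorD(4)[OF S g, of c] Lp_bounded_operatorD(4)[OF T g, of c]
      by eventually_elim (simp add: right_diff_distrib)
  qed (use C D f in auto)
qed

context increasing_C1 begin

lemma family_at_1:
  assumes p: "1 \<le> p" and J: "fractional_integral_family p a b h' J" and f: "f \<in> Lp_space p M"
  shows "AE t in M. J 1 f t = V f t"
proof -
  have "AE t in M. J 1 f t = (LINT s:{a..t}|lebesgue. f s * h' s)"
    using J f by (auto simp: fractional_integral_family_def Lp_op_eq_def)
  moreover have "AE t in M. RL_integral h h' a 1 f t = (LINT s:{a..t}|lebesgue. f s * h' s)"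
    using RL_integral_family[OF p] f by (auto simp: fractional_integral_family_def Lp_op_eq_def)
  ultimately show ?thesis
    using AE_space by eventually_elim (simp add: RL_integral_eq_frac_int)
qed

lemma family_commutes_with_V:
  assumes p: "1 \<le> p" and J: "fractional_integral_family p a b h' J" and \<alpha>: "0 < \<alpha>"
  shows "commutes_with_V p (J \<alpha>)"
  unfolding commutes_with_V_def
proof (intro conjI ballI)
  have bJ: "Lp_bounded_operator p M (J \<beta>)" if "0 < \<beta>" for \<beta>
    using J that by (auto simp: fractional_integral_family_def)
  show "Lp_bounded_operator p M (J \<alpha>)" by (rule bJ[OF \<alpha>])
  have idx: "AE t in M. J \<beta> (J \<gamma> g) t = J (\<beta> + \<gamma>) g t"
    if "0 < \<beta>" "0 < \<gamma>" "g \<in> Lp_space p M" for \<beta> \<gamma> g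
    using J that by (auto simp: fractional_integral_family_def Lp_op_eq_def)
  fix f assume f: "f \<in> Lp_space p M"
  note J\<alpha>f = Lp_bounded_operatorD(1)[OF bJ[OF \<alpha>] f]
  have J1: "AE t in M. J 1 g t = V g t" if g: "g \<in> Lp_space p M" for g
    by (rule family_at_1[OF p J g])
  note J1f = Lp_bounded_operatorD(1)[OF bJ[of 1] f, simplified]
  have "AE t in M. J \<alpha> (V f) t = J \<alpha> (J 1 f) t"
    using J1[OF f] by (intro Lp_bounded_operatorD(2)[OF bJ[OF \<alpha>] V_Lp[OF p f] J1f]) (auto elim: eventually_mono)
  moreover have "AE t in M. J \<alpha> (J 1 f) t = J (\<alpha> + 1) f t" using \<alpha> f by (intro idx) auto
  moreover have "AE t in M. J 1 (J \<alpha> f) t = J (1 + \<alpha>) f t" using \<alpha> f by (intro idx) auto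
  ultimately show "AE t in M. J \<alpha> (V f) t = V (J \<alpha> f) t"
    using J1[OF J\<alpha>f] by eventually_elim (simp add: add.commute)
qed

text \<open>
  Half the order is determined by the whole order. A quarter of the order enters as
  well, since it exhibits the operator of half the order as a square.
\<close>

lemma family_halve:
  assumes p: "1 \<le> p" and J: "fractional_integral_family p a b h' J" and \<alpha>: "0 < \<alpha>"
    and eq: "\<And>f. f \<in> Lp_space p M \<Longrightarrow> AE t in M. J \<alpha> f t = frac_int \<alpha> f t"
    and f: "f \<in> Lp_space p M"
  shows "AE t in M. J (\<alpha>/2) f t = frac_int (\<alpha>/2) f t"
proof -
  have idx: "AE t in M. J \<beta> (J \<beta> g) t = J (\<beta> + \<beta>) g t"
    if "0 < \<beta>" "g \<in> Lp_space p M" for \<beta> g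
    using J that unfolding fractional_integral_family_def Lp_op_eq_def o_apply by blast
  have A: "commutes_with_V p (J (\<alpha>/2))" and C: "commutes_with_V p (J (\<alpha>/4))"
    using \<alpha> by (auto intro!: family_commutes_with_V[OF p J])
  have "AE t in M. J (\<alpha>/2) (\<lambda>_. 1) t = frac_int (\<alpha>/2) (\<lambda>_. 1) t"
  proof (rule square_root_apply_one[OF p _ A C])
    fix g assume g: "g \<in> Lp_space p M"
    show "AE t in M. J (\<alpha>/4) (J (\<alpha>/4) g) t = J (\<alpha>/2) g t"
      using idx[of "\<alpha>/4" g] \<alpha> g by simp
    have "AE t in M. frac_int (\<alpha>/2) (frac_int (\<alpha>/2) g) t = frac_int (\<alpha>/2 + \<alpha>/2) g t"
      using \<alpha> by (intro frac_int_frac_int Lp_imp_L1(1)[OF p g]) auto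
    with idx[of "\<alpha>/2" g] eq[OF g] \<alpha> g
    show "AE t in M. J (\<alpha>/2) (J (\<alpha>/2) g) t = frac_int (\<alpha>/2) (frac_int (\<alpha>/2) g) t"
      by (auto elim: eventually_elim2)
  qed (use \<alpha> in auto)
  then show ?thesis
    using \<alpha> by (intro commutes_with_V_eqI[OF p A frac_int_commutes_with_V[OF p] _ f]) auto
qed

lemma family_dyadic:
  assumes p: "1 \<le> p" and J: "fractional_integral_family p a b h' J" and f: "f \<in> Lp_space p M"
  shows "AE t in M. J (real (Suc m) / 2 ^ n) f t = frac_int (real (Suc m) / 2 ^ n) f t"
proof -
  have unit: "AE t in M. J (1 / 2 ^ n) g t = frac_int (1 / 2 ^ n) g t" if "g \<in> Lp_space p M" for g
    using that
  proof (induction n arbitrary: g)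
    case 0
    then show ?case using family_at_1[OF p J] by simp
  next
    case (Suc n)
    have "AE t in M. J (1 / 2 ^ n / 2) g t = frac_int (1 / 2 ^ n / 2) g t"
      by (rule family_halve[OF p J _ Suc.IH Suc.prems]) auto
    then show ?case by (simp add: mult.commute)
  qed
  define q :: real where "q = 1 / 2 ^ n"
  have q: "0 < q" by (simp add: q_def)
  have bJ: "Lp_bounded_operator p M (J q)"
    using J q by (auto simp: fractional_integral_family_def)
  have "AE t in M. J (real (Suc m) * q) f t = frac_int (real (Suc m) * q) f t"
  proof (induction m)
    case 0
    show ?case using unit[OF f] by (simp add: q_def)
  next
    case (Suc m)
    let ?r = "real (Suc m) * q"
    have r: "0 < ?r" using q by simp
    have sum: "real (Suc (Suc m)) * q = q + ?r" by (simp add: algebra_simps)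
    have bJr: "Lp_bounded_operator p M (J ?r)"
      using J r unfolding fractional_integral_family_def by blast
    note Jr = Lp_bounded_operatorD(1)[OF bJr f] and Ir = conv_op_Lp(1)[OF p kernel_frac[OF r] f]
    have "AE t in M. J q (J ?r f) t = J (q + ?r) f t"
      using J q r f unfolding fractional_integral_family_def Lp_op_eq_def o_apply by blast
    moreover have "AE t in M. J q (J ?r f) t = J q (frac_int ?r f) t"
      by (rule Lp_bounded_operatorD(2)[OF bJ Jr Ir Suc])
    moreover have "AE t in M. J q (frac_int ?r f) t = frac_int q (frac_int ?r f) t"
      using unit[OF Ir] by (simp add: q_def)
    moreover have "AE t in M. frac_int q (frac_int ?r f) t = frac_int (q + ?r) f t"
      using q r by (intro frac_int_frac_int Lp_imp_L1(1)[OF p f])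
    ultimately show ?case unfolding sum by eventually_elim simp
  qed
  then show ?thesis by (simp add: q_def)
qed

text \<open>
  Both families are norm continuous and agree at dyadic orders. The limit is taken in the
  \<open>L\<^sup>1\<close> norm, which every \<open>L\<^sup>p\<close> norm dominates.
\<close>

lemma family_unique:
  assumes p: "1 \<le> p" and J: "fractional_integral_family p a b h' J" and \<alpha>: "0 < \<alpha>"
    and f: "f \<in> Lp_space p M"
  shows "AE t in M. J \<alpha> f t = RL_integral h h' a \<alpha> f t"
proof -
  let ?I = "RL_integral h h' a"
  note fam = RL_integral_family[OF p]
  have bJ: "Lp_bounded_operator p M (J \<beta>)" and bI: "Lp_bounded_operator p M (?I \<beta>)" if "0 < \<beta>" for \<beta>
    using J fam that by (auto simp: fractional_integral_family_def)
  \<comment> \<open>Dyadic approximations from above, so that they differ from \<open>\<alpha>\<close> also when \<open>\<alpha>\<close> is dyadic.\<close>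
  define m where "m n = nat \<lfloor>\<alpha> * 2 ^ n\<rfloor>" for n :: nat
  define q where "q n = real (Suc (m n)) / 2 ^ n" for n
  have q_gt: "\<alpha> < q n" and q_le: "q n \<le> \<alpha> + (1/2) ^ n" for n
  proof -
    have m: "real (m n) = of_int \<lfloor>\<alpha> * 2 ^ n\<rfloor>" using \<alpha> by (simp add: m_def)
    have "\<alpha> * 2 ^ n < real (Suc (m n))" unfolding of_nat_Suc m by linarith
    then show "\<alpha> < q n" by (simp add: q_def pos_less_divide_eq)
    have "real (Suc (m n)) \<le> \<alpha> * 2 ^ n + 1" unfolding of_nat_Suc m by linarith
    then show "q n \<le> \<alpha> + (1/2) ^ n"
      by (simp add: q_def pos_divide_le_eq distrib_right power_mult_distrib[symmetric])
  qed
  have "q \<longlonglongrightarrow> \<alpha>"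
  proof (rule tendsto_sandwich[where f = "\<lambda>_. \<alpha>" and h = "\<lambda>n. \<alpha> + (1/2) ^ n"])
    show "(\<lambda>n. \<alpha> + (1/2) ^ n) \<longlonglongrightarrow> \<alpha>"
      using tendsto_add[OF tendsto_const[of \<alpha>] LIMSEQ_power_zero[of "1/2 :: real"]] by simp
  qed (use q_gt q_le in \<open>auto intro: less_imp_le always_eventually\<close>)
  then have lim: "filterlim q (at \<alpha> within {0<..}) sequentially"
    unfolding filterlim_at using q_gt \<alpha> by (auto intro!: always_eventually simp: less_trans[OF \<alpha>] less_imp_neq[THEN not_sym])
  have q0: "0 < q n" for n using q_gt[of n] \<alpha> by linarith
  let ?NJ = "\<lambda>\<beta>. Lp_onorm p M (\<lambda>f t. J \<beta> f t - J \<alpha> f t)"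
  let ?NI = "\<lambda>\<beta>. Lp_onorm p M (\<lambda>f t. ?I \<beta> f t - ?I \<alpha> f t)"
  have NJ: "(?NJ \<longlongrightarrow> 0) (at \<alpha> within {0<..})" and NI: "(?NI \<longlongrightarrow> 0) (at \<alpha> within {0<..})"
    using J fam \<alpha> unfolding fractional_integral_family_def by blast+
  have "(\<lambda>n. (1 + measure M (space M)) * ((?NJ (q n) + ?NI (q n)) * Lp_norm p M f)) \<longlonglongrightarrow>
      (1 + measure M (space M)) * ((0 + 0) * Lp_norm p M f)"
    by (intro tendsto_intros filterlim_compose[OF NJ lim] filterlim_compose[OF NI lim])
  then have lim0: "(\<lambda>n. (1 + measure M (space M)) * ((?NJ (q n) + ?NI (q n)) * Lp_norm p M f)) \<longlonglongrightarrow> 0"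
    by simp
  note J\<alpha> = Lp_bounded_operatorD(1)[OF bJ[OF \<alpha>] f] and I\<alpha> = Lp_bounded_operatorD(1)[OF bI[OF \<alpha>] f]
  have int: "integrable M (\<lambda>t. \<bar>J \<alpha> f t - ?I \<alpha> f t\<bar>)"
    by (intro integrable_abs Bochner_Integration.integrable_diff Lp_imp_L1(1)[OF p J\<alpha>] Lp_imp_L1(1)[OF p I\<alpha>])
  have "(LINT t|M. \<bar>J \<alpha> f t - ?I \<alpha> f t\<bar>) \<le>
      (1 + measure M (space M)) * ((?NJ (q n) + ?NI (q n)) * Lp_norm p M f)" for n
  proof -
    note Jq = Lp_bounded_operatorD(1)[OF bJ[OF q0[of n]] f] and Iq = Lp_bounded_operatorD(1)[OF bI[OF q0[of n]] f]
    note dJ = Lp_diff(1)[OF p Jq J\<alpha>] and dI = Lp_diff(1)[OF p Iq I\<alpha>]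
    have iJ: "integrable M (\<lambda>t. \<bar>J (q n) f t - J \<alpha> f t\<bar>)" and iI: "integrable M (\<lambda>t. \<bar>?I (q n) f t - ?I \<alpha> f t\<bar>)"
      by (rule integrable_abs[OF Lp_imp_L1(1)[OF p dJ]], rule integrable_abs[OF Lp_imp_L1(1)[OF p dI]])
    have "AE t in M. J (q n) f t = ?I (q n) f t"
      using family_dyadic[OF p J f, of "m n" n] AE_space
      by eventually_elim (simp add: q_def RL_integral_eq_frac_int)
    then have "AE t in M. \<bar>J \<alpha> f t - ?I \<alpha> f t\<bar> \<le> \<bar>J (q n) f t - J \<alpha> f t\<bar> + \<bar>?I (q n) f t - ?I \<alpha> f t\<bar>"
      by eventually_elim linarith
    then have "(LINT t|M. \<bar>J \<alpha> f t - ?I \<alpha> f t\<bar>) \<le>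
        (LINT t|M. \<bar>J (q n) f t - J \<alpha> f t\<bar> + \<bar>?I (q n) f t - ?I \<alpha> f t\<bar>)"
      by (intro integral_mono_AE int Bochner_Integration.integrable_add iJ iI)
    also have "\<dots> = (LINT t|M. \<bar>J (q n) f t - J \<alpha> f t\<bar>) + (LINT t|M. \<bar>?I (q n) f t - ?I \<alpha> f t\<bar>)"
      by (rule Bochner_Integration.integral_add[OF iJ iI])
    also have "\<dots> \<le> (1 + measure M (space M)) * (?NJ (q n) * Lp_norm p M f) +
        (1 + measure M (space M)) * (?NI (q n) * Lp_norm p M f)"
    proof (intro add_mono order_trans[OF Lp_imp_L1(2)[OF p dJ]] order_trans[OF Lp_imp_L1(2)[OF p dI]] mult_left_mono)
      show "Lp_norm p M (\<lambda>t. J (q n) f t - J \<alpha> f t) \<le> ?NJ (q n) * Lp_norm p M f"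
        by (rule Lp_norm_diff_le_onorm[OF p bJ[OF q0] bJ[OF \<alpha>] f])
      show "Lp_norm p M (\<lambda>t. ?I (q n) f t - ?I \<alpha> f t) \<le> ?NI (q n) * Lp_norm p M f"
        by (rule Lp_norm_diff_le_onorm[OF p bI[OF q0] bI[OF \<alpha>] f])
    qed auto
    finally show ?thesis by (simp add: algebra_simps)
  qed
  then have "(LINT t|M. \<bar>J \<alpha> f t - ?I \<alpha> f t\<bar>) \<le> 0"
    by (intro LIMSEQ_le_const[OF lim0]) auto
  then have "(LINT t|M. \<bar>J \<alpha> f t - ?I \<alpha> f t\<bar>) = 0"
    by (intro antisym) (auto intro!: Bochner_Integration.integral_nonneg)
  then have "AE t in M. \<bar>J \<alpha> f t - ?I \<alpha> f t\<bar> = 0"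
    using integral_nonneg_eq_0_iff_AE[OF int] by simp
  then show ?thesis by eventually_elim simp
qed

end

theorem theorem3p1:
  fixes a b :: real and p :: ennreal and h h' :: "real \<Rightarrow> real"
  assumes "a < b"
    and "1 \<le> p"
    and "\<And>t. t \<in> {a..b} \<Longrightarrow> (h has_real_derivative h' t) (at t within {a..b})"
    and "continuous_on {a..b} h'"
    and "\<And>t. t \<in> {a..b} \<Longrightarrow> h' t > 0"
  shows "fractional_integral_family p a b h' (RL_integral h h' a) \<and>
         (\<forall>J. fractional_integral_family p a b h' J \<longrightarrow>
            (\<forall>\<alpha>>0. Lp_op_eq p (lebesgue_on {a..b}) (J \<alpha>) (RL_integral h h' a \<alpha>)))"
proof -
  interpret increasing_C1 a b h h'
    by unfold_locales (use assms in auto)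
  show ?thesis
    using RL_integral_family[OF assms(2)] family_unique[OF assms(2)] by (auto simp: Lp_op_eq_def)
qed

end
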